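(* Consider the panel $y_{i,t}=\alpha_i+\beta_i'\lambda+\beta_i'v_t+u_{i,t}$, $v_t=f_t-\mathbb{E}(f_t)$, $1\le i\le N$, $1\le t\le T$, with $f_t\in\mathbb{R}^K$ observed, and suppose that for some $\nu\ge 4$: (A1) for all $1\le i\le N$, $\{u_{i,t},-\infty<t<\infty\}$ is an $\mathcal{L}_\nu$-decomposable Bernoulli shift with $a>(\nu-1)/(\nu-2)$, $\mathbb{E}u_{i,t}=0$ and $\min_{1\le i\le N}\mathbb{E}u_{i,t}^2>0$; (A2) $\{f_t,-\infty<t<\infty\}$ is a $K$-dimensional $\mathcal{L}_\nu$-decomposable Bernoulli shift with $a>(\nu-1)/(\nu-2)$ and positive definite covariance matrix; (A3) $\mathbb{E}(f_tu_{i,t})=0$ for all $1\le i\le N$; (A4) $N=O\big(T^{\frac12(\frac{\nu}{2}-1)-\varepsilon}\big)$ for some $\varepsilon>0$; (B1) $\lambda$ and $\beta_i$ are fixed with $\|\lambda\|<\infty$ and $\max_{1\le i\le N}\|\beta_i\|<\infty$, and $\mathbf{S}_\beta=\frac1N\sum_{i=1}^N(\beta_i-\overline\beta)(\beta_i-\overline\beta)'$, $\overline\beta=\frac1N\sum_{i=1}^N\beta_i$, is positive definite for all values of $N$; (B2) $\{u_{i,t},1\le t\le T\}$ and $\{f_t,1\le t\le T\}$ are two mutually independent groups, and $\sum_{i=1}^N\sum_{j=1}^N\sum_{s=1}^T\sum_{t=1}^T|\mathbb{E}(u_{i,t}u_{j,s})|\le c_0NT$. Let $Z^{FM}_{N,T}=\max_{1\le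 i\le N}(\psi^{FM}_{i,NT}+\omega_i)$, with $a_N,b_N,\mathbb{P}^*$ as in the context. If $\mathbb{H}_0:\alpha_i=0$ for all $1\le i\le N$ holds, then $$\lim_{\min\{N,T\}\to\infty}\mathbb{P}^*\left[a_N^{-1}(Z^{FM}_{N,T}-b_N)\le x\right]=\exp(-\exp(-x))$$ for almost all realizations of $\{(u_{i,t},f_t')',1\le i\le N,1\le t\le T\}$ and all $-\infty<x<\infty$. If $\mathbb{H}_A:\alpha_i\ne0$ for at least one $1\le i\le N$ holds, then $$\lim_{\min\{N,T\}\to\infty}\mathbb{P}^*\left[a_N^{-1}(Z^{FM}_{N,T}-b_N)\le x\right]=0$$ for almost all realizations of $\{(u_{i,t},f_t')',1\le i\le N,1\le t\le T\}$ and all $-\infty<x<\infty$.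
   Context: Norm: $|X|_r=(\mathbb{E}\|X\|^r)^{1/r}$; $\|\cdot\|$ is the Euclidean norm. $c_0$ denotes a positive, finite constant. $\alpha_i\in\mathbb{R}$, $\beta_i\in\mathbb{R}^K$, $\lambda\in\mathbb{R}^K$ (risk premia) are unknown. Definition ($\mathcal{L}_\nu$-decomposable Bernoulli shift): $\{m_t,-\infty<t<\infty\}$ is an $\mathcal{L}_\nu$-decomposable Bernoulli shift if and only if $m_t=g(\eta_t,\eta_{t-1},\dots)$ where (i) $g:S^\infty\to\mathbb{R}^k$ is a nonrandom measurable function; (ii) $\{\eta_t\}$ is an i.i.d. sequence with values in a measurable space $S$; (iii) $|m_t|_\nu<\infty$; (iv) $|m_t-m^*_{t,\ell}|_\nu\le c_0\ell^{-a}$ for some $c_0>0$, $a>0$, where $m^*_{t,\ell}=g(\eta_t,\dots,\eta_{t-\ell+1},\eta^*_{t-\ell,t,\ell},\eta^*_{t-\ell-1,t,\ell},\dots)$ and $\{\eta^*_{s,t,\ell},-\infty<s,\ell,t<\infty\}$ are i.i.d. copies of $\eta_0$ independent of $\{\eta_t\}$. The exponent "$a$" in the assumptions is the one in (iv). Fama–MacBeth estimation: $\mathbb{M}_{1_N}=\mathbb{I}_N-N^{-1}\iota_N\iota_N'$ with $\iota_N$ the $N$-vector of ones; $\overline y_i=T^{-1}\sum_ty_{i,t}$, $\overline{\mathbf y}=(\overline y_1,\dots,\overline y_N)'$, $\overline f=T^{-1}\sum_tf_t$; $\widehat\beta_i=\big[\sum_t(f_t-\overline f)(f_t-\overline f)'\big]^{-1}\big[\sum_t(f_t-\overline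 f)(y_{i,t}-\overline y_i)\big]$, $\widehat{\boldsymbol\beta}=(\widehat\beta_1,\dots,\widehat\beta_N)'$; $\widehat\lambda=(\widehat{\boldsymbol\beta}'\mathbb{M}_{1_N}\widehat{\boldsymbol\beta})^{-1}(\widehat{\boldsymbol\beta}'\mathbb{M}_{1_N}\overline{\mathbf y})$; $\widehat\alpha_i^{FM}=\overline y_i-\widehat\beta_i'\widehat\lambda$; residuals $\widehat u_{i,t}^{FM}=y_{i,t}-(\widehat\alpha_i^{FM}+\widehat\beta_i'f_t)$. Statistic: $\widehat s_{NT}^{FM}=\sqrt{(NT)^{-1}\sum_{i,t}(\widehat u_{i,t}^{FM})^2}$, $\psi^{FM}_{i,NT}=\big|T^{1/\nu}\widehat\alpha_i^{FM}/\widehat s_{NT}^{FM}\big|^{\nu/2}$; the $\omega_i$ are i.i.d. $\mathcal{N}(0,1)$ generated independently of the sample $\{(u_{i,t},f_t')',1\le i\le N,1\le t\le T\}$. Norming: $b_N=\sqrt{2\log N}-\dfrac{\log\log N+\log(4\pi)}{2\sqrt{2\log N}}$, $a_N=\dfrac{b_N}{1+b_N^2}$. $\mathbb{P}^*$ is probability conditional on the sample.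
   Formalization: H_A is read as: α_i is not of the form β_i'c for all i (otherwise the panel also satisfies H_0 with λ+c). S_β has smallest eigenvalue bounded below for all large N (it is singular for N≤K). Moments of u_i, c_0, lower bound of E u_i² and bound on β_i are uniform in i. *)

theory Defs
  imports "HOL-Probability.Probability"
begin

definition Lnorm :: "'w measure \<Rightarrow> real \<Rightarrow> ('w \<Rightarrow> 'b::euclidean_space) \<Rightarrow> real" where
  "Lnorm M r X = (\<integral>\<omega>. norm (X \<omega>) powr r \<partial>M) powr (1 / r)"

definition iid_copies ::
  "'w measure \<Rightarrow> 's measure \<Rightarrow> (int \<Rightarrow> 'w \<Rightarrow> 's) \<Rightarrow> (int \<Rightarrow> int \<Rightarrow> nat \<Rightarrow> 'w \<Rightarrow> 's) \<Rightarrow> bool" where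
  "iid_copies M S \<eta> \<eta>s \<longleftrightarrow>
     prob_space.indep_vars M (\<lambda>_. S) (case_sum \<eta> (\<lambda>(s, t, l). \<eta>s s t l)) UNIV \<and>
     (\<forall>t. distr M S (\<eta> t) = distr M S (\<eta> 0)) \<and>
     (\<forall>s t l. distr M S (\<eta>s s t l) = distr M S (\<eta> 0))"

definition coupled ::
  "((nat \<Rightarrow> 's) \<Rightarrow> 'b) \<Rightarrow> (int \<Rightarrow> 'w \<Rightarrow> 's) \<Rightarrow> (int \<Rightarrow> int \<Rightarrow> nat \<Rightarrow> 'w \<Rightarrow> 's) \<Rightarrow> int \<Rightarrow> nat \<Rightarrow> 'w \<Rightarrow> 'b" where
  "coupled g \<eta> \<eta>s t l \<omega> =
     g (\<lambda>n. if n < l then \<eta> (t - int n) \<omega> else \<eta>s (t - int n) t l \<omega>)"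

(* The constant c and the exponent a are arguments, so that a family of shifts
   can be required to share them. The lag starts at 1: in Isabelle
   0 powr (-a) = 0, whereas the bound at lag 0 is meant to be void. *)
definition decomposable_shift ::
  "'w measure \<Rightarrow> real \<Rightarrow> real \<Rightarrow> real \<Rightarrow> 's measure \<Rightarrow> ((nat \<Rightarrow> 's) \<Rightarrow> 'b) \<Rightarrow> (int \<Rightarrow> 'w \<Rightarrow> 's) \<Rightarrow>
   (int \<Rightarrow> int \<Rightarrow> nat \<Rightarrow> 'w \<Rightarrow> 's) \<Rightarrow> (int \<Rightarrow> 'w \<Rightarrow> 'b::euclidean_space) \<Rightarrow> bool" where
  "decomposable_shift M \<nu> a c S g \<eta> \<eta>s m \<longleftrightarrow>
     a > 0 \<and> c > 0 \<and>
     g \<in> borel_measurable (\<Pi>\<^sub>M n\<in>UNIV. S) \<and>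
     iid_copies M S \<eta> \<eta>s \<and>
     (\<forall>t. \<forall>\<omega>\<in>space M. m t \<omega> = g (\<lambda>n. \<eta> (t - int n) \<omega>)) \<and>
     (\<forall>t. integrable M (\<lambda>\<omega>. norm (m t \<omega>) powr \<nu>)) \<and>
     (\<forall>t. \<forall>l\<ge>1. Lnorm M \<nu> (\<lambda>\<omega>. m t \<omega> - coupled g \<eta> \<eta>s t l \<omega>) \<le> c * real l powr (- a))"

definition outer :: "real^'k \<Rightarrow> real^'k \<Rightarrow> real^'k^'k" where
  "outer x y = (\<chi> i j. x $ i * y $ j)"

definition pos_def :: "real^'k^'k \<Rightarrow> bool" where
  "pos_def A \<longleftrightarrow> transpose A = A \<and> (\<forall>x. x \<noteq> 0 \<longrightarrow> x \<bullet> (A *v x) > 0)"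

definition covariance_matrix :: "'w measure \<Rightarrow> ('w \<Rightarrow> real^'k) \<Rightarrow> real^'k^'k" where
  "covariance_matrix M X =
     (\<integral>\<omega>. outer (X \<omega> - integral\<^sup>L M X) (X \<omega> - integral\<^sup>L M X) \<partial>M)"

definition S_beta :: "(nat \<Rightarrow> real^'k) \<Rightarrow> nat \<Rightarrow> real^'k^'k" where
  "S_beta \<beta> N = (let bb = (1 / real N) *\<^sub>R (\<Sum>i\<in>{1..N}. \<beta> i) in
     (1 / real N) *\<^sub>R (\<Sum>i\<in>{1..N}. outer (\<beta> i - bb) (\<beta> i - bb)))"

definition indep_rv ::
  "'w measure \<Rightarrow> 'b measure \<Rightarrow> ('w \<Rightarrow> 'b) \<Rightarrow> 'c measure \<Rightarrow> ('w \<Rightarrow> 'c) \<Rightarrow> bool" where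
  "indep_rv M A X B Y \<longleftrightarrow> prob_space.indep_set M
     (sets (vimage_algebra (space M) X A)) (sets (vimage_algebra (space M) Y B))"

definition sample_space :: "nat \<Rightarrow> nat \<Rightarrow> (nat \<times> int \<Rightarrow> real \<times> (real^'k)) measure" where
  "sample_space N T = (\<Pi>\<^sub>M p\<in>{1..N} \<times> {1..int T}. borel)"

definition sample ::
  "(nat \<Rightarrow> int \<Rightarrow> 'w \<Rightarrow> real) \<Rightarrow> (int \<Rightarrow> 'w \<Rightarrow> real^'k) \<Rightarrow> nat \<Rightarrow> nat \<Rightarrow> 'w \<Rightarrow>
   (nat \<times> int \<Rightarrow> real \<times> (real^'k))" where
  "sample u f N T \<omega> = (\<lambda>(i, t)\<in>{1..N} \<times> {1..int T}. (u i t \<omega>, f t \<omega>))"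

definition cond_prob_sample ::
  "'w measure \<Rightarrow> (nat \<Rightarrow> int \<Rightarrow> 'w \<Rightarrow> real) \<Rightarrow> (int \<Rightarrow> 'w \<Rightarrow> real^'k) \<Rightarrow> nat \<Rightarrow> nat \<Rightarrow>
   'w set \<Rightarrow> 'w \<Rightarrow> real" where
  "cond_prob_sample M u f N T A =
     real_cond_exp M (vimage_algebra (space M) (sample u f N T) (sample_space N T)) (indicator A)"

definition panel_model ::
  "'w measure \<Rightarrow> (nat \<Rightarrow> int \<Rightarrow> 'w \<Rightarrow> real) \<Rightarrow> (nat \<Rightarrow> real^'k) \<Rightarrow> (int \<Rightarrow> 'w \<Rightarrow> real^'k) \<Rightarrow>
   (nat \<Rightarrow> int \<Rightarrow> 'w \<Rightarrow> real) \<Rightarrow> (nat \<Rightarrow> real) \<Rightarrow> real^'k \<Rightarrow> bool" where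
  "panel_model M y \<beta> f u \<alpha> lam \<longleftrightarrow> (\<forall>i\<ge>1. \<forall>t\<ge>1. \<forall>\<omega>\<in>space M.
     y i t \<omega> = \<alpha> i + \<beta> i \<bullet> lam + \<beta> i \<bullet> (f t \<omega> - integral\<^sup>L M (f t)) + u i t \<omega>)"

definition H_null :: "(nat \<Rightarrow> real) \<Rightarrow> bool" where
  "H_null \<alpha> \<longleftrightarrow> (\<forall>i\<ge>1. \<alpha> i = 0)"

(* The panel determines (alpha, lambda) only up to replacing alpha_i by
   alpha_i - beta_i . c and lambda by lambda + c. If alpha_i = beta_i . c for
   all i, the very same panel satisfies the null hypothesis with risk premium
   lambda + c. The alternative is therefore read as the complement of the null:
   some alpha_i is nonzero in every representation of the panel. *)
definition H_alt ::
  "'w measure \<Rightarrow> (nat \<Rightarrow> int \<Rightarrow> 'w \<Rightarrow> real) \<Rightarrow> (nat \<Rightarrow> real^'k) \<Rightarrow> (int \<Rightarrow> 'w \<Rightarrow> real^'k) \<Rightarrow>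
   (nat \<Rightarrow> int \<Rightarrow> 'w \<Rightarrow> real) \<Rightarrow> bool" where
  "H_alt M y \<beta> f u \<longleftrightarrow>
     (\<forall>\<alpha> lam. panel_model M y \<beta> f u \<alpha> lam \<longrightarrow> (\<exists>i\<ge>1. \<alpha> i \<noteq> 0))"

(* In the estimators y and f are the observed values (one realization). *)

definition time_mean :: "nat \<Rightarrow> (int \<Rightarrow> 'b::real_vector) \<Rightarrow> 'b" where
  "time_mean T x = (1 / real T) *\<^sub>R (\<Sum>t\<in>{1..int T}. x t)"

definition beta_hat :: "nat \<Rightarrow> (nat \<Rightarrow> int \<Rightarrow> real) \<Rightarrow> (int \<Rightarrow> real^'k) \<Rightarrow> nat \<Rightarrow> real^'k" where
  "beta_hat T y f i =
     matrix_inv (\<Sum>t\<in>{1..int T}. outer (f t - time_mean T f) (f t - time_mean T f)) *v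
     (\<Sum>t\<in>{1..int T}. (y i t - time_mean T (y i)) *\<^sub>R (f t - time_mean T f))"

definition centering :: "nat \<Rightarrow> nat \<Rightarrow> nat \<Rightarrow> real" where
  "centering N i j = (if i = j then 1 else 0) - 1 / real N"

(* The two double sums are B' M B and B' M ybar, where B is the N x K matrix
   with rows beta_hat i and M is the centering matrix. *)
definition lambda_hat :: "nat \<Rightarrow> nat \<Rightarrow> (nat \<Rightarrow> int \<Rightarrow> real) \<Rightarrow> (int \<Rightarrow> real^'k) \<Rightarrow> real^'k" where
  "lambda_hat N T y f =
     matrix_inv (\<Sum>i\<in>{1..N}. \<Sum>j\<in>{1..N}.
        centering N i j *\<^sub>R outer (beta_hat T y f i) (beta_hat T y f j)) *v
     (\<Sum>i\<in>{1..N}. \<Sum>j\<in>{1..N}. (centering N i j * time_mean T (y j)) *\<^sub>R beta_hat T y f i)"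

definition alpha_hat :: "nat \<Rightarrow> nat \<Rightarrow> (nat \<Rightarrow> int \<Rightarrow> real) \<Rightarrow> (int \<Rightarrow> real^'k) \<Rightarrow> nat \<Rightarrow> real" where
  "alpha_hat N T y f i = time_mean T (y i) - beta_hat T y f i \<bullet> lambda_hat N T y f"

definition u_hat ::
  "nat \<Rightarrow> nat \<Rightarrow> (nat \<Rightarrow> int \<Rightarrow> real) \<Rightarrow> (int \<Rightarrow> real^'k) \<Rightarrow> nat \<Rightarrow> int \<Rightarrow> real" where
  "u_hat N T y f i t = y i t - (alpha_hat N T y f i + beta_hat T y f i \<bullet> f t)"

definition s_hat :: "nat \<Rightarrow> nat \<Rightarrow> (nat \<Rightarrow> int \<Rightarrow> real) \<Rightarrow> (int \<Rightarrow> real^'k) \<Rightarrow> real" where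
  "s_hat N T y f =
     sqrt (1 / (real N * real T) * (\<Sum>i\<in>{1..N}. \<Sum>t\<in>{1..int T}. (u_hat N T y f i t)\<^sup>2))"

definition psi ::
  "real \<Rightarrow> nat \<Rightarrow> nat \<Rightarrow> (nat \<Rightarrow> int \<Rightarrow> real) \<Rightarrow> (int \<Rightarrow> real^'k) \<Rightarrow> nat \<Rightarrow> real" where
  "psi \<nu> N T y f i = \<bar>real T powr (1 / \<nu>) * alpha_hat N T y f i / s_hat N T y f\<bar> powr (\<nu> / 2)"

definition Z_stat ::
  "real \<Rightarrow> nat \<Rightarrow> nat \<Rightarrow> (nat \<Rightarrow> int \<Rightarrow> real) \<Rightarrow> (int \<Rightarrow> real^'k) \<Rightarrow> (nat \<Rightarrow> real) \<Rightarrow> real" where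
  "Z_stat \<nu> N T y f w = Max ((\<lambda>i. psi \<nu> N T y f i + w i) ` {1..N})"

definition b_norm :: "nat \<Rightarrow> real" where
  "b_norm N = sqrt (2 * ln (real N)) -
     (ln (ln (real N)) + ln (4 * pi)) / (2 * sqrt (2 * ln (real N)))"

definition a_norm :: "nat \<Rightarrow> real" where
  "a_norm N = b_norm N / (1 + (b_norm N)\<^sup>2)"

definition Z_event ::
  "'w measure \<Rightarrow> real \<Rightarrow> (nat \<Rightarrow> int \<Rightarrow> 'w \<Rightarrow> real) \<Rightarrow> (int \<Rightarrow> 'w \<Rightarrow> real^'k) \<Rightarrow> (nat \<Rightarrow> 'w \<Rightarrow> real) \<Rightarrow>
   nat \<Rightarrow> nat \<Rightarrow> real \<Rightarrow> 'w set" where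
  "Z_event M \<nu> y f w N T x = {\<omega> \<in> space M.
     (Z_stat \<nu> N T (\<lambda>i t. y i t \<omega>) (\<lambda>t. f t \<omega>) (\<lambda>i. w i \<omega>) - b_norm N) / a_norm N \<le> x}"

(* min {N, T} tends to infinity along the pairs with N <= C T^r. *)
definition panel_limit :: "real \<Rightarrow> real \<Rightarrow> (nat \<times> nat) filter" where
  "panel_limit C r = inf (filtercomap (\<lambda>(N, T). min N T) at_top)
     (principal {(N, T). real N \<le> C * real T powr r})"

end

(* Given the sample, the conditional probability is the product of the values of the standard normal
   distribution function at b_N + a_N x - psi_i. Under the null all psi_i are at most T^(-s) for some
   s > 0, uniformly in i, which is negligible against a_N because N is polynomial in T, and the Gumbel
   limit of normal maxima remains. Under the alternative some psi_i exceeds c T^(1/4) and a single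
   factor of the product vanishes.

   The uniform rates come from the moments of order p, an even integer between nu/2 and nu. A sum of
   errors is telescoped over the couplings at lags 2^j, whose increments are 2^(j+1)-dependent, so that
   the moment inequality for independent summands gives the order sqrt(n); factors enter as independent
   weights. Summing normalized dyadic blocks over all assets, scales and positions gives one integrable
   random variable that bounds all partial sums simultaneously. *)
theory Submission
  imports Defs "HOL-Real_Asymp.Real_Asymp"
begin

section \<open>Moment bounds of sums of independent variables\<close>

text \<open>Two features of \<open>psi\<close> shape the proof. The residuals use the raw factors,
  so the time mean of \<open>u_hat\<close> contains \<open>beta_hat\<close> times lam - E f, and
  \<open>s_hat\<close> need not estimate an error variance; it is only bounded. Its lower bound uses
  averages of |u i t|: the absolute value is Lipschitz and keeps all moments of \<open>u\<close>,
  while squares would keep half of the order and spoil the uniform rate. Under the alternative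
  nothing bounds \<open>lambda_hat\<close>, but its error enters the bounds for
  \<open>alpha_hat\<close> and \<open>s_hat\<close> at the same order and cancels in the ratio. The
  growth condition comes from an exponent count: uniformity over N assets costs N^(1/p), so averages
  have order T^(-1/2) N^(1/p) up to small powers. With p >= \<nu>/2 and N <= C T^r, r = (\<nu>/2 -
  1)/2 - \<epsilon>, this is at most T^(-1/\<nu> - \<theta>) and just beats the factor T^(1/\<nu>)
  in \<open>psi\<close>. The error of the factor mean does no harm, since \<open>lambda_hat\<close>
  is compared with the premium shifted by that error.\<close>

definition lp_le :: "'w measure \<Rightarrow> nat \<Rightarrow> ('w \<Rightarrow> real) \<Rightarrow> real \<Rightarrow> bool" where
  "lp_le M p X a \<longleftrightarrow> X \<in> borel_measurable M \<and> integrable M (\<lambda>\<omega>. X \<omega> ^ p) \<and> 0 \<le> a \<and>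
     (\<integral>\<omega>. X \<omega> ^ p \<partial>M) \<le> a ^ p"

lemma lp_leD:
  assumes "lp_le M p X a"
  shows "X \<in> borel_measurable M" "integrable M (\<lambda>\<omega>. X \<omega> ^ p)" "0 \<le> a" "(\<integral>\<omega>. X \<omega> ^ p \<partial>M) \<le> a ^ p"
  using assms by (auto simp: lp_le_def)

lemma lp_le_mono: "lp_le M p X a \<Longrightarrow> a \<le> b \<Longrightarrow> lp_le M p X b"
  unfolding lp_le_def using power_mono order_trans by fastforce

text \<open>Convexity of the even power at the points x/a and y/b with weights a/(a+b) and b/(a+b).
  Integrated with \<open>a\<close> and \<open>b\<close> equal to the norm bounds, the right side
  becomes (a+b)^p. This is the Minkowski inequality in powers instead of roots, the form in which
  \<open>lp_le\<close> bounds an L^p norm for even p.\<close>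

lemma add_power_even_le:
  fixes x y a b :: real
  assumes "even p" "a > 0" "b > 0" "p > 0"
  shows "(x + y) ^ p \<le> (a + b) ^ (p - 1) * (x ^ p / a ^ (p - 1) + y ^ p / b ^ (p - 1))"
proof -
  obtain m where m: "p = Suc m" using assms by (cases p) auto
  have cv: "convex_on UNIV (\<lambda>x::real. x ^ p)"
    using assms convex_power_even by auto
  have "((a / (a+b)) *\<^sub>R (x / a) + (b / (a+b)) *\<^sub>R (y / b)) ^ p
      \<le> (a / (a+b)) * (x / a) ^ p + (b / (a+b)) * (y / b) ^ p"
  proof -
    have "1 - b / (a+b) = a / (a+b)" using assms by (simp add: field_simps)
    then show ?thesis using convex_onD[OF cv, of "b / (a+b)" "x / a" "y / b"] assms by simp
  qed
  also have "(a / (a+b)) *\<^sub>R (x / a) + (b / (a+b)) *\<^sub>R (y / b) = (x + y) / (a + b)"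
    using assms by (simp add: add_divide_distrib)
  finally have "(x + y) ^ p / (a + b) ^ p \<le> (a / (a+b)) * (x / a) ^ p + (b / (a+b)) * (y / b) ^ p"
    by (simp add: power_divide)
  also have "\<dots> = (x ^ p / a ^ m + y ^ p / b ^ m) / (a + b)"
  proof -
    have "(c / (a + b)) * (z / c) ^ p = z ^ p / c ^ m / (a + b)" if "c > 0" for c z
      using that unfolding m by (simp add: power_divide)
    then show ?thesis using assms by (simp add: add_divide_distrib)
  qed
  finally show ?thesis using assms unfolding m
    by (simp add: divide_simps mult_ac)
qed

lemma lp_le_cmult:
  assumes "even p" "lp_le M p X a"
  shows "lp_le M p (\<lambda>\<omega>. c * X \<omega>) (\<bar>c\<bar> * a)"
  using assms unfolding lp_le_def
  by (auto simp: power_mult_distrib power_even_abs intro!: mult_left_mono zero_le_even_power)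

lemma lp_le_zero: "p > 0 \<Longrightarrow> lp_le M p (\<lambda>_. 0) 0"
  by (simp add: lp_le_def zero_power)

text \<open>Bounds equal to 0 need their own treatment because \<open>add_power_even_le\<close>
  divides by both of them.\<close>

lemma lp_le_AE_zero:
  assumes "even p" "p > 0" "lp_le M p X 0"
  shows "AE \<omega> in M. X \<omega> = 0"
proof -
  have "(\<integral>\<omega>. X \<omega> ^ p \<partial>M) = 0"
  proof (rule antisym)
    show "(\<integral>\<omega>. X \<omega> ^ p \<partial>M) \<le> 0" using lp_leD(4)[OF assms(3)] assms by (simp add: zero_power)
    show "0 \<le> (\<integral>\<omega>. X \<omega> ^ p \<partial>M)" using assms by (intro integral_nonneg_AE AE_I2 zero_le_even_power)
  qed
  then show ?thesis
    using integral_nonneg_eq_0_iff_AE[OF lp_leD(2)[OF assms(3)]] assms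
    by (auto simp: zero_le_even_power)
qed

lemma lp_le_cong_AE:
  assumes "lp_le M p X a" "AE \<omega> in M. X \<omega> = Y \<omega>" "Y \<in> borel_measurable M"
  shows "lp_le M p Y a"
proof -
  have m: "X \<in> borel_measurable M" using assms lp_leD by blast
  have ae: "AE \<omega> in M. X \<omega> ^ p = Y \<omega> ^ p" using assms(2) by eventually_elim auto
  have "integrable M (\<lambda>\<omega>. Y \<omega> ^ p)" "(\<integral>\<omega>. X \<omega> ^ p \<partial>M) = (\<integral>\<omega>. Y \<omega> ^ p \<partial>M)"
    using integrable_cong_AE[OF _ _ ae] integral_cong_AE[OF _ _ ae] m assms lp_leD(2) by auto
  then show ?thesis using assms unfolding lp_le_def by auto
qed

lemma lp_le_add:
  assumes p: "even p" "p > 0" and X: "lp_le M p X a" and Y: "lp_le M p Y b"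
  shows "lp_le M p (\<lambda>\<omega>. X \<omega> + Y \<omega>) (a + b)"
proof -
  note [measurable] = lp_leD(1)[OF X] lp_leD(1)[OF Y]
  note ab = lp_leD(3)[OF X] lp_leD(3)[OF Y]
  show ?thesis
  proof (cases "a = 0 \<or> b = 0")
    case True
    then show ?thesis
    proof
      assume "a = 0"
      then have "AE \<omega> in M. X \<omega> = 0" using lp_le_AE_zero X p by auto
      then have "AE \<omega> in M. Y \<omega> = X \<omega> + Y \<omega>" by eventually_elim auto
      from lp_le_cong_AE[OF Y this] show ?thesis using \<open>a = 0\<close> by simp
    next
      assume "b = 0"
      then have "AE \<omega> in M. Y \<omega> = 0" using lp_le_AE_zero Y p by auto
      then have "AE \<omega> in M. X \<omega> = X \<omega> + Y \<omega>" by eventually_elim auto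
      from lp_le_cong_AE[OF X this] show ?thesis using \<open>b = 0\<close> by simp
    qed
  next
    case False
    then have pos: "a > 0" "b > 0" using ab by auto
    let ?g = "\<lambda>\<omega>. (a + b) ^ (p - 1) * (X \<omega> ^ p / a ^ (p - 1) + Y \<omega> ^ p / b ^ (p - 1))"
    have le: "(X \<omega> + Y \<omega>) ^ p \<le> ?g \<omega>" for \<omega> using add_power_even_le pos p by blast
    have ig: "integrable M ?g" using lp_leD(2)[OF X] lp_leD(2)[OF Y] by auto
    have i: "integrable M (\<lambda>\<omega>. (X \<omega> + Y \<omega>) ^ p)"
      using p le by (intro Bochner_Integration.integrable_bound[OF ig])
         (auto simp: zero_le_even_power abs_of_nonneg intro!: AE_I2 order_trans[OF _ abs_ge_self])
    have "(\<integral>\<omega>. (X \<omega> + Y \<omega>) ^ p \<partial>M) \<le> integral\<^sup>L M ?g"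
      using i ig le by (intro integral_mono)
    also have "\<dots> = (a + b) ^ (p - 1) * ((\<integral>\<omega>. X \<omega> ^ p \<partial>M) / a ^ (p - 1) + (\<integral>\<omega>. Y \<omega> ^ p \<partial>M) / b ^ (p - 1))"
      using lp_leD(2)[OF X] lp_leD(2)[OF Y] by simp
    also have "\<dots> \<le> (a + b) ^ (p - 1) * (a ^ p / a ^ (p - 1) + b ^ p / b ^ (p - 1))"
      using pos lp_leD(4)[OF X] lp_leD(4)[OF Y]
      by (intro mult_left_mono add_mono divide_right_mono) auto
    also have "\<dots> = (a + b) ^ p" using p pos by (cases p) auto
    finally show ?thesis using i ab unfolding lp_le_def by auto
  qed
qed

lemma lp_le_sum:
  assumes p: "even p" "p > 0" and "finite I" "\<And>i. i \<in> I \<Longrightarrow> lp_le M p (X i) (a i)"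
  shows "lp_le M p (\<lambda>\<omega>. \<Sum>i\<in>I. X i \<omega>) (\<Sum>i\<in>I. a i)"
  using assms(3,4)
  by (induction I rule: finite_induct) (auto intro!: lp_le_zero lp_le_add p)

text \<open>Compares |t| / s with 1: up to 1 the constant term dominates, beyond 1 the larger
  exponent does. It stands in for the monotonicity of L^p norms on a probability space, at the price
  of a factor 2 in the moment.\<close>

lemma abs_power_le_one_add:
  fixes t s :: real
  assumes "s > 0" "m \<le> n" "even n" shows "\<bar>t\<bar> ^ m \<le> s ^ m + s ^ m * t ^ n / s ^ n"
proof -
  have "(\<bar>t\<bar> / s) ^ m \<le> 1 + (\<bar>t\<bar> / s) ^ n"
  proof (cases "\<bar>t\<bar> / s \<le> 1")
    case True
    then have "(\<bar>t\<bar> / s) ^ m \<le> 1" using assms by (intro power_le_one) auto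
    moreover have "0 \<le> (\<bar>t\<bar> / s) ^ n" using assms by auto
    ultimately show ?thesis by linarith
  next
    case False
    then have "(\<bar>t\<bar> / s) ^ m \<le> (\<bar>t\<bar> / s) ^ n" using assms by (intro power_increasing) auto
    then show ?thesis by linarith
  qed
  then have "s ^ m * (\<bar>t\<bar> / s) ^ m \<le> s ^ m * (1 + (\<bar>t\<bar> / s) ^ n)"
    using assms by (intro mult_left_mono) auto
  moreover have "\<bar>t\<bar> ^ n = t ^ n" using assms by (simp add: power_even_abs)
  ultimately show ?thesis using assms by (simp add: power_divide distrib_left)
qed

context prob_space
begin

lemma lp_le_lower_moment:
  assumes "even p" "m \<le> p" "lp_le M p X a" "a > 0"
  shows "integrable M (\<lambda>\<omega>. X \<omega> ^ m)" "integrable M (\<lambda>\<omega>. \<bar>X \<omega>\<bar> ^ m)" "expectation (\<lambda>\<omega>. \<bar>X \<omega>\<bar> ^ m) \<le> 2 * a ^ m"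
proof -
  note [measurable] = lp_leD(1)[OF assms(3)]
  let ?g = "\<lambda>\<omega>. a ^ m + a ^ m * X \<omega> ^ p / a ^ p"
  have ig: "integrable M ?g" using lp_leD(2)[OF assms(3)] by auto
  have le: "\<bar>X \<omega>\<bar> ^ m \<le> ?g \<omega>" for \<omega> using abs_power_le_one_add assms by blast
  show "integrable M (\<lambda>\<omega>. X \<omega> ^ m)" "integrable M (\<lambda>\<omega>. \<bar>X \<omega>\<bar> ^ m)"
    using le by (auto intro!: Bochner_Integration.integrable_bound[OF ig] AE_I2 order_trans[OF _ abs_ge_self] simp: power_abs)
  then have "expectation (\<lambda>\<omega>. \<bar>X \<omega>\<bar> ^ m) \<le> expectation ?g"
    using ig le by (intro integral_mono) auto
  also have "\<dots> = a ^ m + a ^ m * expectation (\<lambda>\<omega>. X \<omega> ^ p) / a ^ p"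
    using lp_leD(2)[OF assms(3)] by (simp add: prob_space)
  also have "\<dots> \<le> a ^ m + a ^ m * a ^ p / a ^ p"
    using assms lp_leD(4)[OF assms(3)] by (intro add_left_mono divide_right_mono mult_left_mono) auto
  finally show "expectation (\<lambda>\<omega>. \<bar>X \<omega>\<bar> ^ m) \<le> 2 * a ^ m" using assms by simp
qed

text \<open>The mean is at most \<open>2 * a\<close> by the first absolute moment; with
  \<open>a\<close> for the variable itself this makes the constant 3.\<close>

lemma lp_le_center:
  assumes "even p" "p > 0" "lp_le M p X a" "a > 0"
  shows "integrable M X" "lp_le M p (\<lambda>\<omega>. X \<omega> - expectation X) (3 * a)"
proof -
  note lm = lp_le_lower_moment[OF assms(1) _ assms(3,4), of 1]
  show i: "integrable M X" using lm assms by simp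
  have "\<bar>expectation X\<bar> \<le> expectation (\<lambda>\<omega>. \<bar>X \<omega>\<bar>)" by (rule integral_abs_bound)
  also have "\<dots> \<le> 2 * a" using lm(3) assms by simp
  finally have e: "\<bar>expectation X\<bar> \<le> 2 * a" .
  have "lp_le M p (\<lambda>_. - expectation X) (2 * a)"
    using e assms power_mono[OF e, of p] by (auto simp: lp_le_def power_even_abs prob_space)
  from lp_le_add[OF assms(1,2,3) this] show "lp_le M p (\<lambda>\<omega>. X \<omega> - expectation X) (3 * a)"
    by simp
qed

end

text \<open>The term linear in \<open>y\<close> is kept exactly because its expectation vanishes for
  a centred \<open>y\<close> independent of \<open>x\<close>. Every later term is at most x^(p-2)
  y^2 when |y| <= |x| and at most y^p otherwise, and the binomial coefficients add up to
  2^p.\<close>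

lemma binomial_two_terms:
  fixes x y :: real
  assumes "even p" "p \<ge> 2"
  shows "(x + y) ^ p \<le> x ^ p + real p * (x ^ (p - 1) * y) + 2 ^ p * (x ^ (p - 2) * y\<^sup>2 + y ^ p)"
proof -
  define B where "B = x ^ (p - 2) * y\<^sup>2 + y ^ p"
  have ev: "even (p - 2)" using assms by auto
  have B: "B \<ge> 0" unfolding B_def using assms ev by (auto simp: zero_le_even_power)
  have tm: "x ^ k * y ^ (p - k) \<le> B" if "k \<le> p - 2" for k
  proof -
    define j where "j = p - 2 - k"
    have p: "p = j + k + 2" using that assms by (auto simp: j_def)
    have "\<bar>x ^ k * y ^ (p - k)\<bar> \<le> B"
    proof (cases "\<bar>y\<bar> \<le> \<bar>x\<bar>")
      case True
      have "\<bar>x ^ k * y ^ (p - k)\<bar> = \<bar>x\<bar> ^ k * \<bar>y\<bar> ^ j * y\<^sup>2"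
        using p by (simp add: abs_mult power_abs power_add algebra_simps power2_eq_square)
      also have "\<dots> \<le> \<bar>x\<bar> ^ k * \<bar>x\<bar> ^ j * y\<^sup>2"
        using True by (intro mult_right_mono mult_left_mono power_mono) auto
      also have "\<dots> = \<bar>x\<bar> ^ (p - 2) * y\<^sup>2" using p by (simp add: power_add algebra_simps)
      also have "\<dots> \<le> B" using ev assms by (simp add: B_def power_even_abs zero_le_even_power)
      finally show ?thesis .
    next
      case False
      have "\<bar>x ^ k * y ^ (p - k)\<bar> = \<bar>x\<bar> ^ k * \<bar>y\<bar> ^ (p - k)"
        by (simp add: abs_mult power_abs)
      also have "\<dots> \<le> \<bar>y\<bar> ^ k * \<bar>y\<bar> ^ (p - k)"
        using False by (intro mult_right_mono power_mono) auto
      also have "\<dots> = \<bar>y\<bar> ^ p" using that by (simp flip: power_add)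
      also have "\<dots> \<le> B" using ev assms by (simp add: B_def power_even_abs zero_le_even_power)
      finally show ?thesis .
    qed
    then show ?thesis by linarith
  qed
  obtain m where m: "p = Suc (Suc m)" using assms by (metis add_2_eq_Suc le_Suc_ex)
  have "(x + y) ^ p = (\<Sum>k\<le>p. of_nat (p choose k) * x ^ k * y ^ (p - k))"
    by (rule binomial_ring)
  also have "\<dots> = x ^ p + real p * (x ^ (p - 1) * y) + (\<Sum>k\<le>m. of_nat (p choose k) * x ^ k * y ^ (p - k))"
    unfolding m by (simp add: algebra_simps)
  also have "(\<Sum>k\<le>m. of_nat (p choose k) * x ^ k * y ^ (p - k)) \<le> (\<Sum>k\<le>m. real (p choose k) * B)"
    using tm m by (intro sum_mono) (auto simp: mult.assoc intro!: mult_left_mono)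
  also have "\<dots> \<le> (\<Sum>k\<le>p. real (p choose k) * B)"
    using B m by (intro sum_mono2) auto
  also have "\<dots> = 2 ^ p * B" using choose_row_sum[of p]
    by (simp flip: sum_distrib_right of_nat_sum)
  finally show ?thesis unfolding B_def by simp
qed

text \<open>One factor W + x is split off, and half of its x-part is spent on each of the lower
  bounds W^(q-1) and x^(q-1) of the remaining power. The two halves absorb the two error terms in
  the induction of \<open>lp_le_indep_sum\<close>.\<close>

lemma power_add_ge_half:
  fixes W x :: real
  assumes "W \<ge> 0" "x \<ge> 0" "q \<ge> 1"
  shows "W ^ q + W ^ (q - 1) * x / 2 + x ^ q / 2 \<le> (W + x) ^ q"
proof -
  obtain m where m: "q = Suc m" using assms by (cases q) auto
  have 1: "W ^ m \<le> (W + x) ^ m" "x ^ m \<le> (W + x) ^ m" using assms by (auto intro!: power_mono)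
  have "(W + x) ^ q = W * (W + x) ^ m + x * (W + x) ^ m" unfolding m by (simp add: distrib_right)
  moreover have "W * W ^ m \<le> W * (W + x) ^ m" "x * W ^ m \<le> x * (W + x) ^ m" "x * x ^ m \<le> x * (W + x) ^ m"
    using 1 assms by (auto intro!: mult_left_mono)
  ultimately show ?thesis unfolding m by (simp add: mult.commute)
qed

context prob_space
begin

text \<open>An inequality of Marcinkiewicz-Zygmund type for even order, by adding one summand at a
  time. In the expansion of the p-th power the linear term has mean zero, the lower moments of the
  earlier sum come from the induction hypothesis, and what is left fits below the power of the
  enlarged sum of squares.\<close>

lemma lp_le_indep_sum:
  assumes q: "q \<ge> 1" and "finite I" "indep_vars (\<lambda>_. borel) X I"
    and "\<And>i. i \<in> I \<Longrightarrow> lp_le M (2 * q) (X i) (a i)" "\<And>i. i \<in> I \<Longrightarrow> a i > 0"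
    and "\<And>i. i \<in> I \<Longrightarrow> expectation (X i) = 0"
  shows "lp_le M (2 * q) (\<lambda>\<omega>. \<Sum>i\<in>I. X i \<omega>) (sqrt (8 * 2 ^ (2 * q) * (\<Sum>i\<in>I. (a i)\<^sup>2)))"
  using assms(2-)
proof (induction I rule: finite_induct)
  case empty
  then show ?case using q by (auto intro: lp_le_zero)
next
  case (insert j F)
  \<comment> \<open>The 8 makes both error terms fit: 4 * 2^p is half of \<open>B\<close> and pays
    for the mixed term, while 2 * 2^p <= B <= B^q pays for the pure power of the new
    summand.\<close>
  define B :: real where "B = 8 * 2 ^ (2 * q)"
  define p where "p = 2 * q"
  have p: "even p" "p > 0" "p \<ge> 2" using q by (auto simp: p_def)
  have B: "B \<ge> 1" unfolding B_def using one_le_power[of "2::real" "2*q"] by linarith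
  define V where "V = (\<Sum>i\<in>F. (a i)\<^sup>2)"
  have V0: "V \<ge> 0" by (auto simp: V_def sum_nonneg)
  let ?S = "\<lambda>\<omega>. \<Sum>i\<in>F. X i \<omega>"
  have IH: "lp_le M p ?S (sqrt (B * V))"
    using insert.IH indep_vars_subset[OF insert.prems(1)] insert.prems unfolding B_def V_def p_def by fast
  have Xj: "lp_le M p (X j) (a j)" "a j > 0" "expectation (X j) = 0"
    using insert.prems by (auto simp: p_def)
  have powsq: "sqrt y ^ p = y ^ q" if "y \<ge> 0" for y using that by (simp add: p_def power_mult)
  show ?case
  \<comment> \<open>The lower moments of the earlier sum require a strictly positive bound, so the
    first summand is treated by itself.\<close>
  proof (cases "F = {}")
    case True
    have "a j \<le> sqrt (B * (a j)\<^sup>2)"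
      using B Xj(2) by (intro real_le_rsqrt) auto
    then show ?thesis using True lp_le_mono[OF Xj(1)] by (auto simp: B_def p_def)
  next
    case False
    then have "V > 0" unfolding V_def using insert by (intro sum_pos zero_less_power) auto
    define W where "W = B * V"
    have W: "W > 0" using \<open>V > 0\<close> B by (auto simp: W_def)
    define s where "s = sqrt W"
    have s: "s > 0" "s\<^sup>2 = W" using W by (auto simp: s_def)
    have S: "lp_le M p ?S s" using IH by (simp add: s_def W_def)
    note [measurable] = lp_leD(1)[OF S] lp_leD(1)[OF Xj(1)]
    note mS = lp_le_lower_moment[OF p(1) _ S s(1)] and mX = lp_le_lower_moment[OF p(1) _ Xj(1,2)]
    have ind: "indep_var borel (X j) borel ?S"
      using insert by (intro indep_vars_sum) auto
    have ind1: "indep_var borel (X j) borel (\<lambda>\<omega>. ?S \<omega> ^ (p - 1))"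
      using indep_var_compose[OF ind, of "\<lambda>x. x" borel "\<lambda>x. x ^ (p - 1)" borel]
      by (auto simp: comp_def)
    have ind2: "indep_var borel (\<lambda>\<omega>. (X j \<omega>)\<^sup>2) borel (\<lambda>\<omega>. ?S \<omega> ^ (p - 2))"
      using indep_var_compose[OF ind, of "\<lambda>x. x\<^sup>2" borel "\<lambda>x. x ^ (p - 2)" borel]
      by (auto simp: comp_def)
    have iX: "integrable M (X j)" "integrable M (\<lambda>\<omega>. (X j \<omega>)\<^sup>2)" "expectation (\<lambda>\<omega>. (X j \<omega>)\<^sup>2) \<le> 2 * (a j)\<^sup>2"
      using mX(1)[of 1] mX(1,3)[of 2] p by auto
    have iS: "integrable M (\<lambda>\<omega>. ?S \<omega> ^ (p - 1))" "integrable M (\<lambda>\<omega>. ?S \<omega> ^ (p - 2))"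
      "expectation (\<lambda>\<omega>. ?S \<omega> ^ (p - 2)) \<le> 2 * s ^ (p - 2)"
      using mS(1)[of "p-1"] mS(1,3)[of "p-2"] p by (auto simp: power_even_abs)
    have e1: "expectation (\<lambda>\<omega>. ?S \<omega> ^ (p - 1) * X j \<omega>) = 0" "integrable M (\<lambda>\<omega>. ?S \<omega> ^ (p - 1) * X j \<omega>)"
      using indep_var_lebesgue_integral[OF ind1 iX(1) iS(1)] indep_var_integrable[OF ind1 iX(1) iS(1)] Xj by (auto simp: mult.commute)
    have i2: "integrable M (\<lambda>\<omega>. ?S \<omega> ^ (p - 2) * (X j \<omega>)\<^sup>2)"
      using indep_var_integrable[OF ind2 iX(2) iS(2)] by (auto simp: mult.commute)
    have "expectation (\<lambda>\<omega>. ?S \<omega> ^ (p - 2) * (X j \<omega>)\<^sup>2) = expectation (\<lambda>\<omega>. ?S \<omega> ^ (p - 2)) * expectation (\<lambda>\<omega>. (X j \<omega>)\<^sup>2)"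
      using indep_var_lebesgue_integral[OF ind2 iX(2) iS(2)] by (auto simp: mult.commute)
    also have "\<dots> \<le> (2 * s ^ (p - 2)) * (2 * (a j)\<^sup>2)"
      using iS iX s by (intro mult_mono) (auto intro!: integral_nonneg_AE)
    also have "s ^ (p - 2) = W ^ (q - 1)"
    proof -
      have "p - 2 = 2 * (q - 1)" by (auto simp: p_def)
      then show ?thesis using s(2) by (simp add: power_mult)
    qed
    finally have e2: "expectation (\<lambda>\<omega>. ?S \<omega> ^ (p - 2) * (X j \<omega>)\<^sup>2) \<le> 4 * (W ^ (q - 1) * (a j)\<^sup>2)" by simp
    have tot: "lp_le M p (\<lambda>\<omega>. ?S \<omega> + X j \<omega>) (s + a j)" by (rule lp_le_add[OF p(1,2) S Xj(1)])
    let ?g = "\<lambda>\<omega>. ?S \<omega> ^ p + real p * (?S \<omega> ^ (p - 1) * X j \<omega>) + 2 ^ p * (?S \<omega> ^ (p - 2) * (X j \<omega>)\<^sup>2 + X j \<omega> ^ p)"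
    have "expectation (\<lambda>\<omega>. (?S \<omega> + X j \<omega>) ^ p) \<le> expectation ?g"
      using lp_leD(2)[OF tot] lp_leD(2)[OF S] lp_leD(2)[OF Xj(1)] e1 i2
      by (intro integral_mono binomial_two_terms p) auto
    also have "\<dots> = expectation (\<lambda>\<omega>. ?S \<omega> ^ p) + 2 ^ p * (expectation (\<lambda>\<omega>. ?S \<omega> ^ (p - 2) * (X j \<omega>)\<^sup>2) + expectation (\<lambda>\<omega>. X j \<omega> ^ p))"
      using lp_leD(2)[OF S] lp_leD(2)[OF Xj(1)] e1 i2 by simp
    also have "\<dots> \<le> W ^ q + 2 ^ p * (4 * (W ^ (q - 1) * (a j)\<^sup>2) + (a j) ^ p)"
      using lp_leD(4)[OF S] lp_leD(4)[OF Xj(1)] e2 powsq[of W] W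
      by (intro add_mono mult_left_mono) (auto simp: s_def)
    also have "\<dots> \<le> W ^ q + W ^ (q - 1) * (B * (a j)\<^sup>2) / 2 + (B * (a j)\<^sup>2) ^ q / 2"
    proof -
      have "(a j) ^ p * 2 ^ p \<le> (a j) ^ p * (B ^ q / 2)"
      proof (intro mult_left_mono)
        have "2 * 2 ^ p \<le> B" by (simp add: B_def p_def)
        also have "B \<le> B ^ q" using B q by (simp add: self_le_power)
        finally show "2 ^ p \<le> B ^ q / 2" by simp
      qed (use Xj in auto)
      moreover have "(a j) ^ p * (B ^ q / 2) = (B * (a j)\<^sup>2) ^ q / 2"
        by (simp add: power_mult_distrib p_def power_mult)
      moreover have "2 ^ p * (4 * (W ^ (q - 1) * (a j)\<^sup>2)) = W ^ (q - 1) * (B * (a j)\<^sup>2) / 2"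
        by (simp add: B_def p_def)
      ultimately show ?thesis unfolding distrib_left mult.commute[of "2 ^ p" "a j ^ p"] by linarith
    qed
    also have "\<dots> \<le> (W + B * (a j)\<^sup>2) ^ q" using W B q by (intro power_add_ge_half) auto
    also have "W + B * (a j)\<^sup>2 = B * (\<Sum>i\<in>insert j F. (a i)\<^sup>2)"
      using insert by (simp add: W_def V_def algebra_simps)
    finally have "expectation (\<lambda>\<omega>. (?S \<omega> + X j \<omega>) ^ p) \<le> (sqrt (B * (\<Sum>i\<in>insert j F. (a i)\<^sup>2))) ^ p"
      using B by (subst powsq) (auto intro!: mult_nonneg_nonneg sum_nonneg)
    then show ?thesis using lp_leD(1,2)[OF tot] insert(1,2) B unfolding lp_le_def
      by (auto simp: B_def p_def add.commute intro!: mult_nonneg_nonneg add_nonneg_nonneg sum_nonneg)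
  qed
qed

end

section \<open>Weighted sums of variables with short-range dependence\<close>

context prob_space
begin

lemma lp_le_weighted_indep_sum:
  assumes q: "q \<ge> 1" and A: "finite A" "indep_vars (\<lambda>_. borel) D A"
    and D: "\<And>t. t \<in> A \<Longrightarrow> lp_le M (2 * q) (D t) a" and a: "a > 0"
  shows "lp_le M (2 * q) (\<lambda>\<omega>. \<Sum>t\<in>A. c t * (D t \<omega> - expectation (D t)))
           (sqrt (8 * 2 ^ (2 * q)) * (3 * a) * sqrt (\<Sum>t\<in>A. (c t)\<^sup>2))"
proof -
  \<comment> \<open>Vanishing weights are dropped because \<open>lp_le_indep_sum\<close> asks for
    strictly positive bounds.\<close>
  define A' where "A' = {t \<in> A. c t \<noteq> 0}"
  let ?X = "\<lambda>t \<omega>. c t * (D t \<omega> - expectation (D t))"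
  have iD: "integrable M (D t)" "lp_le M (2 * q) (\<lambda>\<omega>. D t \<omega> - expectation (D t)) (3 * a)" if "t \<in> A" for t
    using lp_le_center[OF _ _ D[OF that] a] q by auto
  have "lp_le M (2 * q) (\<lambda>\<omega>. \<Sum>t\<in>A'. ?X t \<omega>) (sqrt (8 * 2 ^ (2 * q) * (\<Sum>t\<in>A'. (\<bar>c t\<bar> * (3 * a))\<^sup>2)))"
  proof (rule lp_le_indep_sum[OF q])
    show "finite A'" using A by (auto simp: A'_def)
    show "indep_vars (\<lambda>_. borel) ?X A'"
      using indep_vars_compose2[OF indep_vars_subset[OF A(2)], of A' "\<lambda>t x. c t * (x - expectation (D t))" "\<lambda>_. borel"]
      by (auto simp: A'_def)
    show "expectation (?X t) = 0" if "t \<in> A'" for t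
      using iD(1)[of t] that by (auto simp: A'_def prob_space)
    show "lp_le M (2 * q) (?X t) (\<bar>c t\<bar> * (3 * a))" if "t \<in> A'" for t
      using iD(2)[of t] that by (intro lp_le_cmult) (auto simp: A'_def)
    show "0 < \<bar>c t\<bar> * (3 * a)" if "t \<in> A'" for t
      using that a by (auto simp: A'_def)
  qed
  moreover have "(\<Sum>t\<in>A'. ?X t \<omega>) = (\<Sum>t\<in>A. ?X t \<omega>)" for \<omega>
    using A(1) by (intro sum.mono_neutral_left) (auto simp: A'_def)
  moreover have "(\<Sum>t\<in>A'. (\<bar>c t\<bar> * (3 * a))\<^sup>2) = (\<Sum>t\<in>A. (\<bar>c t\<bar> * (3 * a))\<^sup>2)"
    using A(1) by (intro sum.mono_neutral_left) (auto simp: A'_def)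
  moreover have "(\<Sum>t\<in>A. (\<bar>c t\<bar> * (3 * a))\<^sup>2) = (3 * a)\<^sup>2 * (\<Sum>t\<in>A. (c t)\<^sup>2)"
    by (simp add: power_mult_distrib sum_distrib_left algebra_simps)
  moreover have "sqrt (8 * 2 ^ (2 * q) * ((3 * a)\<^sup>2 * (\<Sum>t\<in>A. (c t)\<^sup>2)))
      = sqrt (8 * 2 ^ (2 * q)) * (3 * a) * sqrt (\<Sum>t\<in>A. (c t)\<^sup>2)"
    using a by (simp only: real_sqrt_mult real_sqrt_abs)
  ultimately show ?thesis by simp
qed

text \<open>The indices fall into L residue classes modulo L; inside a class distinct indices are at
  least L apart and the variables are independent. The triangle inequality over the classes followed
  by Cauchy-Schwarz turns L square roots into the factor sqrt L.\<close>

lemma lp_le_weighted_gap_sum: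
  fixes D :: "int \<Rightarrow> 'a \<Rightarrow> real"
  assumes q: "q \<ge> 1" and I: "finite I" and L: "L \<ge> 1"
    and ind: "\<And>A. (\<And>s t. s \<in> A \<Longrightarrow> t \<in> A \<Longrightarrow> s \<noteq> t \<Longrightarrow> int L \<le> \<bar>s - t\<bar>) \<Longrightarrow> indep_vars (\<lambda>_. borel) D A"
    and D: "\<And>t. lp_le M (2 * q) (D t) a" and a: "a > 0"
  shows "lp_le M (2 * q) (\<lambda>\<omega>. \<Sum>t\<in>I. c t * (D t \<omega> - expectation (D t)))
           (sqrt (8 * 2 ^ (2 * q)) * (3 * a) * sqrt (real L) * sqrt (\<Sum>t\<in>I. (c t)\<^sup>2))"
proof -
  define R where "R r = {t \<in> I. t mod int L = r}" for r
  let ?V = "\<lambda>r. \<Sum>t\<in>R r. (c t)\<^sup>2"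
  have fin: "finite (R r)" for r using I by (auto simp: R_def)
  have dec: "(\<Sum>t\<in>I. h t) = (\<Sum>r\<in>{0..<int L}. \<Sum>t\<in>R r. h t)" for h :: "int \<Rightarrow> real"
    unfolding R_def using I L by (intro sum.group[symmetric]) auto
  have "lp_le M (2 * q) (\<lambda>\<omega>. \<Sum>t\<in>R r. c t * (D t \<omega> - expectation (D t)))
           (sqrt (8 * 2 ^ (2 * q)) * (3 * a) * sqrt (?V r))" for r
  proof (rule lp_le_weighted_indep_sum[OF q fin _ D a])
    show "indep_vars (\<lambda>_. borel) D (R r)"
    proof (rule ind)
      fix s t assume st: "s \<in> R r" "t \<in> R r" "s \<noteq> t"
      then have "int L dvd (s - t)" by (subst mod_eq_dvd_iff[symmetric]) (simp add: R_def)
      then show "int L \<le> \<bar>s - t\<bar>" using st(3) dvd_imp_le_int[of "s - t" "int L"] by simp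
    qed
  qed
  then have "lp_le M (2 * q) (\<lambda>\<omega>. \<Sum>t\<in>I. c t * (D t \<omega> - expectation (D t)))
      (\<Sum>r\<in>{0..<int L}. sqrt (8 * 2 ^ (2 * q)) * (3 * a) * sqrt (?V r))"
    unfolding dec using q by (intro lp_le_sum) auto
  moreover have "(\<Sum>r\<in>{0..<int L}. sqrt (?V r)) \<le> sqrt (real L) * sqrt (\<Sum>t\<in>I. (c t)\<^sup>2)"
  proof -
    have "(\<Sum>r\<in>{0..<int L}. sqrt (?V r))\<^sup>2 \<le> (\<Sum>r\<in>{0..<int L}. (sqrt (?V r))\<^sup>2) * real (card {0..<int L})"
      using sum_squared_le_sum_of_squares[of "\<lambda>r. sqrt (?V r)" "{0..<int L}"] by (simp add: mult.commute)
    also have "\<dots> = real L * (\<Sum>t\<in>I. (c t)\<^sup>2)"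
      unfolding dec by (simp add: sum_nonneg)
    finally show ?thesis using real_le_rsqrt by (simp flip: real_sqrt_mult)
  qed
  then have "(\<Sum>r\<in>{0..<int L}. sqrt (8 * 2 ^ (2 * q)) * (3 * a) * sqrt (?V r))
     \<le> sqrt (8 * 2 ^ (2 * q)) * (3 * a) * (sqrt (real L) * sqrt (\<Sum>t\<in>I. (c t)\<^sup>2))"
    using a unfolding sum_distrib_left[symmetric] by (intro mult_left_mono) auto
  ultimately show ?thesis using lp_le_mono by (simp add: mult.assoc)
qed

text \<open>Y t j plays the role of the coupling of X t at lag 2 ^ j.\<close>

definition dyadic_approx :: "nat \<Rightarrow> real \<Rightarrow> real \<Rightarrow> (int \<Rightarrow> 'a \<Rightarrow> real) \<Rightarrow> (int \<Rightarrow> nat \<Rightarrow> 'a \<Rightarrow> real) \<Rightarrow> bool" where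
  "dyadic_approx p k d X Y \<longleftrightarrow> k > 0 \<and> d > 0 \<and>
     (\<forall>t. lp_le M p (X t) k) \<and>
     (\<forall>t j. Y t j \<in> borel_measurable M) \<and>
     (\<forall>t j. lp_le M p (\<lambda>\<omega>. X t \<omega> - Y t j \<omega>) (d * (1/2) ^ j)) \<and>
     (\<forall>A. indep_vars (\<lambda>_. borel) (\<lambda>t. Y t 0) A) \<and>
     (\<forall>j A. (\<forall>s\<in>A. \<forall>t\<in>A. s \<noteq> t \<longrightarrow> 2 ^ Suc j \<le> \<bar>s - t\<bar>) \<longrightarrow>
        indep_vars (\<lambda>_. borel) (\<lambda>t \<omega>. Y t (Suc j) \<omega> - Y t j \<omega>) A)"

lemma dyadic_approxD:
  assumes "dyadic_approx p k d X Y"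
  shows "k > 0" "d > 0" "lp_le M p (X t) k" "Y t j \<in> borel_measurable M"
    "lp_le M p (\<lambda>\<omega>. X t \<omega> - Y t j \<omega>) (d * (1/2) ^ j)"
    "indep_vars (\<lambda>_. borel) (\<lambda>t. Y t 0) A"
    "\<forall>s\<in>A. \<forall>t\<in>A. s \<noteq> t \<longrightarrow> 2 ^ Suc j \<le> \<bar>s - t\<bar> \<Longrightarrow>
       indep_vars (\<lambda>_. borel) (\<lambda>t \<omega>. Y t (Suc j) \<omega> - Y t j \<omega>) A"
proof -
  note * = assms[unfolded dyadic_approx_def]
  from * show "k > 0" "d > 0" "lp_le M p (X t) k" "Y t j \<in> borel_measurable M"
    "lp_le M p (\<lambda>\<omega>. X t \<omega> - Y t j \<omega>) (d * (1/2) ^ j)"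
    "indep_vars (\<lambda>_. borel) (\<lambda>t. Y t 0) A"
    by (elim conjE; simp)+
  show "indep_vars (\<lambda>_. borel) (\<lambda>t \<omega>. Y t (Suc j) \<omega> - Y t j \<omega>) A"
    if "\<forall>s\<in>A. \<forall>t\<in>A. s \<noteq> t \<longrightarrow> 2 ^ Suc j \<le> \<bar>s - t\<bar>"
    using *[THEN conjunct2, THEN conjunct2, THEN conjunct2, THEN conjunct2, THEN conjunct2, THEN conjunct2, rule_format, OF that[rule_format]] .
qed

text \<open>The square root is the constant for independent summands. The part 3 * (k + d) comes
  from the couplings at lag 1, 40 * d covers the geometric series of the terms 9 * d * (3/4)^j for
  the increments, and the last 3 * d belongs to the remainder beyond the largest scale.\<close>

definition approx_const :: "nat \<Rightarrow> real \<Rightarrow> real \<Rightarrow> real" where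
  "approx_const q k d = sqrt (8 * 2 ^ (2 * q)) * (3 * (k + d) + 40 * d) + 3 * d"

text \<open>An increment at scale j has norm of order 2^(-j), while its range of dependence 2^(j+1)
  costs only a square root. The contributions therefore decay like 2^(-j/2) and can be added over
  all scales.\<close>

lemma lp_le_dyadic_approx_sum:
  assumes q: "q \<ge> 1" and XY: "dyadic_approx (2 * q) k d X Y" and I: "finite I"
  shows "lp_le M (2 * q) (\<lambda>\<omega>. \<Sum>t\<in>I. c t * (X t \<omega> - expectation (X t)))
           (approx_const q k d * sqrt (\<Sum>t\<in>I. (c t)\<^sup>2))"
proof -
  define p where "p = 2 * q"
  have p: "even p" "p > 0" using q by (auto simp: p_def)
  define B where "B = sqrt (8 * 2 ^ (2 * q))"
  have B: "B \<ge> 0" by (simp add: B_def)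
  define v where "v = sqrt (\<Sum>t\<in>I. (c t)\<^sup>2)"
  have v: "v \<ge> 0" by (auto simp: v_def sum_nonneg)
  have kd: "k > 0" "d > 0" using dyadic_approxD(1,2)[OF XY] by auto
  have X: "lp_le M p (X t) k" for t using dyadic_approxD(3)[OF XY] by (simp add: p_def)
  have [measurable]: "Y t j \<in> borel_measurable M" "X t \<in> borel_measurable M" for t j
    using dyadic_approxD(4)[OF XY] X[THEN lp_leD(1)] by simp_all
  have XY': "lp_le M p (\<lambda>\<omega>. X t \<omega> - Y t j \<omega>) (d * (1/2) ^ j)" for t j
    using dyadic_approxD(5)[OF XY] by (simp add: p_def)
  have neg: "lp_le M p (\<lambda>\<omega>. - Z \<omega>) e" if "lp_le M p Z e" for Z e
    using lp_le_cmult[OF p(1) that, of "-1"] by simp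
  define D where "D t j \<omega> = (if j = 0 then Y t 0 \<omega> else Y t j \<omega> - Y t (j - 1) \<omega>)" for t j \<omega>
  have D0: "lp_le M p (D t 0) (k + d)" for t
    using lp_le_add[OF p X neg[OF XY'[of _ 0]], of t t] by (simp add: D_def[abs_def])
  have DS: "lp_le M p (D t (Suc j)) (2 * d * (1/2) ^ j)" for t j
  proof -
    have "lp_le M p (\<lambda>\<omega>. (X t \<omega> - Y t j \<omega>) + - (X t \<omega> - Y t (Suc j) \<omega>)) (d * (1/2) ^ j + d * (1/2) ^ Suc j)"
      by (intro lp_le_add p neg XY')
    then have "lp_le M p (D t (Suc j)) (d * (1/2) ^ j + d * (1/2) ^ Suc j)"
      by (simp add: D_def[abs_def])
    then show ?thesis by (rule lp_le_mono) (use kd in \<open>simp add: field_simps\<close>)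
  qed
  let ?E = "\<lambda>Z c. \<lambda>\<omega>. \<Sum>t\<in>I. c t * (Z t \<omega> - expectation (Z t))"
  have S0: "lp_le M p (?E (\<lambda>t. D t 0) c) (B * (3 * (k + d)) * v)"
  proof -
    have "indep_vars (\<lambda>_. borel) (\<lambda>t. D t 0) A" for A
      using dyadic_approxD(6)[OF XY] by (simp add: D_def[abs_def])
    then have "lp_le M (2 * q) (?E (\<lambda>t. D t 0) c) (sqrt (8 * 2 ^ (2 * q)) * (3 * (k + d)) * sqrt (real 1) * sqrt (\<Sum>t\<in>I. (c t)\<^sup>2))"
      using D0 kd unfolding p_def by (intro lp_le_weighted_gap_sum q I) auto
    then show ?thesis by (simp add: p_def B_def v_def)
  qed
  have SS: "lp_le M p (?E (\<lambda>t. D t (Suc j)) c) (B * (9 * d) * v * (3/4) ^ j)" for j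
  proof -
    have ind: "indep_vars (\<lambda>_. borel) (\<lambda>t. D t (Suc j)) A" if "\<And>s t. s \<in> A \<Longrightarrow> t \<in> A \<Longrightarrow> s \<noteq> t \<Longrightarrow> int (2 ^ Suc j) \<le> \<bar>s - t\<bar>" for A
    proof -
      have "\<forall>s\<in>A. \<forall>t\<in>A. s \<noteq> t \<longrightarrow> 2 ^ Suc j \<le> \<bar>s - t\<bar>" using that by auto
      then have "indep_vars (\<lambda>_. borel) (\<lambda>t \<omega>. Y t (Suc j) \<omega> - Y t j \<omega>) A"
        by (rule dyadic_approxD(7)[OF XY])
      then show ?thesis by (simp add: D_def[abs_def])
    qed
    have "lp_le M (2 * q) (?E (\<lambda>t. D t (Suc j)) c)
        (sqrt (8 * 2 ^ (2 * q)) * (3 * (2 * d * (1/2) ^ j)) * sqrt (real (2 ^ Suc j)) * sqrt (\<Sum>t\<in>I. (c t)\<^sup>2))"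
      using DS kd unfolding p_def by (intro lp_le_weighted_gap_sum q I ind) auto
    then show ?thesis unfolding B_def[symmetric] v_def[symmetric] unfolding p_def[symmetric]
    proof (rule lp_le_mono)
      \<comment> \<open>Replacing sqrt 2 by the larger 3/2 gives the series the rational ratio
        3/4.\<close>
      have "sqrt (real (2 ^ Suc j)) = sqrt 2 * sqrt 2 ^ j" by (simp add: real_sqrt_mult real_sqrt_power)
      also have "\<dots> \<le> (3/2) * (3/2) ^ j"
        by (intro mult_mono power_mono real_le_lsqrt) (auto simp: power2_eq_square)
      finally have 1: "sqrt (real (2 ^ Suc j)) \<le> (3/2) * (3/2) ^ j" .
      have "B * (3 * (2 * d * (1/2) ^ j)) * sqrt (real (2 ^ Suc j)) * v = (B * (6 * d) * v * (1/2) ^ j) * sqrt (real (2 ^ Suc j))"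
        by (simp add: algebra_simps)
      also have "\<dots> \<le> (B * (6 * d) * v * (1/2) ^ j) * ((3/2) * (3/2) ^ j)"
        using 1 B v kd by (intro mult_left_mono) auto
      also have "\<dots> = B * (9 * d) * v * (3/4) ^ j"
      proof -
        have "(3/4 :: real) ^ j = (1/2) ^ j * (3/2) ^ j" by (simp flip: power_mult_distrib)
        then show ?thesis by simp
      qed
      finally show "B * (3 * (2 * d * (1/2) ^ j)) * sqrt (real (2 ^ Suc j)) * v \<le> B * (9 * d) * v * (3/4) ^ j" .
    qed
  qed
  \<comment> \<open>At a scale with 2^J >= card I the remainder is so small that the plain triangle
    inequality suffices: the factor sqrt (card I) that it loses is at most 2^J.\<close>
  define J where "J = card I"
  have J: "real (card I) \<le> 2 ^ J" unfolding J_def using of_nat_less_two_power[of "card I", where 'a=real] by simp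
  have DD: "lp_le M p (\<lambda>\<omega>. c t * (X t \<omega> - Y t J \<omega> - expectation (\<lambda>\<omega>. X t \<omega> - Y t J \<omega>))) (\<bar>c t\<bar> * (3 * (d * (1/2) ^ J)))" for t
    using kd by (intro lp_le_cmult lp_le_center(2) XY' p) auto
  have R: "lp_le M p (?E (\<lambda>t \<omega>. X t \<omega> - Y t J \<omega>) c) (3 * d * v)"
  proof (rule lp_le_mono)
    show "lp_le M p (?E (\<lambda>t \<omega>. X t \<omega> - Y t J \<omega>) c) (\<Sum>t\<in>I. \<bar>c t\<bar> * (3 * (d * (1/2) ^ J)))"
      by (intro lp_le_sum p I DD)
    have "(\<Sum>t\<in>I. \<bar>c t\<bar>) \<le> sqrt (real (card I)) * v"
    proof -
      have "(\<Sum>t\<in>I. \<bar>c t\<bar>)\<^sup>2 \<le> real (card I) * (\<Sum>t\<in>I. (c t)\<^sup>2)"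
        using sum_squared_le_sum_of_squares[of "\<lambda>t. \<bar>c t\<bar>" I] I by (simp add: mult.commute)
      then show ?thesis unfolding v_def using real_le_rsqrt by (simp flip: real_sqrt_mult)
    qed
    also have "\<dots> \<le> 2 ^ J * v"
    proof (intro mult_right_mono v)
      show "sqrt (real (card I)) \<le> 2 ^ J"
        using J by (intro real_le_lsqrt) (auto simp: power2_eq_square intro: order_trans[OF J])
    qed
    finally have "(\<Sum>t\<in>I. \<bar>c t\<bar>) * (3 * (d * (1/2) ^ J)) \<le> (2 ^ J * v) * (3 * (d * (1/2) ^ J))"
      using kd by (intro mult_right_mono) auto
    also have "\<dots> = 3 * d * v * (2 * (1/2)) ^ J" by (simp only: power_mult_distrib) (simp add: algebra_simps)
    finally show "(\<Sum>t\<in>I. \<bar>c t\<bar> * (3 * (d * (1/2) ^ J))) \<le> 3 * d * v"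
      by (simp add: sum_distrib_right)
  qed
  have iD: "integrable M (D t j)" for t j
  proof (cases j)
    case 0
    then show ?thesis using lp_le_center(1)[OF p D0] kd by auto
  next
    case (Suc i)
    then show ?thesis using lp_le_center(1)[OF p DS[of t i]] kd by auto
  qed
  have iR: "integrable M (\<lambda>\<omega>. X t \<omega> - Y t J \<omega>)" for t
    using kd lp_le_center(1)[OF p XY'] by auto
  have iX: "integrable M (X t)" for t using kd lp_le_center(1)[OF p X] by auto
  have tel: "X t \<omega> = D t 0 \<omega> + (\<Sum>j<J. D t (Suc j) \<omega>) + (X t \<omega> - Y t J \<omega>)" for t \<omega>
  proof -
    have "(\<Sum>j<n. D t (Suc j) \<omega>) = Y t n \<omega> - Y t 0 \<omega>" for n
      by (induction n) (auto simp: D_def)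
    then show ?thesis by (simp add: D_def)
  qed
  have eX: "expectation (X t) = expectation (D t 0) + (\<Sum>j<J. expectation (D t (Suc j))) + expectation (\<lambda>\<omega>. X t \<omega> - Y t J \<omega>)" for t
  proof -
    have "expectation (X t) = expectation (\<lambda>\<omega>. D t 0 \<omega> + (\<Sum>j<J. D t (Suc j) \<omega>) + (X t \<omega> - Y t J \<omega>))"
      using tel by (intro Bochner_Integration.integral_cong) auto
    also have "\<dots> = expectation (\<lambda>\<omega>. D t 0 \<omega> + (\<Sum>j<J. D t (Suc j) \<omega>)) + expectation (\<lambda>\<omega>. X t \<omega> - Y t J \<omega>)"
      using iD iR by (intro Bochner_Integration.integral_add Bochner_Integration.integrable_add Bochner_Integration.integrable_sum) auto
    also have "expectation (\<lambda>\<omega>. D t 0 \<omega> + (\<Sum>j<J. D t (Suc j) \<omega>)) = expectation (D t 0) + expectation (\<lambda>\<omega>. \<Sum>j<J. D t (Suc j) \<omega>)"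
      using iD by (intro Bochner_Integration.integral_add Bochner_Integration.integrable_sum) auto
    finally show ?thesis using iD by (simp add: Bochner_Integration.integral_sum)
  qed
  have eq: "?E X c \<omega> = ?E (\<lambda>t. D t 0) c \<omega> + (\<Sum>j<J. ?E (\<lambda>t. D t (Suc j)) c \<omega>) + ?E (\<lambda>t \<omega>. X t \<omega> - Y t J \<omega>) c \<omega>" for \<omega>
  proof -
    have "(\<Sum>j<J. ?E (\<lambda>t. D t (Suc j)) c \<omega>) = (\<Sum>t\<in>I. c t * ((\<Sum>j<J. D t (Suc j) \<omega>) - (\<Sum>j<J. expectation (D t (Suc j)))))"
      by (subst sum.swap) (simp add: sum_distrib_left sum_subtractf right_diff_distrib)
    moreover have "c t * (X t \<omega> - expectation (X t)) = c t * (D t 0 \<omega> - expectation (D t 0)) +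
        c t * ((\<Sum>j<J. D t (Suc j) \<omega>) - (\<Sum>j<J. expectation (D t (Suc j)))) +
        c t * (X t \<omega> - Y t J \<omega> - expectation (\<lambda>\<omega>. X t \<omega> - Y t J \<omega>))" for t
      unfolding distrib_left[symmetric] using eX[of t] tel[of t \<omega>] by (intro arg_cong2[where f = "(*)"]) auto
    ultimately show ?thesis by (simp only: sum.distrib)
  qed
  have "lp_le M p (?E X c) (B * (3 * (k + d)) * v + (\<Sum>j<J. B * (9 * d) * v * (3/4) ^ j) + 3 * d * v)"
    unfolding eq by (intro lp_le_add lp_le_sum p S0 SS R) auto
  then show ?thesis unfolding p_def
  proof (rule lp_le_mono)
    have "(\<Sum>j<J. (3/4 :: real) ^ j) \<le> 4"
      by (subst sum_gp_strict) (simp add: field_simps)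
    hence "(\<Sum>j<J. B * (9 * d) * v * (3/4) ^ j) \<le> B * (9 * d) * v * 4"
      unfolding sum_distrib_left[symmetric] using B v kd by (intro mult_left_mono) auto
    moreover have "0 \<le> B * d * v" using B v kd by auto
    ultimately show "B * (3 * (k + d)) * v + (\<Sum>j<J. B * (9 * d) * v * (3/4) ^ j) + 3 * d * v
        \<le> approx_const q k d * sqrt (\<Sum>t\<in>I. (c t)\<^sup>2)"
      unfolding approx_const_def B_def[symmetric] v_def[symmetric] by (simp add: algebra_simps)
  qed
qed

end

section \<open>Almost sure bounds of partial sums\<close>

context prob_space
begin

text \<open>The whole nonnegative series has finite expectation, hence is almost surely finite, and
  its value bounds all finite partial sums at once. One null set thus serves all indices.\<close>

lemma AE_weighted_series_bound:
  fixes Y :: "nat \<Rightarrow> nat \<Rightarrow> nat \<Rightarrow> 'a \<Rightarrow> real" and w1 w2 w3 :: "nat \<Rightarrow> real"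
  assumes Y: "\<And>i j b. integrable M (Y i j b)" "\<And>i j b \<omega>. 0 \<le> Y i j b \<omega>" "\<And>i j b. expectation (Y i j b) \<le> K"
    and w: "summable w1" "summable w2" "summable w3" "\<And>i. 0 \<le> w1 i" "\<And>i. 0 \<le> w2 i" "\<And>i. 0 \<le> w3 i"
  shows "AE \<omega> in M. \<exists>W\<ge>0. \<forall>n m l. (\<Sum>i<n. \<Sum>j<m. \<Sum>b<l. w1 i * w2 j * w3 b * Y i j b \<omega>) \<le> W"
proof -
  have K: "0 \<le> K" using Y(3)[of 0 0 0] integral_nonneg_AE[of "Y 0 0 0" M] Y(2) by (meson AE_I2 order_trans)
  have [measurable]: "Y i j b \<in> borel_measurable M" for i j b using Y(1) by auto
  define F where "F \<omega> = (\<Sum>i. \<Sum>j. \<Sum>b. ennreal (w1 i) * (ennreal (w2 j) * (ennreal (w3 b) * ennreal (Y i j b \<omega>))))" for \<omega>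
  have [measurable]: "F \<in> borel_measurable M" unfolding F_def by measurable
  have "(\<integral>\<^sup>+\<omega>. F \<omega> \<partial>M) = (\<Sum>i. \<Sum>j. \<Sum>b. ennreal (w1 i) * (ennreal (w2 j) * (ennreal (w3 b) * (\<integral>\<^sup>+\<omega>. ennreal (Y i j b \<omega>) \<partial>M))))"
    unfolding F_def by (simp add: nn_integral_suminf nn_integral_cmult)
  also have "\<dots> \<le> (\<Sum>i. \<Sum>j. \<Sum>b. ennreal (w1 i) * (ennreal (w2 j) * (ennreal (w3 b) * ennreal K)))"
    using Y by (intro suminf_le mult_left_mono) (auto simp: nn_integral_eq_integral ennreal_leI)
  also have "\<dots> = (\<Sum>i. ennreal (w1 i)) * ((\<Sum>j. ennreal (w2 j)) * ((\<Sum>b. ennreal (w3 b)) * ennreal K))"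
    by (simp add: ennreal_suminf_cmult ennreal_suminf_multc)
  also have "\<dots> < \<top>"
    using ennreal_suminf_neq_top[OF w(1,4)] ennreal_suminf_neq_top[OF w(2,5)] ennreal_suminf_neq_top[OF w(3,6)]
    by (simp add: ennreal_mult_less_top less_top)
  finally have "AE \<omega> in M. F \<omega> \<noteq> \<infinity>" by (intro nn_integral_PInf_AE) auto
  then show ?thesis
  proof eventually_elim
    case (elim \<omega>)
    have "(\<Sum>i<n. \<Sum>j<m. \<Sum>b<l. w1 i * w2 j * w3 b * Y i j b \<omega>) \<le> enn2real (F \<omega>)" for n m l
    proof -
      have "ennreal (\<Sum>i<n. \<Sum>j<m. \<Sum>b<l. w1 i * w2 j * w3 b * Y i j b \<omega>)
          = (\<Sum>i<n. \<Sum>j<m. \<Sum>b<l. ennreal (w1 i) * (ennreal (w2 j) * (ennreal (w3 b) * ennreal (Y i j b \<omega>))))"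
        using w Y by (simp add: sum_ennreal[symmetric] sum_nonneg ennreal_mult' mult.assoc)
      also have "\<dots> \<le> (\<Sum>i<n. \<Sum>j<m. \<Sum>b. ennreal (w1 i) * (ennreal (w2 j) * (ennreal (w3 b) * ennreal (Y i j b \<omega>))))"
        by (intro sum_mono sum_le_suminf) auto
      also have "\<dots> \<le> (\<Sum>i<n. \<Sum>j. \<Sum>b. ennreal (w1 i) * (ennreal (w2 j) * (ennreal (w3 b) * ennreal (Y i j b \<omega>))))"
        by (intro sum_mono sum_le_suminf) auto
      also have "\<dots> \<le> F \<omega>" unfolding F_def by (intro sum_le_suminf) auto
      also have "F \<omega> = ennreal (enn2real (F \<omega>))" using elim by (simp add: less_top)
      finally show ?thesis by (simp add: ennreal_le_iff)
    qed
    then show ?case using enn2real_nonneg by blast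
  qed
qed

end

text \<open>Binary expansion of m: the points m * 2^j and (m div 2) * 2^(j+1) coincide or differ by
  one block of length 2^j, so about log2 m blocks lead from 0 to the endpoint. As \<open>B\<close>
  is monotone, its value at the last endpoint covers all of them. The scale stays arbitrary in the
  induction because every halving raises it.\<close>

lemma dyadic_chaining:
  fixes G B :: "nat \<Rightarrow> real"
  assumes "mono B" "G 0 = 0" and blk: "\<And>b j. \<bar>G ((b + 1) * 2 ^ j) - G (b * 2 ^ j)\<bar> \<le> B ((b + 1) * 2 ^ j)"
    and "m \<ge> 1"
  shows "\<bar>G (m * 2 ^ j)\<bar> \<le> B (m * 2 ^ j) * (1 + log 2 (real m))"
  using assms(4)
proof (induction m arbitrary: j rule: less_induct)
  case (less m)
  have B0: "0 \<le> B (b * 2 ^ j)" if "b \<ge> 1" for b j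
    using order_trans[OF abs_ge_zero blk[of "b - 1" j]] that by simp
  show ?case
  proof (cases "m = 1")
    case True
    then show ?thesis using blk[of 0 j] assms(2) by simp
  next
    case False
    define k where "k = m div 2"
    have k: "k \<ge> 1" "k < m" using False less.prems by (auto simp: k_def)
    have IH: "\<bar>G (k * 2 ^ Suc j)\<bar> \<le> B (k * 2 ^ Suc j) * (1 + log 2 (real k))"
      using less.IH[OF k(2,1)] .
    have lk: "log 2 (real k) \<ge> 0" using k by simp
    have mk: "m = 2 * k \<or> m = 2 * k + 1" by (auto simp: k_def)
    have le: "k * 2 ^ Suc j \<le> m * 2 ^ j"
      using mk by auto
    have "\<bar>G (m * 2 ^ j) - G (k * 2 ^ Suc j)\<bar> \<le> B (m * 2 ^ j)"
      using mk
    proof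
      assume "m = 2 * k"
      then show ?thesis using B0[OF less.prems] by (simp add: mult_ac)
    next
      assume "m = 2 * k + 1"
      then show ?thesis using blk[of "2 * k" j] by (simp add: mult_ac)
    qed
    then have "\<bar>G (m * 2 ^ j)\<bar> \<le> B (m * 2 ^ j) + B (k * 2 ^ Suc j) * (1 + log 2 (real k))"
      using IH by linarith
    also have "\<dots> \<le> B (m * 2 ^ j) + B (m * 2 ^ j) * (1 + log 2 (real k))"
      using monoD[OF assms(1) le] lk by (intro add_left_mono mult_right_mono) auto
    also have "\<dots> = B (m * 2 ^ j) * (1 + log 2 (2 * real k))"
      using k by (simp add: log_mult algebra_simps)
    also have "\<dots> \<le> B (m * 2 ^ j) * (1 + log 2 (real m))"
      using B0[OF less.prems] mk k by (intro mult_left_mono add_left_mono) auto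
    finally show ?thesis .
  qed
qed

lemma one_add_log2_le_powr:
  assumes "s > 0" "n \<ge> 1"
  shows "1 + log 2 (real n) \<le> (1 + 1 / (s * ln 2)) * real n powr s"
proof -
  have "ln (real n) \<le> real n powr s / s" using assms by (intro ln_powr_bound) auto
  then have "log 2 (real n) \<le> real n powr s / s / ln 2"
    unfolding log_def by (intro divide_right_mono) auto
  moreover have "1 \<le> real n powr s" using assms ge_one_powr_ge_zero by auto
  ultimately show ?thesis by (simp add: field_simps)
qed

lemma summable_Suc_powr:
  assumes "\<delta> > 0" shows "summable (\<lambda>i. real (Suc i) powr (- (1 + \<delta>)))"
  using assms summable_real_powr_iff[of "- (1 + \<delta>)"]
  by (subst summable_Suc_iff) auto

lemma sum_greaterThanAtMost_diff:
  fixes x :: "int \<Rightarrow> real"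
  assumes "m \<le> n"
  shows "(\<Sum>t\<in>{1..int n}. x t) - (\<Sum>t\<in>{1..int m}. x t) = (\<Sum>t\<in>{int m<..int n}. x t)"
proof -
  have "{1..int n} = {1..int m} \<union> {int m<..int n}" using assms by auto
  moreover have "{1..int m} \<inter> {int m<..int n} = {}" by auto
  ultimately have "(\<Sum>t\<in>{1..int n}. x t) = (\<Sum>t\<in>{1..int m}. x t) + (\<Sum>t\<in>{int m<..int n}. x t)"
    by (simp add: sum.union_disjoint)
  then show ?thesis by simp
qed

context prob_space
begin

text \<open>A block of length 2^j has p-th moment of order 2^(jq); divided by this, the blocks of
  all assets share one bound in mean. The weights are summable over assets, scales and positions.
  Undoing them costs i^(1+\<delta>) and, beyond the order sqrt T, only a small power of T; the p-th
  root turns the former into the stated power of i.\<close>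

lemma AE_partial_sums_bound:
  fixes X :: "nat \<Rightarrow> int \<Rightarrow> 'a \<Rightarrow> real"
  assumes q: "q \<ge> 1" and \<delta>: "\<delta> > 0"
    and X: "\<And>i m n. i \<ge> 1 \<Longrightarrow> m \<le> n \<Longrightarrow>
       lp_le M (2 * q) (\<lambda>\<omega>. \<Sum>t\<in>{int m<..int n}. X i t \<omega>) (K * sqrt (real (n - m)))"
  shows "AE \<omega> in M. \<exists>W\<ge>0. \<forall>i\<ge>1. \<forall>T\<ge>1. \<bar>\<Sum>t\<in>{1..int T}. X i t \<omega>\<bar>
           \<le> W * real i powr ((1 + \<delta>) / (2 * q)) * real T powr (1/2 + \<delta>)"
proof -
  define p where "p = 2 * q"
  have p: "even p" "p > 0" using q by (auto simp: p_def)
  define bl where "bl i j b \<omega> = (\<Sum>t\<in>{int (b * 2 ^ j)<..int ((b + 1) * 2 ^ j)}. X (Suc i) t \<omega>)" for i j b \<omega>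
  define Y where "Y i j b \<omega> = bl i j b \<omega> ^ p / (2 ^ j) ^ q" for i j b \<omega>
  have bl: "lp_le M p (bl i j b) (K * sqrt (2 ^ j))" for i j b
    using X[of "Suc i" "b * 2 ^ j" "(b + 1) * 2 ^ j"] by (simp add: bl_def[abs_def] p_def)
  have eY: "expectation (Y i j b) \<le> K ^ p" for i j b
  proof -
    have "expectation (\<lambda>\<omega>. bl i j b \<omega> ^ p) / (2 ^ j) ^ q \<le> (K * sqrt (2 ^ j)) ^ p / (2 ^ j) ^ q"
      using lp_leD(4)[OF bl] by (intro divide_right_mono) auto
    also have "(K * sqrt (2 ^ j)) ^ p = K ^ p * (2 ^ j) ^ q"
      by (simp add: p_def power_mult power_mult_distrib)
    finally show ?thesis by (simp add: Y_def[abs_def])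
  qed
  define w where "w i = real (Suc i) powr (- (1 + \<delta>))" for i
  have w1: "w i * real (Suc i) powr (1 + \<delta>) = 1" for i
    unfolding w_def by (subst powr_add[symmetric]) simp
  have AE: "AE \<omega> in M. \<exists>W\<ge>0. \<forall>n m l. (\<Sum>i<n. \<Sum>j<m. \<Sum>b<l. w i * (2 powr - \<delta>) ^ j * w b * Y i j b \<omega>) \<le> W"
  proof (rule AE_weighted_series_bound)
    show "integrable M (Y i j b)" for i j b using lp_leD(2)[OF bl] by (auto simp: Y_def[abs_def])
    show "0 \<le> Y i j b \<omega>" for i j b \<omega> using p by (simp add: Y_def zero_le_even_power)
    show "expectation (Y i j b) \<le> K ^ p" for i j b by (rule eY)
    show "summable w" "summable w" unfolding w_def using summable_Suc_powr[OF \<delta>] by auto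
    show "summable (\<lambda>j. (2 powr - \<delta>) ^ j)" using \<delta> by (intro summable_geometric) (auto simp: powr_less_one)
  qed (auto simp: w_def)
  \<comment> \<open>Half of \<delta> is reserved for the logarithm of the chaining; the other half
    covers \<delta>/p because p >= 2.\<close>
  define c where "c = 1 + 1 / (\<delta> / 2 * ln 2)"
  have c: "c \<ge> 0" using \<delta> by (auto simp: c_def)
  show ?thesis using AE
  proof eventually_elim
    case (elim \<omega>)
    then obtain W where W: "W \<ge> 0" "\<And>n m l. (\<Sum>i<n. \<Sum>j<m. \<Sum>b<l. w i * (2 powr - \<delta>) ^ j * w b * Y i j b \<omega>) \<le> W"
      by auto
    have Y0: "0 \<le> Y i j b \<omega>" for i j b using p by (simp add: Y_def zero_le_even_power)
    have term0: "0 \<le> w i * (2 powr - \<delta>) ^ j * w b * Y i j b \<omega>" for i j b using Y0 by (auto simp: w_def)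
    have trm: "w i * (2 powr - \<delta>) ^ j * w b * Y i j b \<omega> \<le> W" for i j b
    proof -
      have "w i * (2 powr - \<delta>) ^ j * w b * Y i j b \<omega> \<le> (\<Sum>b<Suc b. w i * (2 powr - \<delta>) ^ j * w b * Y i j b \<omega>)"
        using term0 by (intro member_le_sum) auto
      also have "\<dots> \<le> (\<Sum>j<Suc j. \<Sum>b<Suc b. w i * (2 powr - \<delta>) ^ j * w b * Y i j b \<omega>)"
        by (rule member_le_sum[of j _ "\<lambda>j. \<Sum>b<Suc b. w i * (2 powr - \<delta>) ^ j * w b * Y i j b \<omega>"]) (auto intro!: sum_nonneg term0 add_nonneg_nonneg)
      also have "\<dots> \<le> (\<Sum>i<Suc i. \<Sum>j<Suc j. \<Sum>b<Suc b. w i * (2 powr - \<delta>) ^ j * w b * Y i j b \<omega>)"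
        by (rule member_le_sum[of i _ "\<lambda>i. \<Sum>j<Suc j. \<Sum>b<Suc b. w i * (2 powr - \<delta>) ^ j * w b * Y i j b \<omega>"]) (auto intro!: sum_nonneg term0 add_nonneg_nonneg)
      also have "\<dots> \<le> W" by (rule W)
      finally show ?thesis .
    qed
    define A where "A i n = (W * real i powr (1 + \<delta>) * real n powr (q + \<delta>)) powr (1 / p)" for i n :: nat
    have blk: "\<bar>bl i j b \<omega>\<bar> \<le> A (Suc i) ((b + 1) * 2 ^ j)" for i j b
    proof -
      have w2: "(2 powr - \<delta>) ^ j = (2 ^ j) powr - \<delta>"
        by (simp add: powr_realpow[symmetric] powr_powr mult.commute)
      have "bl i j b \<omega> ^ p = (w i * (2 powr - \<delta>) ^ j * w b * Y i j b \<omega>) * (real (Suc i) powr (1 + \<delta>) * real (Suc b) powr (1 + \<delta>) * (2 ^ j) powr \<delta> * (2 ^ j) ^ q)"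
      proof -
        have w3: "(2 ^ j) powr - \<delta> * (2 ^ j) powr \<delta> = (1::real)" by (subst powr_add[symmetric]) simp
        have "bl i j b \<omega> ^ p = Y i j b \<omega> * (2 ^ j) ^ q" by (simp add: Y_def)
        also have "\<dots> = (w i * real (Suc i) powr (1 + \<delta>)) * (w b * real (Suc b) powr (1 + \<delta>)) *
            ((2 ^ j) powr - \<delta> * (2 ^ j) powr \<delta>) * (Y i j b \<omega> * (2 ^ j) ^ q)"
          unfolding w1 w3 by simp
        finally show ?thesis unfolding w2 by (simp only: mult_ac)
      qed
      also have "\<dots> \<le> W * (real (Suc i) powr (1 + \<delta>) * real (Suc b) powr (1 + \<delta>) * (2 ^ j) powr \<delta> * (2 ^ j) ^ q)"
        using trm by (intro mult_right_mono) auto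
      \<comment> \<open>Raising the exponent of the position from 1 to q, possible since q >= 1,
        merges position and block length into the right endpoint (b + 1) * 2^j.\<close>
      also have "\<dots> \<le> W * (real (Suc i) powr (1 + \<delta>) * real (Suc b) powr (q + \<delta>) * (2 ^ j) powr \<delta> * (2 ^ j) ^ q)"
        using W q by (intro mult_left_mono mult_right_mono powr_mono) auto
      also have "\<dots> = W * real (Suc i) powr (1 + \<delta>) * real ((b + 1) * 2 ^ j) powr (q + \<delta>)"
      proof -
        have "real ((b + 1) * 2 ^ j) powr (q + \<delta>) = real (Suc b) powr (q + \<delta>) * (2 ^ j) powr (q + \<delta>)"
          by (subst powr_mult[symmetric]) (auto simp: algebra_simps)
        also have "(2 ^ j) powr (q + \<delta>) = (2 ^ j) powr \<delta> * (2 ^ j :: real) ^ q"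
          by (simp add: powr_add powr_realpow)
        finally show ?thesis by (simp only: mult_ac)
      qed
      finally have le: "bl i j b \<omega> ^ p \<le> W * real (Suc i) powr (1 + \<delta>) * real ((b + 1) * 2 ^ j) powr (q + \<delta>)" .
      have "\<bar>bl i j b \<omega>\<bar> = (\<bar>bl i j b \<omega>\<bar> ^ p) powr (1 / p)"
        using p by (cases "bl i j b \<omega> = 0") (auto simp: powr_realpow[symmetric] powr_powr zero_power)
      also have "\<dots> \<le> A (Suc i) ((b + 1) * 2 ^ j)"
        unfolding A_def using p le by (intro powr_mono2) (auto simp: power_even_abs zero_le_even_power)
      finally show ?thesis .
    qed
    have "\<bar>\<Sum>t\<in>{1..int T}. X i t \<omega>\<bar> \<le> (W powr (1 / p) * c) * real i powr ((1 + \<delta>) / p) * real T powr (1/2 + \<delta>)"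
      if iT: "i \<ge> 1" "T \<ge> 1" for i T
    proof -
      obtain i' where i': "i = Suc i'" using iT by (cases i) auto
      let ?G = "\<lambda>n. \<Sum>t\<in>{1..int n}. X i t \<omega>"
      have "\<bar>?G (T * 2 ^ 0)\<bar> \<le> A i (T * 2 ^ 0) * (1 + log 2 (real T))"
      proof (rule dyadic_chaining)
        show "mono (A i)" unfolding A_def
          using W q \<delta> by (intro monoI powr_mono2 mult_left_mono) auto
        show "\<bar>?G ((b + 1) * 2 ^ j) - ?G (b * 2 ^ j)\<bar> \<le> A i ((b + 1) * 2 ^ j)" for b j
          using blk[of i' j b] sum_greaterThanAtMost_diff[of "b * 2 ^ j" "(b + 1) * 2 ^ j" "\<lambda>t. X i t \<omega>"]
          unfolding i' bl_def by simp
      qed (use that in auto)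
      also have "\<dots> \<le> A i T * (c * real T powr (\<delta> / 2))"
        using one_add_log2_le_powr[of "\<delta> / 2" T] \<delta> that
        by (auto simp: A_def c_def intro!: mult_left_mono)
      also have "A i T = W powr (1 / p) * real i powr ((1 + \<delta>) / p) * real T powr ((q + \<delta>) / p)"
        using W by (simp add: A_def powr_mult powr_powr)
      also have "(q + \<delta>) / p = 1/2 + \<delta> / p" using q by (simp add: p_def field_simps)
      also have "W powr (1 / p) * real i powr ((1 + \<delta>) / p) * real T powr (1/2 + \<delta> / p) * (c * real T powr (\<delta> / 2))
          = (W powr (1 / p) * c) * real i powr ((1 + \<delta>) / p) * (real T powr (1/2 + \<delta> / p + \<delta> / 2))"
        by (simp add: powr_add algebra_simps)
      also have "\<dots> \<le> (W powr (1 / p) * c) * real i powr ((1 + \<delta>) / p) * (real T powr (1/2 + \<delta>))"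
      proof (intro mult_left_mono powr_mono)
        have "\<delta> / p \<le> \<delta> / 2" using q \<delta> by (intro divide_left_mono) (auto simp: p_def)
        then show "1 / 2 + \<delta> / real p + \<delta> / 2 \<le> 1 / 2 + \<delta>" by linarith
      qed (use that c in auto)
      finally show ?thesis by simp
    qed
    then show ?case using c by (intro exI[of _ "W powr (1 / p) * c"]) (auto simp: p_def)
  qed
qed

text \<open>First moments suffice when a factor (N T)^\<delta> may be lost: the weights
  i^(-1-\<delta>) t^(-1-\<delta>) make the expected series finite, and inside the panel they are at
  least (N T)^(-1-\<delta>).\<close>

lemma AE_double_sum_bound:
  fixes X :: "nat \<Rightarrow> int \<Rightarrow> 'a \<Rightarrow> real"
  assumes \<delta>: "\<delta> > 0"
    and X: "\<And>i t. i \<ge> 1 \<Longrightarrow> integrable M (X i t)" "\<And>i t \<omega>. i \<ge> 1 \<Longrightarrow> 0 \<le> X i t \<omega>" "\<And>i t. i \<ge> 1 \<Longrightarrow> expectation (X i t) \<le> K"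
  shows "AE \<omega> in M. \<exists>W\<ge>0. \<forall>N T. (\<Sum>i\<in>{1..N}. \<Sum>t\<in>{1..int T}. X i t \<omega>) \<le> W * (real N * real T) powr (1 + \<delta>)"
proof -
  define w where "w i = real (Suc i) powr (- (1 + \<delta>))" for i
  have w1: "w i * real (Suc i) powr (1 + \<delta>) = 1" for i
    unfolding w_def by (subst powr_add[symmetric]) simp
  have w0: "0 \<le> w i" for i by (simp add: w_def)
  have sw: "summable w" unfolding w_def using summable_Suc_powr[OF \<delta>] by auto
  \<comment> \<open>The third summation is a dummy that adapts two indices to the general series; it
    is later cut down to b = 0, whose weight is 1.\<close>
  have AE: "AE \<omega> in M. \<exists>W\<ge>0. \<forall>n m l. (\<Sum>i<n. \<Sum>j<m. \<Sum>b<l. w i * w j * (1/2) ^ b * X (Suc i) (int (Suc j)) \<omega>) \<le> W"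
    using sw X w0 by (intro AE_weighted_series_bound[where K = K]) auto
  show ?thesis using AE
  proof eventually_elim
    case (elim \<omega>)
    then obtain W where W: "W \<ge> 0" "\<And>n m l. (\<Sum>i<n. \<Sum>j<m. \<Sum>b<l. w i * w j * (1/2) ^ b * X (Suc i) (int (Suc j)) \<omega>) \<le> W"
      by auto
    have "(\<Sum>i\<in>{1..N}. \<Sum>t\<in>{1..int T}. X i t \<omega>) \<le> W * (real N * real T) powr (1 + \<delta>)" for N T
    proof -
      have r1: "(\<Sum>t\<in>{1..int T}. g t) = (\<Sum>j<T. g (int (Suc j)))" for g :: "int \<Rightarrow> real"
        by (rule sum.reindex_bij_witness[of _ "\<lambda>j. int (Suc j)" "\<lambda>t. nat t - 1"]) auto
      have r2: "(\<Sum>i\<in>{1..N}. g i) = (\<Sum>i<N. g (Suc i))" for g :: "nat \<Rightarrow> real"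
        by (rule sum.reindex_bij_witness[of _ "\<lambda>j. Suc j" "\<lambda>t. t - 1"]) auto
      have "(\<Sum>i\<in>{1..N}. \<Sum>t\<in>{1..int T}. X i t \<omega>) = (\<Sum>i<N. \<Sum>j<T. X (Suc i) (int (Suc j)) \<omega>)"
        unfolding r1 r2 ..
      also have "\<dots> \<le> (\<Sum>i<N. \<Sum>j<T. (real N * real T) powr (1 + \<delta>) * (w i * w j * X (Suc i) (int (Suc j)) \<omega>))"
      proof (intro sum_mono)
        fix i j assume ij: "i \<in> {..<N}" "j \<in> {..<T}"
        have "1 = (real (Suc i) powr (1 + \<delta>) * real (Suc j) powr (1 + \<delta>)) * (w i * w j)"
        proof -
          have "(real (Suc i) powr (1 + \<delta>) * real (Suc j) powr (1 + \<delta>)) * (w i * w j)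
              = (w i * real (Suc i) powr (1 + \<delta>)) * (w j * real (Suc j) powr (1 + \<delta>))"
            by (simp only: mult_ac)
          then show ?thesis unfolding w1 by simp
        qed
        also have "\<dots> \<le> (real N powr (1 + \<delta>) * real T powr (1 + \<delta>)) * (w i * w j)"
          using ij \<delta> by (intro mult_right_mono mult_mono powr_mono2) (auto simp: w_def)
        finally have "1 * X (Suc i) (int (Suc j)) \<omega> \<le> ((real N powr (1 + \<delta>) * real T powr (1 + \<delta>)) * (w i * w j)) * X (Suc i) (int (Suc j)) \<omega>"
          using X(2) by (intro mult_right_mono) auto
        then show "X (Suc i) (int (Suc j)) \<omega> \<le> (real N * real T) powr (1 + \<delta>) * (w i * w j * X (Suc i) (int (Suc j)) \<omega>)"
          by (simp add: powr_mult mult.assoc)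
      qed
      also have "\<dots> = (real N * real T) powr (1 + \<delta>) * (\<Sum>i<N. \<Sum>j<T. \<Sum>b<1. w i * w j * (1/2) ^ b * X (Suc i) (int (Suc j)) \<omega>)"
        by (simp add: sum_distrib_left)
      also have "\<dots> \<le> (real N * real T) powr (1 + \<delta>) * W"
        by (intro mult_left_mono W) auto
      finally show ?thesis by (simp add: mult.commute)
    qed
    then show ?case using W by blast
  qed
qed

end

section \<open>Decomposable shifts\<close>

text \<open>Jensen's inequality for the uniform weights on \<open>I\<close>.\<close>

lemma sum_power_le_card_power:
  fixes x :: "'i \<Rightarrow> real"
  assumes "finite I" "q \<ge> 1" "\<And>t. 0 \<le> x t"
  shows "(\<Sum>t\<in>I. x t) ^ q \<le> real (card I) ^ (q - 1) * (\<Sum>t\<in>I. x t ^ q)"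
proof (cases "I = {}")
  case True
  then show ?thesis using assms by (simp add: zero_power)
next
  case False
  define n where "n = real (card I)"
  have n: "n > 0" using False assms by (auto simp: n_def card_gt_0_iff)
  have cv: "convex_on {0..} (\<lambda>x::real. x ^ q)"
  proof (cases "even q")
    case True
    then show ?thesis using convex_power_even convex_on_subset by blast
  next
    case False
    then show ?thesis by (rule convex_power_odd)
  qed
  have "(\<Sum>t\<in>I. (1 / n) *\<^sub>R x t) ^ q \<le> (\<Sum>t\<in>I. (1 / n) * x t ^ q)"
    using n False assms by (intro convex_on_sum[OF _ _ cv]) (auto simp: n_def)
  then have "((\<Sum>t\<in>I. x t) / n) ^ q \<le> (\<Sum>t\<in>I. x t ^ q) / n"
    by (simp add: sum_divide_distrib)
  then have "(\<Sum>t\<in>I. x t) ^ q \<le> n ^ q * ((\<Sum>t\<in>I. x t ^ q) / n)"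
    using n by (simp add: power_divide field_simps)
  also have "\<dots> = n ^ (q - 1) * (\<Sum>t\<in>I. x t ^ q)" using n assms(2) by (cases q) auto
  finally show ?thesis by (simp add: n_def)
qed

context prob_space
begin

text \<open>\<open>indep_rv\<close> speaks of generated sigma-algebras. On measurable rectangles
  this is the product formula, and rectangles determine a product measure. Measurability comes along
  because the sigma-algebras consist of events.\<close>

lemma indep_rv_distr:
  assumes "indep_rv M A X B Y" "X \<in> space M \<rightarrow> space A" "Y \<in> space M \<rightarrow> space B"
  shows "X \<in> measurable M A" "Y \<in> measurable M B"
    "distr M A X \<Otimes>\<^sub>M distr M B Y = distr M (A \<Otimes>\<^sub>M B) (\<lambda>\<omega>. (X \<omega>, Y \<omega>))"
proof -
  have ind: "indep_set (sets (vimage_algebra (space M) X A)) (sets (vimage_algebra (space M) Y B))"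
    using assms(1) by (simp add: indep_rv_def)
  note sX = sets_vimage_algebra2[OF assms(2)] and sY = sets_vimage_algebra2[OF assms(3)]
  have ev: "sets (vimage_algebra (space M) X A) \<subseteq> events" "sets (vimage_algebra (space M) Y B) \<subseteq> events"
    and pr: "\<And>a b. a \<in> sets (vimage_algebra (space M) X A) \<Longrightarrow> b \<in> sets (vimage_algebra (space M) Y B) \<Longrightarrow> prob (a \<inter> b) = prob a * prob b"
    using ind by (auto simp: indep_sets2_eq)
  show [measurable]: "X \<in> measurable M A" "Y \<in> measurable M B"
    using ev assms(2,3) unfolding sX sY by (auto intro!: measurableI)
  interpret DX: prob_space "distr M A X" by (rule prob_space_distr) measurable
  interpret DY: prob_space "distr M B Y" by (rule prob_space_distr) measurable
  show "distr M A X \<Otimes>\<^sub>M distr M B Y = distr M (A \<Otimes>\<^sub>M B) (\<lambda>\<omega>. (X \<omega>, Y \<omega>))"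
  proof (rule pair_measure_eqI)
    fix a b assume "a \<in> sets (distr M A X)" "b \<in> sets (distr M B Y)"
    then have [measurable]: "a \<in> sets A" "b \<in> sets B" by auto
    have eq: "(\<lambda>\<omega>. (X \<omega>, Y \<omega>)) -` (a \<times> b) \<inter> space M = (X -` a \<inter> space M) \<inter> (Y -` b \<inter> space M)" by auto
    have "prob ((X -` a \<inter> space M) \<inter> (Y -` b \<inter> space M)) = prob (X -` a \<inter> space M) * prob (Y -` b \<inter> space M)"
      by (rule pr) (auto simp: sX sY)
    then show "emeasure (distr M A X) a * emeasure (distr M B Y) b = emeasure (distr M (A \<Otimes>\<^sub>M B) (\<lambda>\<omega>. (X \<omega>, Y \<omega>))) (a \<times> b)"
      by (simp add: emeasure_distr eq emeasure_eq_measure ennreal_mult)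
  qed (auto intro: DX.sigma_finite_measure_axioms DY.sigma_finite_measure_axioms)
qed

text \<open>The passage from the real exponent \<nu> to an even integer \<open>p\<close>. Comparing
  |D| / s with 1 loses a factor 2 in the p-th moment, and 2 <= 2^p moves it into the norm.\<close>

lemma lp_le_of_powr_moment:
  assumes "even p" "real p \<le> \<nu>" "p \<ge> 1" "X \<in> borel_measurable M" "D \<in> borel_measurable M"
    and XD: "\<And>\<omega>. \<omega> \<in> space M \<Longrightarrow> \<bar>X \<omega>\<bar> \<le> norm (D \<omega> :: 'b::euclidean_space)"
    and i: "integrable M (\<lambda>\<omega>. norm (D \<omega>) powr \<nu>)" and L: "Lnorm M \<nu> D \<le> s" and s: "s > 0"
  shows "lp_le M p X (2 * s)"
proof -
  note [measurable] = assms(4,5)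
  let ?g = "\<lambda>\<omega>. s ^ p + s ^ p * (norm (D \<omega>) powr \<nu> / s powr \<nu>)"
  have nu: "\<nu> \<ge> 1" using assms by linarith
  have le: "X \<omega> ^ p \<le> ?g \<omega>" if "\<omega> \<in> space M" for \<omega>
  proof -
    let ?t = "norm (D \<omega>)"
    have "X \<omega> ^ p \<le> ?t ^ p" using power_mono[OF XD[OF that], of p] assms(1) by (simp add: power_even_abs)
    also have "?t ^ p = s ^ p * (?t / s) ^ p" using s by (simp add: power_divide)
    also have "(?t / s) ^ p \<le> 1 + (?t / s) powr \<nu>"
    proof (cases "?t / s \<le> 1")
      case True
      then have "(?t / s) ^ p \<le> 1" using s by (intro power_le_one) auto
      then show ?thesis using powr_ge_zero[of "?t / s" \<nu>] by linarith
    next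
      case False
      then have "(?t / s) ^ p = (?t / s) powr p" by (subst powr_realpow) auto
      also have "\<dots> \<le> (?t / s) powr \<nu>" using False assms(2) by (intro powr_mono) auto
      finally show ?thesis by simp
    qed
    then have "s ^ p * (?t / s) ^ p \<le> s ^ p * (1 + (?t / s) powr \<nu>)" using s by (intro mult_left_mono) auto
    also have "\<dots> = ?g \<omega>" using s by (simp add: powr_divide distrib_left)
    finally show ?thesis .
  qed
  have ig: "integrable M ?g" using i by auto
  have iX: "integrable M (\<lambda>\<omega>. X \<omega> ^ p)"
    using le assms(1) by (intro Bochner_Integration.integrable_bound[OF ig])
      (auto simp: zero_le_even_power abs_of_nonneg intro!: AE_I2 order_trans[OF _ abs_ge_self])
  have "expectation (\<lambda>\<omega>. X \<omega> ^ p) \<le> expectation ?g"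
    using iX ig le by (intro integral_mono)
  also have "\<dots> = s ^ p + s ^ p * (expectation (\<lambda>\<omega>. norm (D \<omega>) powr \<nu>) / s powr \<nu>)"
    using i by (simp add: prob_space)
  also have "\<dots> \<le> s ^ p + s ^ p * (s powr \<nu> / s powr \<nu>)"
  proof (intro add_left_mono mult_left_mono divide_right_mono)
    have "expectation (\<lambda>\<omega>. norm (D \<omega>) powr \<nu>) = (Lnorm M \<nu> D) powr \<nu>"
      using nu by (simp add: Lnorm_def powr_powr integral_nonneg_AE)
    also have "\<dots> \<le> s powr \<nu>" using L nu by (intro powr_mono2) (auto simp: Lnorm_def)
    finally show "expectation (\<lambda>\<omega>. norm (D \<omega>) powr \<nu>) \<le> s powr \<nu>" .
  qed (use s in auto)
  also have "\<dots> = 2 * s ^ p" using s by simp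
  also have "\<dots> \<le> 2 ^ p * s ^ p" using assms(3) s self_le_power[of "2::real" p] by (intro mult_right_mono) auto
  finally show ?thesis using iX s assms(4) by (simp add: lp_le_def power_mult_distrib)
qed

text \<open>Innovations and all their copies form one family over a sum type, so that joint
  independence and the choice of arguments are handled once.\<close>

definition copies :: "(int \<Rightarrow> 'a \<Rightarrow> 's) \<Rightarrow> (int \<Rightarrow> int \<Rightarrow> nat \<Rightarrow> 'a \<Rightarrow> 's) \<Rightarrow> int + int \<times> int \<times> nat \<Rightarrow> 'a \<Rightarrow> 's" where
  "copies \<eta> \<eta>s = case_sum \<eta> (\<lambda>(s, t, l). \<eta>s s t l)"

text \<open>Injective in \<open>n\<close> for fixed \<open>t\<close> and \<open>l\<close>; this is
  what gives a coupled variable the law of the original one.\<close>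

definition coupled_index :: "int \<Rightarrow> nat \<Rightarrow> nat \<Rightarrow> int + int \<times> int \<times> nat" where
  "coupled_index t l n = (if n < l then Inl (t - int n) else Inr (t - int n, t, l))"

lemma coupled_eq: "coupled g \<eta> \<eta>s t l \<omega> = g (\<lambda>n. copies \<eta> \<eta>s (coupled_index t l n) \<omega>)"
  unfolding coupled_def by (intro arg_cong[where f=g] ext) (simp add: copies_def coupled_index_def)

lemma iid_copies_measurable:
  assumes "iid_copies M S \<eta> \<eta>s"
  shows "copies \<eta> \<eta>s k \<in> measurable M S"
  using assms unfolding iid_copies_def copies_def[symmetric] indep_vars_def by auto

lemma iid_copies_measurable_seq:
  assumes "iid_copies M S \<eta> \<eta>s"
  shows "(\<lambda>\<omega> n. copies \<eta> \<eta>s (\<sigma> n) \<omega>) \<in> measurable M (\<Pi>\<^sub>M n\<in>(UNIV::nat set). S)"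
  by (intro measurable_PiM_single') (auto intro: iid_copies_measurable[OF assms] measurable_space[OF iid_copies_measurable[OF assms]])

text \<open>Every injective choice from the family is again i.i.d. with the same marginal law, so
  the joint law does not depend on the choice. Stationarity of the shift and equality in law with
  its couplings are both instances.\<close>

lemma iid_copies_distr:
  fixes \<sigma> :: "nat \<Rightarrow> int + int \<times> int \<times> nat"
  assumes iid: "iid_copies M S \<eta> \<eta>s" and "inj \<sigma>"
  shows "distr M (\<Pi>\<^sub>M n\<in>UNIV. S) (\<lambda>\<omega> n. copies \<eta> \<eta>s (\<sigma> n) \<omega>) = (\<Pi>\<^sub>M n\<in>UNIV. distr M S (\<eta> 0))"
proof -
  let ?Z = "copies \<eta> \<eta>s"
  have ind: "indep_vars (\<lambda>_. S) ?Z UNIV" using iid unfolding iid_copies_def copies_def by auto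
  have d: "distr M S (?Z k) = distr M S (\<eta> 0)" for k
    using iid unfolding iid_copies_def copies_def by (auto split: sum.split)
  have "indep_vars (\<lambda>n. PiM {\<sigma> n} (\<lambda>_. S)) (\<lambda>n \<omega>. restrict (\<lambda>i. ?Z i \<omega>) {\<sigma> n}) UNIV"
    using assms(2) by (intro indep_vars_restrict[OF ind]) (auto simp: disjoint_family_on_def inj_def)
  from indep_vars_compose2[OF this, of "\<lambda>n f. f (\<sigma> n)" "\<lambda>_. S"]
  have "indep_vars (\<lambda>_. S) (\<lambda>n. ?Z (\<sigma> n)) UNIV"
    by (simp add: measurable_component_singleton)
  then have "distr M (\<Pi>\<^sub>M n\<in>UNIV. S) (\<lambda>\<omega>. \<lambda>n\<in>UNIV. ?Z (\<sigma> n) \<omega>) = (\<Pi>\<^sub>M n\<in>UNIV. distr M S (?Z (\<sigma> n)))"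
    by (subst (asm) indep_vars_iff_distr_eq_PiM') (use iid_copies_measurable[OF iid] in auto)
  then show ?thesis unfolding d by (simp add: restrict_def)
qed

text \<open>Cauchy-Schwarz read off from 0 <= (X^2 y/x - Y^2 x/y)^2, where the ratio of the norms
  balances the two fourth moments. A dominated \<open>Z\<close> in place of the product also covers
  differences of products.\<close>

lemma lp_le_mult:
  assumes A: "lp_le M 4 X x" "x > 0" and B: "lp_le M 4 Y y" "y > 0"
    and Z: "Z \<in> borel_measurable M" "\<And>\<omega>. \<bar>Z \<omega>\<bar> \<le> \<bar>X \<omega> * Y \<omega>\<bar>"
  shows "lp_le M 2 Z (x * y)"
proof -
  note [measurable] = Z(1)
  let ?g = "\<lambda>\<omega>. (X \<omega> ^ 4 * (y\<^sup>2 / x\<^sup>2) + Y \<omega> ^ 4 * (x\<^sup>2 / y\<^sup>2)) / 2"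
  have le: "Z \<omega> ^ 2 \<le> ?g \<omega>" for \<omega>
  proof -
    have "Z \<omega> ^ 2 \<le> (X \<omega> * Y \<omega>)\<^sup>2" using Z(2) by (simp add: abs_le_square_iff)
    also have "\<dots> \<le> ?g \<omega>"
    proof -
      have "0 \<le> ((X \<omega>)\<^sup>2 * (y / x) - (Y \<omega>)\<^sup>2 * (x / y))\<^sup>2" by simp
      also have "\<dots> = X \<omega> ^ 4 * (y\<^sup>2 / x\<^sup>2) + Y \<omega> ^ 4 * (x\<^sup>2 / y\<^sup>2) - 2 * (X \<omega> * Y \<omega>)\<^sup>2"
        using A(2) B(2) by (simp add: power2_diff power_mult_distrib power_divide flip: power_mult)
      finally show ?thesis by simp
    qed
    finally show ?thesis .
  qed
  have ig: "integrable M ?g" using lp_leD(2)[OF A(1)] lp_leD(2)[OF B(1)] by auto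
  have iZ: "integrable M (\<lambda>\<omega>. Z \<omega> ^ 2)"
    using le by (intro Bochner_Integration.integrable_bound[OF ig])
      (auto intro!: AE_I2 order_trans[OF _ abs_ge_self])
  have "expectation (\<lambda>\<omega>. Z \<omega> ^ 2) \<le> expectation ?g" using iZ ig le by (intro integral_mono)
  also have "\<dots> = (expectation (\<lambda>\<omega>. X \<omega> ^ 4) * (y\<^sup>2 / x\<^sup>2) + expectation (\<lambda>\<omega>. Y \<omega> ^ 4) * (x\<^sup>2 / y\<^sup>2)) / 2"
    using lp_leD(2)[OF A(1)] lp_leD(2)[OF B(1)] by simp
  also have "\<dots> \<le> (x ^ 4 * (y\<^sup>2 / x\<^sup>2) + y ^ 4 * (x\<^sup>2 / y\<^sup>2)) / 2"
    using lp_leD(4)[OF A(1)] lp_leD(4)[OF B(1)] by (intro divide_right_mono add_mono mult_right_mono) auto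
  also have "\<dots> = (x * y)\<^sup>2" using A(2) B(2) by (simp add: field_simps eval_nat_numeral)
  finally show ?thesis using iZ A B Z(1) by (auto simp: lp_le_def)
qed

section \<open>Laws, moments and independence of the couplings of one shift\<close>

context
  fixes \<nu> a c :: real and S :: "'s measure" and g :: "(nat \<Rightarrow> 's) \<Rightarrow> 'b::euclidean_space"
    and \<eta> \<eta>s m
  assumes shift: "decomposable_shift M \<nu> a c S g \<eta> \<eta>s m"
begin

lemma shift_facts:
  shows "c > 0" "iid_copies M S \<eta> \<eta>s" "g \<in> borel_measurable (\<Pi>\<^sub>M n\<in>UNIV. S)"
    "integrable M (\<lambda>\<omega>. norm (m t \<omega>) powr \<nu>)"
    "l \<ge> 1 \<Longrightarrow> Lnorm M \<nu> (\<lambda>\<omega>. m t \<omega> - coupled g \<eta> \<eta>s t l \<omega>) \<le> c * real l powr (- a)"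
    "\<omega> \<in> space M \<Longrightarrow> m t \<omega> = g (\<lambda>n. copies \<eta> \<eta>s (Inl (t - int n)) \<omega>)"
  using shift unfolding decomposable_shift_def copies_def by auto

lemma coupled_measurable: "coupled g \<eta> \<eta>s t l \<in> borel_measurable M"
  unfolding coupled_eq[abs_def]
  using measurable_compose[OF iid_copies_measurable_seq[OF shift_facts(2)] shift_facts(3)] .

lemma shift_measurable: "m t \<in> borel_measurable M"
proof -
  have "(\<lambda>\<omega>. g (\<lambda>n. copies \<eta> \<eta>s (Inl (t - int n)) \<omega>)) \<in> borel_measurable M"
    using measurable_compose[OF iid_copies_measurable_seq[OF shift_facts(2)] shift_facts(3)] .
  then show ?thesis using shift_facts(6) by (subst measurable_cong) auto
qed

lemma shift_law:
  assumes "inj \<sigma>"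
  shows "distr M borel (\<lambda>\<omega>. g (\<lambda>n. copies \<eta> \<eta>s (\<sigma> n) \<omega>)) = distr (\<Pi>\<^sub>M n\<in>UNIV. distr M S (\<eta> 0)) borel g"
  unfolding iid_copies_distr[OF shift_facts(2) assms, symmetric]
  by (subst distr_distr[OF shift_facts(3) iid_copies_measurable_seq[OF shift_facts(2)]]) (simp add: comp_def)

lemma distr_shift: "distr M borel (m t) = distr (\<Pi>\<^sub>M n\<in>UNIV. distr M S (\<eta> 0)) borel g"
proof -
  have "distr M borel (m t) = distr M borel (\<lambda>\<omega>. g (\<lambda>n. copies \<eta> \<eta>s (Inl (t - int n)) \<omega>))"
    using shift_facts(6) by (intro distr_cong) auto
  also have "\<dots> = distr (\<Pi>\<^sub>M n\<in>UNIV. distr M S (\<eta> 0)) borel g"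
    by (intro shift_law) (auto simp: inj_def)
  finally show ?thesis .
qed

lemma distr_coupled: "distr M borel (coupled g \<eta> \<eta>s t l) = distr M borel (m t')"
  unfolding distr_shift coupled_eq[abs_def]
  by (intro shift_law) (auto simp: inj_def coupled_index_def split: if_splits)

lemma distr_shift_eq: "distr M borel (m t) = distr M borel (m t')"
  unfolding distr_shift ..

lemma coupled_integrable: "integrable M (\<lambda>\<omega>. norm (coupled g \<eta> \<eta>s t l \<omega>) powr \<nu>)"
proof -
  have "integrable (distr M borel (m 0)) (\<lambda>x. norm x powr \<nu>)"
    using shift_facts(4) shift_measurable by (subst integrable_distr_eq) auto
  then show ?thesis unfolding distr_coupled[of t l 0, symmetric]
    using coupled_measurable by (subst (asm) integrable_distr_eq) auto
qed

lemma coupled_Lnorm: "Lnorm M \<nu> (coupled g \<eta> \<eta>s t l) = Lnorm M \<nu> (m t')"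
proof -
  have "(\<integral>\<omega>. norm (coupled g \<eta> \<eta>s t l \<omega>) powr \<nu> \<partial>M) = (\<integral>x. norm x powr \<nu> \<partial>distr M borel (coupled g \<eta> \<eta>s t l))"
    using coupled_measurable by (subst integral_distr) auto
  also have "\<dots> = (\<integral>\<omega>. norm (m t' \<omega>) powr \<nu> \<partial>M)"
    unfolding distr_coupled[of t l t'] using shift_measurable by (subst integral_distr) auto
  finally show ?thesis by (simp add: Lnorm_def)
qed

text \<open>A bound on \<open>Lnorm\<close> carries information only with this: the integral of a
  function that is not integrable is 0 by convention, and \<open>Lnorm\<close> would then be 0 as
  well.\<close>

lemma diff_integrable:
  assumes "\<nu> \<ge> 0"
  shows "integrable M (\<lambda>\<omega>. norm (m t \<omega> - coupled g \<eta> \<eta>s t l \<omega>) powr \<nu>)"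
proof -
  have [measurable]: "m t \<in> borel_measurable M" "coupled g \<eta> \<eta>s t l \<in> borel_measurable M"
    by (rule shift_measurable coupled_measurable)+
  have le: "norm (x - y) powr \<nu> \<le> 2 powr \<nu> * (norm x powr \<nu> + norm y powr \<nu>)" for x y :: 'b
  proof -
    let ?z = "max (norm x) (norm y)"
    have "norm (x - y) powr \<nu> \<le> (2 * ?z) powr \<nu>"
      using norm_triangle_ineq4[of x y] assms by (intro powr_mono2) auto
    also have "\<dots> = 2 powr \<nu> * ?z powr \<nu>" by (simp add: powr_mult)
    also have "\<dots> \<le> 2 powr \<nu> * (norm x powr \<nu> + norm y powr \<nu>)" by (auto simp: max_def)
    finally show ?thesis .
  qed
  show ?thesis
  proof (rule Bochner_Integration.integrable_bound)
    show "integrable M (\<lambda>\<omega>. 2 powr \<nu> * (norm (m t \<omega>) powr \<nu> + norm (coupled g \<eta> \<eta>s t l \<omega>) powr \<nu>))"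
      using shift_facts(4) coupled_integrable by auto
  qed (use le in \<open>auto intro!: AE_I2 order_trans[OF _ abs_ge_self]\<close>)
qed

text \<open>The window \<open>K t\<close> holds the innovations of the last L times and all copies
  tagged with t. Windows of times at least L apart are disjoint, for innovations by the gap and for
  copies by the tag, and functions of disjoint parts of an independent family are
  independent.\<close>

lemma indep_vars_coupled:
  fixes H :: "'b \<Rightarrow> 'b \<Rightarrow> real"
  assumes H: "(\<lambda>(x, y). H x y) \<in> borel_measurable (borel \<Otimes>\<^sub>M borel)" and l: "l \<le> L" "l' \<le> L"
    and gap: "\<And>s t. s \<in> A \<Longrightarrow> t \<in> A \<Longrightarrow> s \<noteq> t \<Longrightarrow> int L \<le> \<bar>s - t\<bar>"
  shows "indep_vars (\<lambda>_. borel) (\<lambda>t \<omega>. H (coupled g \<eta> \<eta>s t l \<omega>) (coupled g \<eta> \<eta>s t l' \<omega>)) A"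
proof -
  let ?Z = "copies \<eta> \<eta>s"
  define K where "K t = Inl ` {t - int L<..t} \<union> Inr ` (UNIV \<times> {t} \<times> UNIV :: (int \<times> int \<times> nat) set)" for t :: int
  have ind: "indep_vars (\<lambda>_. S) ?Z UNIV"
    using shift_facts(2) unfolding iid_copies_def copies_def by auto
  have "indep_vars (\<lambda>t. PiM (K t) (\<lambda>_. S)) (\<lambda>t \<omega>. restrict (\<lambda>i. ?Z i \<omega>) (K t)) A"
  proof (intro indep_vars_restrict[OF ind])
    show "disjoint_family_on K A"
      unfolding disjoint_family_on_def K_def using gap by fastforce
  qed auto
  moreover have idx: "coupled_index t k n \<in> K t" if "k \<le> L" for t k n
    using that by (auto simp: coupled_index_def K_def)
  define Gm where "Gm t k f = g (\<lambda>n. f (coupled_index t k n))" for t k and f :: "int + int \<times> int \<times> nat \<Rightarrow> 's"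
  have mG: "Gm t k \<in> borel_measurable (PiM (K t) (\<lambda>_. S))" if "k \<le> L" for t k
  proof -
    have "(\<lambda>f n. f (coupled_index t k n)) \<in> measurable (PiM (K t) (\<lambda>_. S)) (\<Pi>\<^sub>M n\<in>UNIV. S)"
      using idx[OF that] by (intro measurable_PiM_single') (auto simp: space_PiM PiE_def intro!: measurable_component_singleton)
    from measurable_compose[OF this shift_facts(3)] show ?thesis unfolding Gm_def by simp
  qed
  have "(\<lambda>f. (\<lambda>(x, y). H x y) (Gm t l f, Gm t l' f)) \<in> borel_measurable (PiM (K t) (\<lambda>_. S))" for t
    using mG[OF l(1)] mG[OF l(2)] by (intro measurable_compose[OF _ H] measurable_Pair)
  ultimately have "indep_vars (\<lambda>_. borel) (\<lambda>t \<omega>. (\<lambda>f. H (Gm t l f) (Gm t l' f)) (restrict (\<lambda>i. ?Z i \<omega>) (K t))) A"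
    by (intro indep_vars_compose2[where Y = "\<lambda>t f. H (Gm t l f) (Gm t l' f)" and M' = "\<lambda>t. PiM (K t) (\<lambda>_. S)"]) auto
  moreover have "Gm t k (restrict (\<lambda>i. ?Z i \<omega>) (K t)) = coupled g \<eta> \<eta>s t k \<omega>" if "k \<le> L" for t k \<omega>
    using idx[OF that] by (simp add: Gm_def coupled_eq)
  ultimately show ?thesis using l by simp
qed

lemma dyadic_approx_shift_aux:
  fixes h :: "'b \<Rightarrow> real"
  assumes "k > 0" "d > 0" and [measurable]: "h \<in> borel_measurable borel"
    and "\<And>t. lp_le M p (\<lambda>\<omega>. h (m t \<omega>)) k"
    and "\<And>t j. lp_le M p (\<lambda>\<omega>. h (m t \<omega>) - h (coupled g \<eta> \<eta>s t (2 ^ j) \<omega>)) (d * (1/2) ^ j)"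
  shows "dyadic_approx p k d (\<lambda>t \<omega>. h (m t \<omega>)) (\<lambda>t j \<omega>. h (coupled g \<eta> \<eta>s t (2 ^ j) \<omega>))"
  unfolding dyadic_approx_def
proof (intro conjI allI impI assms)
  note [measurable] = coupled_measurable
  show "(\<lambda>\<omega>. h (coupled g \<eta> \<eta>s t (2 ^ j) \<omega>)) \<in> borel_measurable M" for t j by measurable
  \<comment> \<open>At lag 2^0 = 1 only the innovation at time t itself is original, so any distinct
    times are far enough apart.\<close>
  show "indep_vars (\<lambda>_. borel) (\<lambda>t \<omega>. h (coupled g \<eta> \<eta>s t (2 ^ 0) \<omega>)) A" for A
    by (rule indep_vars_coupled[where L = 1 and l' = 1 and H = "\<lambda>x y. h x"]) auto
  show "indep_vars (\<lambda>_. borel) (\<lambda>t \<omega>. h (coupled g \<eta> \<eta>s t (2 ^ Suc j) \<omega>) - h (coupled g \<eta> \<eta>s t (2 ^ j) \<omega>)) A"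
    if "\<forall>s\<in>A. \<forall>t\<in>A. s \<noteq> t \<longrightarrow> 2 ^ Suc j \<le> \<bar>s - t\<bar>" for j A
    by (rule indep_vars_coupled[where L = "2 ^ Suc j" and H = "\<lambda>x y. h x - h y"]) (use that in auto)
qed

context
  fixes k :: real
  assumes nu: "\<nu> \<ge> 4" and a: "a \<ge> 1" and k: "k > 0" "\<And>t. Lnorm M \<nu> (m t) \<le> k"
begin

text \<open>Along the lags 2^j polynomial decay is geometric, and an exponent of at least 1 makes
  the ratio at most 1/2.\<close>

lemma shift_lag_bound: "Lnorm M \<nu> (\<lambda>\<omega>. m t \<omega> - coupled g \<eta> \<eta>s t (2 ^ j) \<omega>) \<le> c * (1/2) ^ j"
proof -
  have "Lnorm M \<nu> (\<lambda>\<omega>. m t \<omega> - coupled g \<eta> \<eta>s t (2 ^ j) \<omega>) \<le> c * real (2 ^ j) powr (- a)"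
    by (rule shift_facts(5)) auto
  also have "real (2 ^ j) powr (- a) \<le> real (2 ^ j) powr (- 1)"
    using a by (intro powr_mono) auto
  also have "real (2 ^ j) powr (- 1) = (1/2) ^ j" by (simp add: powr_minus power_one_over inverse_eq_divide)
  finally show ?thesis using shift_facts(1) by simp
qed

text \<open>A Lipschitz function inherits the distance to the coupling, so absolute values of errors
  and coordinates of factors obey the same bounds as the shifts themselves.\<close>

lemma dyadic_approx_lipschitz:
  fixes h :: "'b \<Rightarrow> real"
  assumes p: "even p" "real p \<le> \<nu>" "p \<ge> 1" and h[measurable]: "h \<in> borel_measurable borel"
    and lip: "\<And>x y. \<bar>h x - h y\<bar> \<le> norm (x - y)" "\<And>x. \<bar>h x\<bar> \<le> norm x"
  shows "dyadic_approx p (2 * k) (2 * c) (\<lambda>t \<omega>. h (m t \<omega>)) (\<lambda>t j \<omega>. h (coupled g \<eta> \<eta>s t (2 ^ j) \<omega>))"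
proof (rule dyadic_approx_shift_aux)
  note [measurable] = coupled_measurable shift_measurable
  show "lp_le M p (\<lambda>\<omega>. h (m t \<omega>)) (2 * k)" for t
    by (rule lp_le_of_powr_moment[where D = "m t", OF p _ _ _ shift_facts(4) k(2) k(1)]) (auto simp: lip)
  have "lp_le M p (\<lambda>\<omega>. h (m t \<omega>) - h (coupled g \<eta> \<eta>s t (2 ^ j) \<omega>)) (2 * (c * (1/2) ^ j))" for t j
    using nu shift_facts(1)
    by (intro lp_le_of_powr_moment[OF p _ _ _ diff_integrable[of t "2 ^ j"] shift_lag_bound[of t j]]) (auto simp: lip)
  then show "lp_le M p (\<lambda>\<omega>. h (m t \<omega>) - h (coupled g \<eta> \<eta>s t (2 ^ j) \<omega>)) (2 * c * (1/2) ^ j)" for t j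
    by (simp add: mult.assoc)
qed (use k shift_facts(1) in auto)

text \<open>Fourth moments of the shift lead to order 2 for a product. The distance of a product to
  its coupling is at most (|x| + |y|) |x - y|, and 8 k c is 4 k times 2 c.\<close>

lemma dyadic_approx_product:
  fixes h1 h2 :: "'b \<Rightarrow> real"
  assumes h[measurable]: "h1 \<in> borel_measurable borel" "h2 \<in> borel_measurable borel"
    and lip: "\<And>x y. \<bar>h1 x - h1 y\<bar> \<le> norm (x - y)" "\<And>x. \<bar>h1 x\<bar> \<le> norm x"
      "\<And>x y. \<bar>h2 x - h2 y\<bar> \<le> norm (x - y)" "\<And>x. \<bar>h2 x\<bar> \<le> norm x"
  shows "dyadic_approx 2 (4 * k\<^sup>2) (8 * k * c) (\<lambda>t \<omega>. h1 (m t \<omega>) * h2 (m t \<omega>))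
     (\<lambda>t j \<omega>. h1 (coupled g \<eta> \<eta>s t (2 ^ j) \<omega>) * h2 (coupled g \<eta> \<eta>s t (2 ^ j) \<omega>))"
proof (rule dyadic_approx_shift_aux[where h = "\<lambda>x. h1 x * h2 x"])
  note [measurable] = coupled_measurable shift_measurable
  have p: "even (4::nat)" "real 4 \<le> \<nu>" "(4::nat) \<ge> 1" using nu by auto
  have A: "lp_le M 4 (\<lambda>\<omega>. norm (m t \<omega>)) (2 * k)" for t
    by (rule lp_le_of_powr_moment[where D = "m t", OF p _ _ _ shift_facts(4) k(2) k(1)]) auto
  have B: "lp_le M 4 (\<lambda>\<omega>. norm (coupled g \<eta> \<eta>s t (2 ^ j) \<omega>)) (2 * k)" for t j
    using coupled_Lnorm[of t "2 ^ j" t] k(2)[of t]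
    by (intro lp_le_of_powr_moment[OF p _ _ _ coupled_integrable _ k(1)]) auto
  have AB: "lp_le M 4 (\<lambda>\<omega>. norm (m t \<omega>) + norm (coupled g \<eta> \<eta>s t (2 ^ j) \<omega>)) (2 * k + 2 * k)" for t j
    by (intro lp_le_add A B) auto
  have D: "lp_le M 4 (\<lambda>\<omega>. norm (m t \<omega> - coupled g \<eta> \<eta>s t (2 ^ j) \<omega>)) (2 * (c * (1/2) ^ j))" for t j
    using nu shift_facts(1)
    by (intro lp_le_of_powr_moment[OF p _ _ _ diff_integrable[of t "2 ^ j"] shift_lag_bound[of t j]]) auto
  have "lp_le M 2 (\<lambda>\<omega>. h1 (m t \<omega>) * h2 (m t \<omega>)) ((2 * k) * (2 * k))" for t
    using k lip by (intro lp_le_mult[OF A _ A]) (auto simp: abs_mult intro!: mult_mono)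
  then show "lp_le M 2 (\<lambda>\<omega>. h1 (m t \<omega>) * h2 (m t \<omega>)) (4 * k\<^sup>2)" for t by (simp add: power2_eq_square)
  have le: "\<bar>h1 x * h2 x - h1 y * h2 y\<bar> \<le> \<bar>(norm x + norm y) * norm (x - y)\<bar>" for x y :: 'b
  proof -
    have "h1 x * h2 x - h1 y * h2 y = h1 x * (h2 x - h2 y) + (h1 x - h1 y) * h2 y" by (simp add: algebra_simps)
    also have "\<bar>\<dots>\<bar> \<le> \<bar>h1 x\<bar> * \<bar>h2 x - h2 y\<bar> + \<bar>h1 x - h1 y\<bar> * \<bar>h2 y\<bar>"
      by (metis abs_mult abs_triangle_ineq)
    also have "\<dots> \<le> norm x * norm (x - y) + norm (x - y) * norm y"
      using lip by (intro add_mono mult_mono) auto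
    finally show ?thesis by (simp add: algebra_simps)
  qed
  have "lp_le M 2 (\<lambda>\<omega>. h1 (m t \<omega>) * h2 (m t \<omega>) - h1 (coupled g \<eta> \<eta>s t (2 ^ j) \<omega>) * h2 (coupled g \<eta> \<eta>s t (2 ^ j) \<omega>))
      ((2 * k + 2 * k) * (2 * (c * (1/2) ^ j)))" for t j
    using k shift_facts(1) by (intro lp_le_mult[OF AB[of t j] _ D[of t j]] le) auto
  then show "lp_le M 2 (\<lambda>\<omega>. h1 (m t \<omega>) * h2 (m t \<omega>) - h1 (coupled g \<eta> \<eta>s t (2 ^ j) \<omega>) * h2 (coupled g \<eta> \<eta>s t (2 ^ j) \<omega>))
     (8 * k * c * (1/2) ^ j)" for t j by (simp add: algebra_simps)
qed (use k shift_facts(1) in auto)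

end

end

text \<open>Fubini: with the factor path frozen, the values \<phi> (f t) are deterministic weights
  and \<open>U\<close> applies; the mean of the q-th power of their sum of squares is then bounded
  by Jensen. Independence thus keeps the order p, where products of dependent variables would call
  for moments of order 2p.\<close>

lemma lp_le_independent_weights:
  fixes u :: "int \<Rightarrow> 'a \<Rightarrow> real" and f :: "int \<Rightarrow> 'a \<Rightarrow> 'b::euclidean_space" and T :: nat
  assumes ind: "indep_rv M (\<Pi>\<^sub>M t\<in>{1..int T}. borel) (\<lambda>\<omega>. \<lambda>t\<in>{1..int T}. u t \<omega>)
            (\<Pi>\<^sub>M t\<in>{1..int T}. borel) (\<lambda>\<omega>. \<lambda>t\<in>{1..int T}. f t \<omega>)"
    and I: "I \<subseteq> {1..int T}" and q: "q \<ge> 1" and K: "K \<ge> 0" and k: "k \<ge> 0"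
    and u[measurable]: "\<And>t. u t \<in> borel_measurable M" and f[measurable]: "\<And>t. f t \<in> borel_measurable M"
    and U: "\<And>c. lp_le M (2 * q) (\<lambda>\<omega>. \<Sum>t\<in>I. c t * u t \<omega>) (K * sqrt (\<Sum>t\<in>I. (c t)\<^sup>2))"
    and \<phi>[measurable]: "\<phi> \<in> borel_measurable borel"
    and F: "\<And>t. lp_le M (2 * q) (\<lambda>\<omega>. \<phi> (f t \<omega>)) k"
  shows "lp_le M (2 * q) (\<lambda>\<omega>. \<Sum>t\<in>I. \<phi> (f t \<omega>) * u t \<omega>) (K * k * sqrt (card I))"
proof -
  define p where "p = 2 * q"
  have p: "even p" "p > 0" using q by (auto simp: p_def)
  let ?A = "\<Pi>\<^sub>M t\<in>{1..int T}. (borel :: real measure)" and ?B = "\<Pi>\<^sub>M t\<in>{1..int T}. (borel :: 'b measure)"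
  let ?U = "\<lambda>\<omega>. \<lambda>t\<in>{1..int T}. u t \<omega>" and ?F = "\<lambda>\<omega>. \<lambda>t\<in>{1..int T}. f t \<omega>"
  note iv = indep_rv_distr[OF ind]
  have m[measurable]: "?U \<in> measurable M ?A" "?F \<in> measurable M ?B"
    and prod: "distr M ?A ?U \<Otimes>\<^sub>M distr M ?B ?F = distr M (?A \<Otimes>\<^sub>M ?B) (\<lambda>x. (?U x, ?F x))"
    using iv by (auto simp: space_PiM)
  interpret DU: prob_space "distr M ?A ?U" by (rule prob_space_distr) fact
  interpret DF: prob_space "distr M ?B ?F" by (rule prob_space_distr) fact
  interpret P: pair_sigma_finite "distr M ?A ?U" "distr M ?B ?F" ..
  have finI: "finite I" using I finite_subset by blast
  define h where "h x = ennreal ((\<Sum>t\<in>I. \<phi> (snd x t) * fst x t) ^ p)" for x :: "(int \<Rightarrow> real) \<times> (int \<Rightarrow> 'b)"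
  have comp: "(\<lambda>x. fst x t) \<in> borel_measurable (?A \<Otimes>\<^sub>M ?B)" "(\<lambda>x. snd x t) \<in> borel_measurable (?A \<Otimes>\<^sub>M ?B)" if "t \<in> I" for t
    using that I by (auto intro!: measurable_compose[OF measurable_fst] measurable_compose[OF measurable_snd] measurable_component_singleton)
  have hm: "h \<in> borel_measurable (?A \<Otimes>\<^sub>M ?B)"
    unfolding h_def using comp by (intro measurable_compose[OF _ measurable_ennreal] borel_measurable_power borel_measurable_sum borel_measurable_times measurable_compose[OF _ \<phi>]) auto
  have "(\<integral>\<^sup>+\<omega>. ennreal ((\<Sum>t\<in>I. \<phi> (f t \<omega>) * u t \<omega>) ^ p) \<partial>M) = (\<integral>\<^sup>+\<omega>. h (?U \<omega>, ?F \<omega>) \<partial>M)"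
    unfolding h_def using I by (intro nn_integral_cong arg_cong[where f=ennreal] arg_cong[where f = "\<lambda>x. x ^ p"] sum.cong) auto
  also have "\<dots> = (\<integral>\<^sup>+x. h x \<partial>distr M (?A \<Otimes>\<^sub>M ?B) (\<lambda>x. (?U x, ?F x)))"
    using hm by (subst nn_integral_distr) auto
  also have "\<dots> = (\<integral>\<^sup>+x. h x \<partial>(distr M ?A ?U \<Otimes>\<^sub>M distr M ?B ?F))" unfolding prod ..
  also have "\<dots> = (\<integral>\<^sup>+y. \<integral>\<^sup>+x. h (x, y) \<partial>distr M ?A ?U \<partial>distr M ?B ?F)"
    using hm by (subst P.nn_integral_snd[symmetric]) (auto cong: measurable_cong_sets)
  also have "\<dots> = (\<integral>\<^sup>+\<omega>'. \<integral>\<^sup>+\<omega>. h (?U \<omega>, ?F \<omega>') \<partial>M \<partial>M)"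
  proof -
    have hm': "(\<lambda>(x, y). h (x, y)) \<in> borel_measurable (?A \<Otimes>\<^sub>M ?B)" using hm by simp
    have "(\<integral>\<^sup>+x. h (x, y) \<partial>distr M ?A ?U) = (\<integral>\<^sup>+\<omega>. h (?U \<omega>, y) \<partial>M)" if "y \<in> space ?B" for y
      using hm that by (subst nn_integral_distr) auto
    moreover have "(\<lambda>y. \<integral>\<^sup>+x. h (x, y) \<partial>distr M ?A ?U) \<in> borel_measurable ?B"
      using hm' by (intro DU.borel_measurable_nn_integral) (auto simp: measurable_split_conv intro!: measurable_compose[OF measurable_pair_swap' hm, simplified] cong: measurable_cong_sets)
    ultimately show ?thesis
      using measurable_space[OF m(2)] by (subst nn_integral_distr[OF m(2)]) (auto intro!: nn_integral_cong)
  qed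
  also have "\<dots> \<le> (\<integral>\<^sup>+\<omega>'. ennreal (K ^ p * ((\<Sum>t\<in>I. (\<phi> (f t \<omega>'))\<^sup>2)) ^ q) \<partial>M)"
  proof (intro nn_integral_mono)
    fix \<omega>' assume "\<omega>' \<in> space M"
    let ?c = "\<lambda>t. \<phi> (f t \<omega>')"
    have "(\<integral>\<^sup>+\<omega>. h (?U \<omega>, ?F \<omega>') \<partial>M) = (\<integral>\<^sup>+\<omega>. ennreal ((\<Sum>t\<in>I. ?c t * u t \<omega>) ^ p) \<partial>M)"
      unfolding h_def using I by (intro nn_integral_cong arg_cong[where f=ennreal] arg_cong[where f = "\<lambda>x. x ^ p"] sum.cong) auto
    also have "\<dots> = ennreal (expectation (\<lambda>\<omega>. (\<Sum>t\<in>I. ?c t * u t \<omega>) ^ p))"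
      using lp_leD(2)[OF U[of ?c]] p by (intro nn_integral_eq_integral) (auto simp: p_def[symmetric] zero_le_even_power)
    also have "\<dots> \<le> ennreal ((K * sqrt (\<Sum>t\<in>I. (?c t)\<^sup>2)) ^ p)"
      using lp_leD(4)[OF U[of ?c]] by (intro ennreal_leI) (simp add: p_def)
    also have "(K * sqrt (\<Sum>t\<in>I. (?c t)\<^sup>2)) ^ p = K ^ p * ((\<Sum>t\<in>I. (?c t)\<^sup>2)) ^ q"
      by (simp add: p_def power_mult_distrib power_mult sum_nonneg)
    finally show "(\<integral>\<^sup>+\<omega>. h (?U \<omega>, ?F \<omega>') \<partial>M) \<le> ennreal (K ^ p * ((\<Sum>t\<in>I. (?c t)\<^sup>2)) ^ q)" .
  qed
  also have "\<dots> \<le> (\<integral>\<^sup>+\<omega>'. ennreal (K ^ p * (real (card I) ^ (q - 1) * (\<Sum>t\<in>I. (\<phi> (f t \<omega>')) ^ p))) \<partial>M)"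
  proof (intro nn_integral_mono ennreal_leI mult_left_mono)
    fix \<omega>'
    show "(\<Sum>t\<in>I. (\<phi> (f t \<omega>'))\<^sup>2) ^ q \<le> real (card I) ^ (q - 1) * (\<Sum>t\<in>I. (\<phi> (f t \<omega>')) ^ p)"
      using sum_power_le_card_power[OF finI q, of "\<lambda>t. (\<phi> (f t \<omega>'))\<^sup>2"] by (simp add: p_def power_mult)
  qed (use K in auto)
  also have "\<dots> = ennreal (K ^ p * (real (card I) ^ (q - 1) * (\<Sum>t\<in>I. expectation (\<lambda>\<omega>. (\<phi> (f t \<omega>)) ^ p))))"
    using lp_leD(2)[OF F] p K
    by (subst nn_integral_eq_integral) (auto simp: p_def[symmetric] zero_le_even_power intro!: mult_nonneg_nonneg sum_nonneg)
  also have "\<dots> \<le> ennreal (K ^ p * (real (card I) ^ (q - 1) * (\<Sum>t\<in>I. k ^ p)))"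
    using lp_leD(4)[OF F] K by (intro ennreal_leI mult_left_mono sum_mono) (auto simp: p_def)
  also have "K ^ p * (real (card I) ^ (q - 1) * (\<Sum>t\<in>I. k ^ p)) = (K * k * sqrt (card I)) ^ p"
  proof -
    have "real (card I) ^ (q - 1) * real (card I) = real (card I) ^ q" using q by (cases q) auto
    then show ?thesis by (simp add: p_def power_mult_distrib power_mult)
  qed
  finally have fin: "(\<integral>\<^sup>+\<omega>. ennreal ((\<Sum>t\<in>I. \<phi> (f t \<omega>) * u t \<omega>) ^ p) \<partial>M) \<le> ennreal ((K * k * sqrt (card I)) ^ p)" .
  have int: "integrable M (\<lambda>\<omega>. (\<Sum>t\<in>I. \<phi> (f t \<omega>) * u t \<omega>) ^ p)"
    using p fin by (intro integrableI_bounded) (auto simp: zero_le_even_power order_le_less_trans)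
  then have "ennreal (expectation (\<lambda>\<omega>. (\<Sum>t\<in>I. \<phi> (f t \<omega>) * u t \<omega>) ^ p)) \<le> ennreal ((K * k * sqrt (card I)) ^ p)"
    using fin p by (subst (asm) nn_integral_eq_integral) (auto simp: zero_le_even_power)
  then show ?thesis using int K k unfolding lp_le_def p_def[symmetric]
    by (subst (asm) ennreal_le_iff) (auto intro!: zero_le_even_power p)
qed

end

section \<open>The Gumbel limit of normal maxima\<close>

text \<open>L stands for log N and c for log(4 pi), so that \<open>z\<close> is b_N + a_N x.
  Expanding the square gives b^2/2 = L - (ln L + c)/2 + (ln L + c)^2/(16 L), and the cross term of
  z^2/2 tends to x because b^2/(1 + b^2) tends to 1.\<close>

lemma gumbel_exponent_limit:
  fixes x c :: real
  defines "b \<equiv> \<lambda>L::real. sqrt (2 * L) - (ln L + c) / (2 * sqrt (2 * L))"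
  defines "z \<equiv> \<lambda>L. b L + b L / (1 + (b L)\<^sup>2) * x"
  shows "((\<lambda>L. L - (z L)\<^sup>2 / 2 - ln L / 2) \<longlongrightarrow> c / 2 - x) at_top"
proof -
  have b: "filterlim b at_top at_top" unfolding b_def by real_asymp
  have 1: "((\<lambda>L. L - (b L)\<^sup>2 / 2 - ln L / 2) \<longlongrightarrow> c / 2) at_top"
  proof (rule Lim_transform_eventually)
    have "((\<lambda>L. (ln L + c)\<^sup>2 / (16 * L)) \<longlongrightarrow> 0) at_top" by real_asymp
    from tendsto_diff[OF tendsto_const this, of "c / 2"]
    show "((\<lambda>L. c / 2 - (ln L + c)\<^sup>2 / (16 * L)) \<longlongrightarrow> c / 2) at_top" by simp
    show "\<forall>\<^sub>F L in at_top. c / 2 - (ln L + c)\<^sup>2 / (16 * L) = L - (b L)\<^sup>2 / 2 - ln L / 2"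
      using eventually_gt_at_top[of 0]
    proof eventually_elim
      case (elim L)
      have "(b L)\<^sup>2 = 2 * L - (ln L + c) + (ln L + c)\<^sup>2 / (8 * L)"
        using elim by (simp add: b_def power2_diff power_divide power_mult_distrib)
      then show ?case using elim by (simp add: field_simps)
    qed
  qed
  have 2: "((\<lambda>b::real. (b / (1 + b\<^sup>2))) \<longlongrightarrow> 0) at_top" by real_asymp
  have 3: "((\<lambda>b::real. b * (b / (1 + b\<^sup>2))) \<longlongrightarrow> 1) at_top" by real_asymp
  have "((\<lambda>L. (L - (b L)\<^sup>2 / 2 - ln L / 2) - (b L * (b L / (1 + (b L)\<^sup>2))) * x - (b L / (1 + (b L)\<^sup>2))\<^sup>2 * x\<^sup>2 / 2)
      \<longlongrightarrow> c / 2 - 1 * x - 0\<^sup>2 * x\<^sup>2 / 2) at_top"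
    by (intro tendsto_intros 1 filterlim_compose[OF 2 b] filterlim_compose[OF 3 b]) auto
  moreover have "(L - (b L)\<^sup>2 / 2 - ln L / 2) - (b L * (b L / (1 + (b L)\<^sup>2))) * x - (b L / (1 + (b L)\<^sup>2))\<^sup>2 * x\<^sup>2 / 2
      = L - (z L)\<^sup>2 / 2 - ln L / 2" for L
  proof -
    have "(u + v * x)\<^sup>2 = u\<^sup>2 + 2 * (u * v) * x + v\<^sup>2 * x\<^sup>2" for u v :: real
      by (simp add: power2_sum power_mult_distrib)
    from this[of "b L" "b L / (1 + (b L)\<^sup>2)"] show ?thesis unfolding z_def by linarith
  qed
  ultimately show ?thesis by (simp only:) simp
qed

section \<open>Tail of the standard normal law\<close>

definition std_normal_cdf :: "real \<Rightarrow> real" where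
  "std_normal_cdf z = measure (density lborel std_normal_density) {..z}"

lemma std_normal_density_pos: "0 < std_normal_density z"
  using normal_density_pos[of 1 0 z] by simp

lemma std_normal_density_deriv:
  "(std_normal_density has_real_derivative - x * std_normal_density x) (at x)"
  unfolding std_normal_density_def[abs_def]
  by (auto intro!: derivative_eq_intros simp: field_simps)

lemma std_normal_density_tendsto_0: "(std_normal_density \<longlongrightarrow> 0) at_top"
  unfolding std_normal_density_def[abs_def] by real_asymp

lemma std_normal_tail:
  "1 - std_normal_cdf z = enn2real (\<integral>\<^sup>+x. ennreal (std_normal_density x) * indicator {z..} x \<partial>lborel)"
  "(\<integral>\<^sup>+x. ennreal (std_normal_density x) * indicator {z..} x \<partial>lborel) < \<top>"
proof -
  interpret prob_space "density lborel std_normal_density" by (rule prob_space_normal_density) simp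
  let ?D = "density lborel std_normal_density"
  have e: "emeasure ?D {z..} = (\<integral>\<^sup>+x. ennreal (std_normal_density x) * indicator {z..} x \<partial>lborel)"
    by (subst emeasure_density) auto
  show "(\<integral>\<^sup>+x. ennreal (std_normal_density x) * indicator {z..} x \<partial>lborel) < \<top>"
    unfolding e[symmetric] by (simp add: emeasure_eq_measure)
  have "emeasure ?D {z} = 0"
    by (subst emeasure_density) (auto simp: nn_integral_indicator_singleton)
  then have z: "prob {z} = 0" by (simp add: emeasure_eq_measure)
  have "prob ({..z} \<union> {z<..}) = prob {..z} + prob {z<..}"
    by (intro finite_measure_Union) auto
  moreover have "{..z} \<union> {z<..} = space ?D" by auto
  moreover have "prob {z..} = prob {z} + prob {z<..}"
    by (subst finite_measure_Union[symmetric]) (auto intro: arg_cong[where f=prob])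
  ultimately have "1 - std_normal_cdf z = prob {z..}" using z prob_space by (simp add: std_normal_cdf_def)
  then show "1 - std_normal_cdf z = enn2real (\<integral>\<^sup>+x. ennreal (std_normal_density x) * indicator {z..} x \<partial>lborel)"
    by (simp add: measure_def e)
qed

text \<open>The density times 1 + 1/x^2 dominates the density and has the explicit antiderivative
  -density/x.\<close>

lemma mills_upper:
  assumes "z > 0" shows "1 - std_normal_cdf z \<le> std_normal_density z / z"
proof -
  have "(\<integral>\<^sup>+x. ennreal (std_normal_density x) * indicator {z..} x \<partial>lborel)
      \<le> (\<integral>\<^sup>+x. ennreal (std_normal_density x * (1 + 1 / x\<^sup>2)) * indicator {z..} x \<partial>lborel)"
  proof (intro nn_integral_mono mult_right_mono ennreal_leI)
    show "std_normal_density x \<le> std_normal_density x * (1 + 1 / x\<^sup>2)" for x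
      using mult_left_mono[of 1 "1 + 1 / x\<^sup>2" "std_normal_density x"] std_normal_density_pos[of x] by simp
  qed auto
  also have "\<dots> = ennreal (0 - (- (std_normal_density z / z)))"
  proof (rule nn_integral_FTC_atLeast)
    show "((\<lambda>x. - (std_normal_density x / x)) has_real_derivative std_normal_density x * (1 + 1 / x\<^sup>2)) (at x)" if "z \<le> x" for x
      using that assms by (auto intro!: derivative_eq_intros std_normal_density_deriv simp: field_simps power2_eq_square)
    have "((\<lambda>x. - (std_normal_density x / x)) \<longlongrightarrow> - (0 * 0)) at_top"
      unfolding divide_inverse by (intro tendsto_intros std_normal_density_tendsto_0 tendsto_inverse_0_at_top filterlim_ident)
    then show "((\<lambda>x. - (std_normal_density x / x)) \<longlongrightarrow> 0) at_top" by simp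
  qed auto
  finally show ?thesis unfolding std_normal_tail(1) using assms by (simp add: enn2real_leI)
qed

text \<open>The antiderivative -density * (1/x - 1/x^3) has derivative density * (1 - 3/x^4), which
  lies below the density. From x >= 2 on it is nonnegative, as the fundamental theorem for
  nonnegative integrands requires.\<close>

lemma mills_lower:
  assumes "z \<ge> 2" shows "std_normal_density z / z * (1 - 1 / z\<^sup>2) \<le> 1 - std_normal_cdf z"
proof -
  let ?F = "\<lambda>x. - (std_normal_density x * (1 / x - 1 / x ^ 3))"
  have pos: "0 \<le> 1 - 3 / x ^ 4" if "z \<le> x" for x :: real
  proof -
    have "2 ^ 4 \<le> x ^ 4" using that assms by (intro power_mono) auto
    then have "3 \<le> x ^ 4" by simp
    then show ?thesis by (auto simp: divide_le_eq_1)
  qed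
  have "ennreal (0 - ?F z) = (\<integral>\<^sup>+x. ennreal (std_normal_density x * (1 - 3 / x ^ 4)) * indicator {z..} x \<partial>lborel)"
  proof (rule nn_integral_FTC_atLeast[symmetric])
    show "(?F has_real_derivative std_normal_density x * (1 - 3 / x ^ 4)) (at x)" if "z \<le> x" for x
      using that assms by (auto intro!: derivative_eq_intros std_normal_density_deriv simp: field_simps eval_nat_numeral)
    have "((\<lambda>x::real. 1 / x - 1 / x ^ 3) \<longlongrightarrow> 0) at_top" by real_asymp
    then have "(?F \<longlongrightarrow> - (0 * 0)) at_top"
      by (intro tendsto_intros std_normal_density_tendsto_0)
    then show "(?F \<longlongrightarrow> 0) at_top" by simp
  qed (use pos in auto)
  also have "\<dots> \<le> (\<integral>\<^sup>+x. ennreal (std_normal_density x) * indicator {z..} x \<partial>lborel)"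
  proof (intro nn_integral_mono mult_right_mono ennreal_leI)
    fix x :: real
    have "1 - 3 / x ^ 4 \<le> 1" by simp
    from mult_left_mono[OF this less_imp_le[OF std_normal_density_pos[of x]]]
    show "std_normal_density x * (1 - 3 / x ^ 4) \<le> std_normal_density x" by (simp only: mult_1_right)
  qed auto
  finally have le: "ennreal (0 - ?F z) \<le> (\<integral>\<^sup>+x. ennreal (std_normal_density x) * indicator {z..} x \<partial>lborel)" (is "_ \<le> ?I") .
  have le_enn2real: "a \<le> enn2real I" if "ennreal a \<le> I" "I < \<top>" for a I
  proof (cases "0 \<le> a")
    case True
    then show ?thesis using enn2real_mono[OF that] by simp
  next
    case False
    then show ?thesis using enn2real_nonneg[of I] by linarith
  qed
  have "0 - ?F z \<le> 1 - std_normal_cdf z"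
    unfolding std_normal_tail(1) by (rule le_enn2real[OF le std_normal_tail(2)])
  moreover have "0 - ?F z = std_normal_density z / z * (1 - 1 / z\<^sup>2)"
    using assms by (simp add: power2_eq_square power3_eq_cube right_diff_distrib)
  ultimately show ?thesis by simp
qed

lemma mills_ratio: "((\<lambda>z. (1 - std_normal_cdf z) / (std_normal_density z / z)) \<longlongrightarrow> 1) at_top"
proof (rule tendsto_sandwich)
  show "\<forall>\<^sub>F z in at_top. 1 - 1 / z\<^sup>2 \<le> (1 - std_normal_cdf z) / (std_normal_density z / z)"
    using eventually_ge_at_top[of 2]
  proof eventually_elim
    case (elim z)
    have "std_normal_density z / z > 0" using elim normal_density_pos[of 1 0 z] by simp
    then show ?case using mills_lower[OF elim] by (subst pos_le_divide_eq) (simp_all add: mult.commute)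
  qed
  show "\<forall>\<^sub>F z in at_top. (1 - std_normal_cdf z) / (std_normal_density z / z) \<le> 1"
    using eventually_ge_at_top[of 2]
  proof eventually_elim
    case (elim z)
    have "std_normal_density z / z > 0" using elim normal_density_pos[of 1 0 z] by simp
    then show ?case using mills_upper[of z] elim by (subst pos_divide_le_eq) simp_all
  qed
  show "((\<lambda>z::real. 1 - 1 / z\<^sup>2) \<longlongrightarrow> 1) at_top" by real_asymp
qed simp

lemma std_normal_cdf_mono: "z \<le> z' \<Longrightarrow> std_normal_cdf z \<le> std_normal_cdf z'"
proof -
  interpret prob_space "density lborel std_normal_density" by (rule prob_space_normal_density) simp
  show "z \<le> z' \<Longrightarrow> std_normal_cdf z \<le> std_normal_cdf z'"
    unfolding std_normal_cdf_def by (intro finite_measure_mono) auto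
qed

lemma std_normal_cdf_bounds: "0 \<le> std_normal_cdf z" "std_normal_cdf z \<le> 1"
proof -
  interpret prob_space "density lborel std_normal_density" by (rule prob_space_normal_density) simp
  show "0 \<le> std_normal_cdf z" "std_normal_cdf z \<le> 1" unfolding std_normal_cdf_def by auto
qed

lemma std_normal_cdf_at_bot: "(std_normal_cdf \<longlongrightarrow> 0) at_bot"
proof -
  interpret real_distribution "density lborel std_normal_density"
    using prob_space_normal_density[of 1 0] by (auto simp: real_distribution_def real_distribution_axioms_def)
  have "std_normal_cdf = cdf (density lborel std_normal_density)"
    by (auto simp: std_normal_cdf_def cdf_def)
  then show ?thesis using cdf_lim_at_bot by simp
qed

text \<open>Sandwich for the logarithm: -c - 2 c^2 <= ln (1 - c) <= -c once c < 1/2, and n c^2 tends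
  to 0 because n c converges.\<close>

lemma one_minus_power_tendsto_exp:
  fixes c :: "nat \<Rightarrow> real"
  assumes c: "(\<lambda>n. real n * c n) \<longlonglongrightarrow> l" and c0: "\<And>n. 0 \<le> c n"
  shows "(\<lambda>n. (1 - c n) ^ n) \<longlonglongrightarrow> exp (- l)"
proof -
  have "(\<lambda>n. real n * c n * (1 / real n)) \<longlonglongrightarrow> l * 0"
    by (intro tendsto_mult c lim_1_over_n)
  moreover have "\<forall>\<^sub>F n in sequentially. real n * c n * (1 / real n) = c n"
    using eventually_gt_at_top[of 0] by eventually_elim auto
  ultimately have c_0: "c \<longlonglongrightarrow> 0" by (auto dest: Lim_transform_eventually)
  have sm: "\<forall>\<^sub>F n in sequentially. c n < 1/2" using order_tendstoD(2)[OF c_0, of "1/2"] by simp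
  have lim: "(\<lambda>n. real n * ln (1 - c n)) \<longlonglongrightarrow> - l"
  proof (rule tendsto_sandwich)
    show "\<forall>\<^sub>F n in sequentially. - (real n * c n) - 2 * (real n * c n) * c n \<le> real n * ln (1 - c n)"
      using sm
    proof eventually_elim
      case (elim n)
      have "- c n - 2 * (c n)\<^sup>2 \<le> ln (1 - c n)" using ln_one_minus_pos_lower_bound[of "c n"] c0 elim by simp
      then have "real n * (- c n - 2 * (c n)\<^sup>2) \<le> real n * ln (1 - c n)" by (intro mult_left_mono) auto
      then show ?case by (simp add: algebra_simps power2_eq_square)
    qed
    show "\<forall>\<^sub>F n in sequentially. real n * ln (1 - c n) \<le> - (real n * c n)"
      using sm
    proof eventually_elim
      case (elim n)
      have "ln (1 - c n) \<le> - c n" using ln_add_one_self_le_self2[of "- c n"] elim by simp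
      then have "real n * ln (1 - c n) \<le> real n * - c n" by (intro mult_left_mono) auto
      then show ?case by simp
    qed
    have "(\<lambda>n. - (real n * c n) - 2 * (real n * c n) * c n) \<longlonglongrightarrow> - l - 2 * l * 0"
      by (intro tendsto_intros c c_0)
    then show "(\<lambda>n. - (real n * c n) - 2 * (real n * c n) * c n) \<longlonglongrightarrow> - l" by simp
    show "(\<lambda>n. - (real n * c n)) \<longlonglongrightarrow> - l" by (intro tendsto_intros c)
  qed
  have "(\<lambda>n. exp (real n * ln (1 - c n))) \<longlonglongrightarrow> exp (- l)" by (intro tendsto_exp lim)
  moreover have "\<forall>\<^sub>F n in sequentially. exp (real n * ln (1 - c n)) = (1 - c n) ^ n"
    using sm by eventually_elim (auto simp: exp_of_nat_mult)
  ultimately show ?thesis by (auto dest: Lim_transform_eventually)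
qed

lemma b_norm_at_top: "filterlim b_norm at_top sequentially"
  unfolding b_norm_def[abs_def] by real_asymp

lemma z_norm_at_top: "filterlim (\<lambda>N. b_norm N + a_norm N * x) at_top sequentially"
proof -
  have "filterlim (\<lambda>b::real. b + b / (1 + b\<^sup>2) * x) at_top at_top" by real_asymp
  from filterlim_compose[OF this b_norm_at_top] show ?thesis by (simp add: a_norm_def)
qed

text \<open>It is enough that N times the upper tail at z tends to exp (-x). By the Mills ratio the
  tail may be replaced by density(z)/z; the exponent is that of
  \<open>gumbel_exponent_limit\<close>, whose term ln (ln N)/2 accounts for the division by z,
  asymptotically sqrt (2 ln N).\<close>

lemma gumbel_limit:
  "(\<lambda>N. std_normal_cdf (b_norm N + a_norm N * x) ^ N) \<longlonglongrightarrow> exp (- exp (- x))"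
proof -
  define z where "z N = b_norm N + a_norm N * x" for N
  have z: "filterlim z at_top sequentially" unfolding z_def by (rule z_norm_at_top)
  have bs: "(\<lambda>N. b_norm N / sqrt (2 * ln (real N))) \<longlonglongrightarrow> 1"
    unfolding b_norm_def[abs_def] by real_asymp
  have zb: "((\<lambda>b::real. (b + b / (1 + b\<^sup>2) * x) / b) \<longlongrightarrow> 1) at_top" by real_asymp
  have L1: "(\<lambda>N. z N / b_norm N * (b_norm N / sqrt (2 * ln (real N)))) \<longlonglongrightarrow> 1 * 1"
    using filterlim_compose[OF zb b_norm_at_top] by (intro tendsto_mult bs) (simp add: z_def a_norm_def)
  have L2: "\<forall>\<^sub>F N in sequentially. z N / b_norm N * (b_norm N / sqrt (2 * ln (real N))) = z N / sqrt (2 * ln (real N))"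
    using filterlim_at_top_dense[THEN iffD1, OF b_norm_at_top, rule_format, of 0] by eventually_elim auto
  have zs: "(\<lambda>N. z N / sqrt (2 * ln (real N))) \<longlonglongrightarrow> 1"
    using Lim_transform_eventually[OF L1 L2] by (simp only: mult_1_right)
  have lN: "filterlim (\<lambda>N. ln (real N)) at_top sequentially" by real_asymp
  have "(\<lambda>N. ln (real N) - (z N)\<^sup>2 / 2 - ln (ln (real N)) / 2) \<longlonglongrightarrow> ln (4 * pi) / 2 - x"
    using filterlim_compose[OF gumbel_exponent_limit[of "ln (4 * pi)" x] lN]
    by (simp add: z_def b_norm_def a_norm_def)
  then have E: "(\<lambda>N. exp (ln (real N) - (z N)\<^sup>2 / 2 - ln (ln (real N)) / 2)) \<longlonglongrightarrow> exp (ln (4 * pi) / 2 - x)"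
    by (rule tendsto_exp)
  have "(\<lambda>N. exp (ln (real N) - (z N)\<^sup>2 / 2 - ln (ln (real N)) / 2) * inverse (sqrt 2 * sqrt (2 * pi) * (z N / sqrt (2 * ln (real N)))))
      \<longlonglongrightarrow> exp (ln (4 * pi) / 2 - x) * inverse (sqrt 2 * sqrt (2 * pi) * 1)"
    by (intro tendsto_mult[OF E] tendsto_inverse tendsto_mult tendsto_const zs) auto
  \<comment> \<open>This explains 4 pi in \<open>b_norm\<close>: its root cancels the sqrt (2 pi) of
    the density together with the sqrt 2 contributed by z.\<close>
  moreover have "exp (ln (4 * pi) / 2 - x) * inverse (sqrt 2 * sqrt (2 * pi) * 1) = exp (- x)"
  proof -
    have "exp (ln (4 * pi) / 2) = sqrt (4 * pi)" by (simp add: ln_sqrt[symmetric])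
    also have "\<dots> = sqrt 2 * sqrt (2 * pi)" by (simp flip: real_sqrt_mult)
    finally have "exp (ln (4 * pi) / 2 - x) = sqrt 2 * sqrt (2 * pi) * exp (- x)"
      by (simp only: diff_conv_add_uminus exp_add)
    then show ?thesis by (simp add: field_simps)
  qed
  moreover have "\<forall>\<^sub>F N in sequentially. exp (ln (real N) - (z N)\<^sup>2 / 2 - ln (ln (real N)) / 2) * inverse (sqrt 2 * sqrt (2 * pi) * (z N / sqrt (2 * ln (real N))))
      = real N * (std_normal_density (z N) / z N)"
    using eventually_gt_at_top[of 2] filterlim_at_top_dense[THEN iffD1, OF lN, rule_format, of 0]
  proof eventually_elim
    case (elim N)
    have "exp (ln (ln (real N)) / 2) = sqrt (ln (real N))" using elim by (simp add: ln_sqrt[symmetric])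
    then have "exp (ln (real N) - (z N)\<^sup>2 / 2 - ln (ln (real N)) / 2) = real N * exp (- (z N)\<^sup>2 / 2) / sqrt (ln (real N))"
    proof -
      have "exp (a - b - c) = exp a * exp (- b) / exp c" for a b c :: real
        by (simp add: exp_diff exp_minus exp_add field_simps)
      with \<open>exp (ln (ln (real N)) / 2) = sqrt (ln (real N))\<close> show ?thesis using elim by simp
    qed
    moreover have "sqrt (2 * ln (real N)) = sqrt 2 * sqrt (ln (real N))" by (rule real_sqrt_mult)
    moreover have "n * e / r * inverse (s * p * (y / (s * r))) = n * (1 / p * e / y)" if "r > 0" "s > 0" for n e r s p y :: real
      using that by (simp add: field_simps)
    moreover have "sqrt (ln (real N)) > 0" "sqrt 2 > (0::real)" using elim by simp_all
    ultimately show ?case unfolding std_normal_density_def by (simp only:)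
  qed
  ultimately have dl: "(\<lambda>N. real N * (std_normal_density (z N) / z N)) \<longlonglongrightarrow> exp (- x)"
    by (auto dest: Lim_transform_eventually)
  have "(\<lambda>N. real N * (std_normal_density (z N) / z N) * ((1 - std_normal_cdf (z N)) / (std_normal_density (z N) / z N))) \<longlonglongrightarrow> exp (- x) * 1"
    by (intro tendsto_mult dl filterlim_compose[OF mills_ratio z])
  moreover have "\<forall>\<^sub>F N in sequentially. real N * (std_normal_density (z N) / z N) * ((1 - std_normal_cdf (z N)) / (std_normal_density (z N) / z N))
      = real N * (1 - std_normal_cdf (z N))"
    using filterlim_at_top_dense[THEN iffD1, OF z, rule_format, of 0]
  proof eventually_elim
    case (elim N)
    have "std_normal_density (z N) \<noteq> 0" "z N \<noteq> 0" using elim std_normal_density_pos[of "z N"] by auto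
    then show ?case by simp
  qed
  ultimately have "(\<lambda>N. real N * (1 - std_normal_cdf (z N))) \<longlonglongrightarrow> exp (- x)"
    by (auto dest: Lim_transform_eventually)
  from one_minus_power_tendsto_exp[OF this] show ?thesis
    using std_normal_cdf_bounds by (simp add: z_def)
qed

section \<open>The conditional law given the sample\<close>

lemma borel_measurable_vec_nth_iff:
  fixes X :: "'a \<Rightarrow> real^'k"
  shows "X \<in> borel_measurable M \<longleftrightarrow> (\<forall>i. (\<lambda>s. X s $ i) \<in> borel_measurable M)"
proof
  assume "X \<in> borel_measurable M"
  then have "(\<lambda>s. X s \<bullet> axis i 1) \<in> borel_measurable M" for i by measurable
  then show "\<forall>i. (\<lambda>s. X s $ i) \<in> borel_measurable M" by (simp add: inner_axis)
next
  assume "\<forall>i. (\<lambda>s. X s $ i) \<in> borel_measurable M"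
  then show "X \<in> borel_measurable M"
    by (subst borel_measurable_euclidean_space) (auto simp: Basis_vec_def inner_axis)
qed

lemma matrix_inv_solve:
  fixes A :: "real^'k^'k"
  assumes "invertible A"
  shows "A *v (matrix_inv A *v b) = b" "matrix_inv A *v (A *v b) = b"
proof -
  have "A ** matrix_inv A = mat 1 \<and> matrix_inv A ** A = mat 1"
    using assms unfolding invertible_def matrix_inv_def by (rule someI_ex)
  then show "A *v (matrix_inv A *v b) = b" "matrix_inv A *v (A *v b) = b"
    by (simp_all add: matrix_vector_mul_assoc)
qed

text \<open>For regular matrices Cramer's rule expresses the solution through determinants, which
  are polynomials in the entries; the singular ones form a measurable set on which the choice
  operator behind \<open>matrix_inv\<close> is constant.\<close>

lemma borel_measurable_matrix_inv_vector:
  fixes A :: "'a \<Rightarrow> real^'k^'k" and b :: "'a \<Rightarrow> real^'k"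
  assumes A[measurable]: "\<And>i j. (\<lambda>s. A s $ i $ j) \<in> borel_measurable M" and b: "b \<in> borel_measurable M"
  shows "(\<lambda>s. matrix_inv (A s) *v b s) \<in> borel_measurable M"
proof -
  have bm[measurable]: "(\<lambda>s. b s $ i) \<in> borel_measurable M" for i
    using b by (auto simp: borel_measurable_vec_nth_iff)
  have det[measurable]: "(\<lambda>s. det (B s)) \<in> borel_measurable M" if [measurable]: "\<And>i j. (\<lambda>s. B s $ i $ j) \<in> borel_measurable M"
    for B :: "'a \<Rightarrow> real^'k^'k"
    unfolding det_def by measurable
  txt \<open>All singular matrices share the same unspecified value of matrix_inv.\<close>
  define C :: "real^'k^'k" where "C = (SOME A'. False)"
  let ?cr = "\<lambda>s k. det (\<chi> i j. if j = k then b s $ i else A s $ i $ j)"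
  have eq: "(matrix_inv (A s) *v b s) $ k =
      (if det (A s) = 0 then (\<Sum>j\<in>UNIV. C $ k $ j * b s $ j) else ?cr s k / det (A s))" for s k
  proof (cases "det (A s) = 0")
    case True
    then have "\<not> invertible (A s)" by (simp add: invertible_det_nz)
    then have "matrix_inv (A s) = C" unfolding matrix_inv_def C_def invertible_def
      by (intro arg_cong[where f = Eps]) auto
    then show ?thesis using True by (simp add: matrix_vector_mult_def)
  next
    case False
    then have inv: "invertible (A s)" by (simp add: invertible_det_nz)
    have "matrix_inv (A s) *v b s = (\<chi> k. ?cr s k / det (A s))"
      using matrix_inv_solve(1)[OF inv] cramer[OF False] by blast
    then show ?thesis using False by simp
  qed
  have [measurable]: "(\<lambda>s. ?cr s k) \<in> borel_measurable M" for k
    by (rule det) auto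
  have [measurable]: "(\<lambda>s. det (A s)) \<in> borel_measurable M" by (rule det) measurable
  show ?thesis unfolding borel_measurable_vec_nth_iff eq by (intro allI) measurable
qed

lemma borel_measurable_psi:
  fixes Y :: "'a \<Rightarrow> nat \<Rightarrow> int \<Rightarrow> real" and F :: "'a \<Rightarrow> int \<Rightarrow> real^'k"
  assumes Y[measurable]: "\<And>i t. (\<lambda>s. Y s i t) \<in> borel_measurable M" and F[measurable]: "\<And>t. (\<lambda>s. F s t) \<in> borel_measurable M"
  shows "(\<lambda>s. psi \<nu> N T (Y s) (F s) i) \<in> borel_measurable M"
proof -
  have [measurable]: "(\<lambda>s. time_mean T (F s)) \<in> borel_measurable M" "(\<lambda>s. time_mean T (Y s i)) \<in> borel_measurable M" for i
    unfolding time_mean_def by measurable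
  have nth[measurable]: "(\<lambda>s. X s $ a) \<in> borel_measurable M" if "X \<in> borel_measurable M" for X :: "'a \<Rightarrow> real^'k" and a
    using that by (auto simp: borel_measurable_vec_nth_iff)
  have [measurable]: "(\<lambda>s. beta_hat T (Y s) (F s) i) \<in> borel_measurable M" for i
    unfolding beta_hat_def
  proof (rule borel_measurable_matrix_inv_vector)
    have "(\<lambda>s. F s t - time_mean T (F s)) \<in> borel_measurable M" for t by measurable
    note [measurable] = nth[OF this]
    show "(\<lambda>s. (\<Sum>t\<in>{1..int T}. outer (F s t - time_mean T (F s)) (F s t - time_mean T (F s))) $ a $ b) \<in> borel_measurable M" for a b
      unfolding sum_component outer_def vec_lambda_beta by measurable
  qed measurable
  have [measurable]: "(\<lambda>s. lambda_hat N T (Y s) (F s)) \<in> borel_measurable M"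
    unfolding lambda_hat_def
  proof (rule borel_measurable_matrix_inv_vector)
    have [measurable]: "(\<lambda>s. beta_hat T (Y s) (F s) i $ a) \<in> borel_measurable M" for i a by (rule nth) measurable
    show "(\<lambda>s. (\<Sum>i\<in>{1..N}. \<Sum>j\<in>{1..N}. centering N i j *\<^sub>R outer (beta_hat T (Y s) (F s) i) (beta_hat T (Y s) (F s) j)) $ a $ b) \<in> borel_measurable M" for a b
      unfolding sum_component outer_def vector_scaleR_component vec_lambda_beta by measurable
  qed measurable
  have [measurable]: "(\<lambda>s. alpha_hat N T (Y s) (F s) i) \<in> borel_measurable M" for i
    unfolding alpha_hat_def by measurable
  show ?thesis unfolding psi_def s_hat_def u_hat_def by measurable
qed

text \<open>The statistic sees only the observed window, so a panel rebuilt from the sample may take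
  any values elsewhere.\<close>

lemma psi_cong:
  assumes Y: "\<And>i t. i \<in> {1..N} \<Longrightarrow> t \<in> {1..int T} \<Longrightarrow> Y i t = Y' i t" and F: "\<And>t. t \<in> {1..int T} \<Longrightarrow> F t = F' t"
    and i: "i \<in> {1..N}"
  shows "psi \<nu> N T Y F i = psi \<nu> N T Y' F' i"
proof -
  have tF: "time_mean T F = time_mean T F'" unfolding time_mean_def using F by auto
  have tY: "time_mean T (Y i) = time_mean T (Y' i)" if "i \<in> {1..N}" for i
    unfolding time_mean_def using Y[OF that] by auto
  have b: "beta_hat T Y F i = beta_hat T Y' F' i" if "i \<in> {1..N}" for i
    unfolding beta_hat_def tF tY[OF that] using Y[OF that] F by (auto intro!: arg_cong2[where f = "(*v)"] arg_cong[where f = matrix_inv] sum.cong)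
  have l: "lambda_hat N T Y F = lambda_hat N T Y' F'"
    unfolding lambda_hat_def using b tY by (auto intro!: arg_cong2[where f = "(*v)"] arg_cong[where f = matrix_inv] sum.cong)
  have a: "alpha_hat N T Y F i = alpha_hat N T Y' F' i" if "i \<in> {1..N}" for i
    unfolding alpha_hat_def l tY[OF that] b[OF that] ..
  have s: "s_hat N T Y F = s_hat N T Y' F'"
    unfolding s_hat_def u_hat_def using a b Y F by (auto intro!: arg_cong[where f = sqrt] arg_cong2[where f = "(*)"] sum.cong)
  show ?thesis unfolding psi_def s a[OF i] ..
qed

context prob_space
begin

lemma prob_normal_le:
  assumes "distributed M lborel X std_normal_density"
  shows "prob (X -` {..c} \<inter> space M) = std_normal_cdf c"
proof -
  have d: "distr M lborel X = density lborel std_normal_density" and m: "X \<in> measurable M lborel"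
    using assms by (auto simp: distributed_def)
  have "std_normal_cdf c = measure (distr M lborel X) {..c}" unfolding std_normal_cdf_def d ..
  also have "\<dots> = prob (X -` {..c} \<inter> space M)" using m by (subst measure_distr) auto
  finally show ?thesis ..
qed

text \<open>Independence lets the sample be frozen: under the product law, Fubini leaves for each s
  the probability that independent normal variables stay below constants. The resulting function of
  \<open>S\<close> is tested on the sets of the form S^(-1)(b), which make up the
  sub-sigma-algebra.\<close>

lemma real_cond_exp_normal_thresholds:
  fixes w :: "nat \<Rightarrow> 'a \<Rightarrow> real"
  assumes w_normal: "\<And>i. i \<ge> 1 \<Longrightarrow> distributed M lborel (w i) std_normal_density"
    and w_indep: "indep_vars (\<lambda>_. borel) w {1..}"
    and ind: "indep_rv M (\<Pi>\<^sub>M i\<in>{1..}. borel) (\<lambda>\<omega>. \<lambda>i\<in>{1..}. w i \<omega>) Q S"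
    and S: "S \<in> space M \<rightarrow> space Q"
    and G[measurable]: "\<And>i. i \<in> {1..N} \<Longrightarrow> G i \<in> borel_measurable Q" and N: "N \<ge> 1"
  shows "AE \<omega> in M. real_cond_exp M (vimage_algebra (space M) S Q)
      (indicator {\<omega> \<in> space M. \<forall>i\<in>{1..N}. w i \<omega> \<le> G i (S \<omega>)}) \<omega> = (\<Prod>i\<in>{1..N}. std_normal_cdf (G i (S \<omega>)))"
proof -
  let ?B = "\<Pi>\<^sub>M i\<in>{1..}. (borel :: real measure)"
  let ?W = "\<lambda>\<omega>. \<lambda>i\<in>{1..}. w i \<omega>"
  have m[measurable]: "?W \<in> measurable M ?B" "S \<in> measurable M Q"
    and joint: "distr M ?B ?W \<Otimes>\<^sub>M distr M Q S = distr M (?B \<Otimes>\<^sub>M Q) (\<lambda>\<omega>. (?W \<omega>, S \<omega>))"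
    using indep_rv_distr[OF ind _ S] by (auto simp: space_PiM)
  interpret DW: prob_space "distr M ?B ?W" by (rule prob_space_distr) fact
  interpret DS: prob_space "distr M Q S" by (rule prob_space_distr) fact
  interpret P: pair_sigma_finite "distr M ?B ?W" "distr M Q S" ..
  let ?F = "vimage_algebra (space M) S Q"
  have sub: "subalgebra M ?F"
    using m(2) S by (auto simp: subalgebra_def sets_vimage_algebra2)
  interpret FS: finite_measure_subalgebra M ?F by unfold_locales (rule sub)
  have [measurable]: "std_normal_cdf \<in> borel_measurable borel"
    by (rule borel_measurable_mono) (auto intro: monoI std_normal_cdf_mono)
  have wm[measurable]: "w i \<in> borel_measurable M" if "i \<in> {1..N}" for i
    using that w_indep by (auto simp: indep_vars_def)
  let ?A = "{\<omega> \<in> space M. \<forall>i\<in>{1..N}. w i \<omega> \<le> G i (S \<omega>)}"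
  have GS[measurable]: "(\<lambda>\<omega>. G i (S \<omega>)) \<in> borel_measurable M" if "i \<in> {1..N}" for i
    using measurable_compose[OF m(2) G[OF that]] .
  have Am[measurable]: "?A \<in> sets M" using wm GS by measurable
  define g where "g s = (\<Prod>i\<in>{1..N}. std_normal_cdf (G i s))" for s
  have gm[measurable]: "g \<in> borel_measurable Q" unfolding g_def
    by (intro borel_measurable_prod) (auto intro!: measurable_compose[OF G])
  have g01: "0 \<le> g s" "g s \<le> 1" for s
    unfolding g_def using std_normal_cdf_bounds by (auto intro!: prod_nonneg prod_le_1)
  have "AE \<omega> in M. real_cond_exp M ?F (indicator ?A) \<omega> = g (S \<omega>)"
  proof (rule FS.real_cond_exp_charact)
    show "integrable M (indicator ?A :: 'a \<Rightarrow> real)" using Am by (intro integrable_real_indicator) (auto simp: less_top[symmetric])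
    show "integrable M (\<lambda>\<omega>. g (S \<omega>))" using g01 by (intro integrable_const_bound[of _ 1]) auto
    show "(\<lambda>\<omega>. g (S \<omega>)) \<in> borel_measurable ?F"
      using measurable_compose[OF measurable_vimage_algebra1[OF S] gm] .
    fix B assume "B \<in> sets ?F"
    then obtain b where b[measurable]: "b \<in> sets Q" and Bb: "B = S -` b \<inter> space M"
      using S by (auto simp: sets_vimage_algebra2)
    have Bm[measurable]: "B \<in> sets M" unfolding Bb by measurable
    let ?J = "{x \<in> space (?B \<Otimes>\<^sub>M Q). snd x \<in> b \<and> (\<forall>i\<in>{1..N}. fst x i \<le> G i (snd x))}"
    have J: "?J \<in> sets (?B \<Otimes>\<^sub>M Q)"
    proof -
      have "(\<lambda>x. fst x i) \<in> borel_measurable (?B \<Otimes>\<^sub>M Q)" "(\<lambda>x. G i (snd x)) \<in> borel_measurable (?B \<Otimes>\<^sub>M Q)" if "i \<in> {1..N}" for i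
        using that by (auto intro!: measurable_compose[OF measurable_fst] measurable_compose[OF measurable_snd] measurable_component_singleton)
      then have [measurable]: "Measurable.pred (?B \<Otimes>\<^sub>M Q) (\<lambda>x. fst x i \<le> G i (snd x))" if "i \<in> {1..N}" for i
        using that by measurable
      show ?thesis by measurable
    qed
    have "ennreal (\<integral>\<omega>\<in>B. indicator ?A \<omega> \<partial>M) = emeasure M (?A \<inter> B)"
    proof -
      have "(\<integral>\<omega>\<in>B. indicator ?A \<omega> \<partial>M) = (\<integral>\<omega>. indicator (?A \<inter> B) \<omega> \<partial>M)"
        unfolding set_lebesgue_integral_def by (intro Bochner_Integration.integral_cong) (auto split: split_indicator)
      also have "\<dots> = prob (?A \<inter> B)" by simp
      finally show ?thesis by (simp add: emeasure_eq_measure)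
    qed
    also have "?A \<inter> B = (\<lambda>\<omega>. (?W \<omega>, S \<omega>)) -` ?J \<inter> space M"
      unfolding Bb using S by (auto simp: space_pair_measure space_PiM)
    also have "emeasure M \<dots> = emeasure (distr M ?B ?W \<Otimes>\<^sub>M distr M Q S) ?J"
      unfolding joint using J measurable_Pair[OF m] by (subst emeasure_distr) auto
    also have "\<dots> = (\<integral>\<^sup>+s. emeasure (distr M ?B ?W) ((\<lambda>x. (x, s)) -` ?J) \<partial>distr M Q S)"
      using J by (intro P.emeasure_pair_measure_alt2) (simp cong: sets_pair_measure_cong)
    also have "\<dots> = (\<integral>\<^sup>+s. ennreal (g s * indicator b s) \<partial>distr M Q S)"
    proof (intro nn_integral_cong)
      fix s assume "s \<in> space (distr M Q S)"
      then have s: "s \<in> space Q" by simp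
      show "emeasure (distr M ?B ?W) ((\<lambda>x. (x, s)) -` ?J) = ennreal (g s * indicator b s)"
      proof (cases "s \<in> b")
        case True
        have V: "(\<lambda>x. (x, s)) -` ?J \<in> sets ?B" using sets_Pair2[OF J] .
        have "emeasure (distr M ?B ?W) ((\<lambda>x. (x, s)) -` ?J) = emeasure M (?W -` ((\<lambda>x. (x, s)) -` ?J) \<inter> space M)"
          by (rule emeasure_distr[OF m(1) V])
        also have "?W -` ((\<lambda>x. (x, s)) -` ?J) \<inter> space M = (\<Inter>i\<in>{1..N}. w i -` {..G i s} \<inter> space M)"
          using True s N by (auto simp: space_pair_measure space_PiM)
        also have "prob \<dots> = (\<Prod>i\<in>{1..N}. prob (w i -` {..G i s} \<inter> space M))"
          using N by (intro indep_varsD[OF w_indep]) auto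
        then have "emeasure M (\<Inter>i\<in>{1..N}. w i -` {..G i s} \<inter> space M) = ennreal (g s)"
          using prob_normal_le[OF w_normal] by (simp add: emeasure_eq_measure g_def)
        finally show ?thesis using True by (simp add: restrict_def)
      next
        case False
        then have "(\<lambda>x. (x, s)) -` ?J = {}" by auto
        then show ?thesis using False by (simp only: emeasure_empty) simp
      qed
    qed
    also have "\<dots> = (\<integral>\<^sup>+\<omega>. ennreal (g (S \<omega>) * indicator b (S \<omega>)) \<partial>M)"
      by (subst nn_integral_distr) auto
    also have "\<dots> = ennreal (\<integral>\<omega>. g (S \<omega>) * indicator b (S \<omega>) \<partial>M)"
      using g01 by (intro nn_integral_eq_integral integrable_const_bound[of _ 1]) (auto split: split_indicator)
    also have "(\<integral>\<omega>. g (S \<omega>) * indicator b (S \<omega>) \<partial>M) = (\<integral>\<omega>\<in>B. g (S \<omega>) \<partial>M)"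
      unfolding set_lebesgue_integral_def Bb
      by (intro Bochner_Integration.integral_cong) (auto split: split_indicator)
    finally show "(\<integral>\<omega>\<in>B. indicator ?A \<omega> \<partial>M) = (\<integral>\<omega>\<in>B. g (S \<omega>) \<partial>M)"
      using g01 by (subst (asm) ennreal_inj) (auto simp: set_lebesgue_integral_def intro!: integral_nonneg_AE AE_I2)
  qed
  then show ?thesis by (simp add: g_def)
qed

text \<open>The maximum stays below a level exactly if each normal variable stays below the level
  minus its \<open>psi\<close>, and \<open>psi\<close> is a function of the sample, so these are
  random thresholds known given the sample.\<close>

lemma cond_prob_Z_event:
  fixes y u :: "nat \<Rightarrow> int \<Rightarrow> 'a \<Rightarrow> real" and f :: "int \<Rightarrow> 'a \<Rightarrow> real^'k" and w :: "nat \<Rightarrow> 'a \<Rightarrow> real"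
  assumes model: "panel_model M y \<beta> f u \<alpha> lam"
    and w_normal: "\<And>i. i \<ge> 1 \<Longrightarrow> distributed M lborel (w i) std_normal_density"
    and w_indep: "indep_vars (\<lambda>_. borel) w {1..}"
    and w_sample: "indep_rv M (\<Pi>\<^sub>M i\<in>{1..}. borel) (\<lambda>\<omega>. \<lambda>i\<in>{1..}. w i \<omega>) (sample_space N T) (sample u f N T)"
    and N: "N \<ge> 1" and a: "a_norm N > 0"
  shows "AE \<omega> in M. cond_prob_sample M u f N T (Z_event M \<nu> y f w N T x) \<omega> =
     (\<Prod>i\<in>{1..N}. std_normal_cdf (b_norm N + a_norm N * x - psi \<nu> N T (\<lambda>i t. y i t \<omega>) (\<lambda>t. f t \<omega>) i))"
proof -
  define I where "I = {1..N} \<times> {1..int T}"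
  \<comment> \<open>Every row of the sample repeats the factors; they are read off the first row,
    which exists because N >= 1.\<close>
  define F where "F s t = (if t \<in> {1..int T} then snd (s (1, t)) else 0)" for s :: "nat \<times> int \<Rightarrow> real \<times> (real^'k)" and t
  \<comment> \<open>The observations are not recorded in the sample, but the model equation recovers
    them from errors and factors, the parameters and the mean of f being constants.\<close>
  define Y where "Y s i t = (if (i, t) \<in> I then \<alpha> i + \<beta> i \<bullet> lam + \<beta> i \<bullet> (snd (s (1, t)) - integral\<^sup>L M (f t)) + fst (s (i, t)) else 0)" for s :: "nat \<times> int \<Rightarrow> real \<times> (real^'k)" and i t
  have comp[measurable]: "(\<lambda>s. s p) \<in> borel_measurable (sample_space N T)" if "p \<in> I" for p
    unfolding sample_space_def I_def[symmetric] using that by measurable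
  have one: "(1, t) \<in> I" if "(i, t) \<in> I \<or> t \<in> {1..int T}" for i t using that N by (auto simp: I_def)
  have fs[measurable]: "(\<lambda>s. fst (s p)) \<in> borel_measurable (sample_space N T)" "(\<lambda>s. snd (s p)) \<in> borel_measurable (sample_space N T)" if "p \<in> I" for p
    using measurable_compose[OF comp[OF that], of fst borel] measurable_compose[OF comp[OF that], of snd borel]
      borel_measurable_continuous_onI[OF continuous_on_fst[OF continuous_on_id]] borel_measurable_continuous_onI[OF continuous_on_snd[OF continuous_on_id]]
    by auto
  have Fm[measurable]: "(\<lambda>s. F s t) \<in> borel_measurable (sample_space N T)" for t
    unfolding F_def using fs(2)[OF one, of 1 t] by (cases "t \<in> {1..int T}") auto
  have Ym[measurable]: "(\<lambda>s. Y s i t) \<in> borel_measurable (sample_space N T)" for i t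
  proof (cases "(i, t) \<in> I")
    case True
    note [measurable] = fs(1)[OF True] fs(2)[OF one[OF disjI1[OF True]]]
    have "(\<lambda>s. \<alpha> i + \<beta> i \<bullet> lam + \<beta> i \<bullet> (snd (s (1, t)) - integral\<^sup>L M (f t)) + fst (s (i, t))) \<in> borel_measurable (sample_space N T)"
      by measurable
    then show ?thesis unfolding Y_def using True by (simp only: if_True)
  qed (simp add: Y_def)
  define z where "z = b_norm N + a_norm N * x"
  let ?G = "\<lambda>i s. z - psi \<nu> N T (Y s) (F s) i"
  have S: "sample u f N T \<in> space M \<rightarrow> space (sample_space N T)"
    by (auto simp: sample_def sample_space_def space_PiM split: prod.splits)
  have psi_eq: "psi \<nu> N T (Y (sample u f N T \<omega>)) (F (sample u f N T \<omega>)) i = psi \<nu> N T (\<lambda>i t. y i t \<omega>) (\<lambda>t. f t \<omega>) i"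
    if "\<omega> \<in> space M" "i \<in> {1..N}" for \<omega> i
    using that model N
    by (intro psi_cong) (auto simp: Y_def F_def I_def sample_def panel_model_def)
  have ev: "Z_event M \<nu> y f w N T x = {\<omega> \<in> space M. \<forall>i\<in>{1..N}. w i \<omega> \<le> ?G i (sample u f N T \<omega>)}"
  proof -
    have "(Z_stat \<nu> N T (\<lambda>i t. y i t \<omega>) (\<lambda>t. f t \<omega>) (\<lambda>i. w i \<omega>) - b_norm N) / a_norm N \<le> x \<longleftrightarrow>
        (\<forall>i\<in>{1..N}. w i \<omega> \<le> ?G i (sample u f N T \<omega>))" if "\<omega> \<in> space M" for \<omega>
    proof -
      have "(Z_stat \<nu> N T (\<lambda>i t. y i t \<omega>) (\<lambda>t. f t \<omega>) (\<lambda>i. w i \<omega>) - b_norm N) / a_norm N \<le> x \<longleftrightarrow>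
          Z_stat \<nu> N T (\<lambda>i t. y i t \<omega>) (\<lambda>t. f t \<omega>) (\<lambda>i. w i \<omega>) \<le> z"
        using a by (simp add: z_def pos_divide_le_eq algebra_simps)
      also have "\<dots> \<longleftrightarrow> (\<forall>i\<in>{1..N}. psi \<nu> N T (\<lambda>i t. y i t \<omega>) (\<lambda>t. f t \<omega>) i + w i \<omega> \<le> z)"
        unfolding Z_stat_def using N by (subst Max_le_iff) auto
      also have "\<dots> \<longleftrightarrow> (\<forall>i\<in>{1..N}. w i \<omega> \<le> ?G i (sample u f N T \<omega>))"
        using psi_eq[OF that] by (intro ball_cong) auto
      finally show ?thesis .
    qed
    then show ?thesis unfolding Z_event_def by blast
  qed
  have "AE \<omega> in M. real_cond_exp M (vimage_algebra (space M) (sample u f N T) (sample_space N T))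
      (indicator {\<omega> \<in> space M. \<forall>i\<in>{1..N}. w i \<omega> \<le> ?G i (sample u f N T \<omega>)}) \<omega> = (\<Prod>i\<in>{1..N}. std_normal_cdf (?G i (sample u f N T \<omega>)))"
    by (intro real_cond_exp_normal_thresholds w_normal w_indep w_sample S N borel_measurable_diff borel_measurable_psi) auto
  then show ?thesis unfolding cond_prob_sample_def ev using AE_space
    by eventually_elim (use psi_eq in \<open>simp add: z_def\<close>)
qed

end

section \<open>The estimators on a fixed path\<close>

lemma outer_mult_vector: "outer x y *v z = (y \<bullet> z) *\<^sub>R x"
  by (vector outer_def matrix_vector_mult_def inner_vec_def)
    (simp add: sum_distrib_left sum_distrib_right mult_ac)

lemma sum_matrix_vector_mult: "(\<Sum>i\<in>I. A i) *v x = (\<Sum>i\<in>I. A i *v (x :: real^'k))"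
  by (induction I rule: infinite_finite_induct) (auto simp: matrix_vector_mult_add_rdistrib)

lemma coercive_imp_invertible:
  fixes A :: "real^'k^'k"
  assumes "\<And>x. x \<noteq> 0 \<Longrightarrow> x \<bullet> (A *v x) > 0"
  shows "invertible A"
proof -
  have "inj ((*v) A)"
  proof (rule injI)
    fix x y assume "A *v x = A *v y"
    then have "A *v (x - y) = 0" by (simp add: matrix_vector_mult_diff_distrib)
    then show "x = y" using assms[of "x - y"] by (cases "x = y") auto
  qed
  then show ?thesis using matrix_left_invertible_injective invertible_left_inverse by blast
qed

lemma time_mean_add: "time_mean T (\<lambda>t. g t + h t) = time_mean T g + time_mean T h"
  by (simp add: time_mean_def sum.distrib scaleR_add_right)

lemma time_mean_diff: "time_mean T (\<lambda>t. g t - h t) = time_mean T g - time_mean T h"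
  by (simp add: time_mean_def sum_subtractf scaleR_diff_right)

lemma time_mean_const: "T \<ge> 1 \<Longrightarrow> time_mean T (\<lambda>t. c) = c"
  by (simp add: time_mean_def sum_constant_scaleR)

lemma time_mean_inner: "time_mean T (\<lambda>t. b \<bullet> g t) = b \<bullet> time_mean T g"
  by (simp add: time_mean_def inner_sum_right)

lemma time_mean_cong: "(\<And>t. t \<in> {1..int T} \<Longrightarrow> g t = h t) \<Longrightarrow> time_mean T g = time_mean T h"
  by (simp add: time_mean_def)

lemma time_mean_mono:
  fixes g h :: "int \<Rightarrow> real"
  shows "(\<And>t. t \<in> {1..int T} \<Longrightarrow> g t \<le> h t) \<Longrightarrow> time_mean T g \<le> time_mean T h"
  by (auto simp: time_mean_def intro!: divide_right_mono sum_mono)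

lemma time_mean_cmult: "time_mean T (\<lambda>t. c * g t) = c * time_mean T (g :: int \<Rightarrow> real)"
  by (simp add: time_mean_def sum_distrib_left mult_ac)

lemma time_mean_sum:
  "finite I \<Longrightarrow> time_mean T (\<lambda>t. \<Sum>a\<in>I. h a t) = (\<Sum>a\<in>I. time_mean T (h a))"
  by (induction I rule: finite_induct) (auto simp: time_mean_add time_mean_def[of T "\<lambda>t. 0"])

lemma time_mean_square_le:
  fixes g :: "int \<Rightarrow> real"
  assumes "T \<ge> 1"
  shows "(time_mean T g)\<^sup>2 \<le> time_mean T (\<lambda>t. (g t)\<^sup>2)"
proof -
  have "(\<Sum>t\<in>{1..int T}. g t)\<^sup>2 \<le> real T * (\<Sum>t\<in>{1..int T}. (g t)\<^sup>2)"
    using sum_squared_le_sum_of_squares[of g "{1..int T}"] by (simp add: mult.commute)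
  then have "(\<Sum>t\<in>{1..int T}. g t)\<^sup>2 / (real T)\<^sup>2 \<le> real T * (\<Sum>t\<in>{1..int T}. (g t)\<^sup>2) / (real T)\<^sup>2"
    by (intro divide_right_mono) auto
  then show ?thesis using assms by (simp add: time_mean_def power_divide power2_eq_square)
qed

lemma time_mean_variance_le:
  fixes g :: "int \<Rightarrow> real"
  assumes "T \<ge> 1"
  shows "time_mean T (\<lambda>t. (g t - time_mean T g)\<^sup>2) \<le> time_mean T (\<lambda>t. (g t)\<^sup>2)"
proof -
  let ?m = "time_mean T g"
  have "time_mean T (\<lambda>t. (g t - ?m)\<^sup>2) = time_mean T (\<lambda>t. (g t)\<^sup>2 - 2 * ?m * g t + ?m\<^sup>2)"
    by (intro time_mean_cong) (simp add: power2_diff mult_ac)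
  also have "\<dots> = time_mean T (\<lambda>t. (g t)\<^sup>2) - 2 * ?m * ?m + ?m\<^sup>2"
    using assms by (simp add: time_mean_add time_mean_diff time_mean_cmult time_mean_const)
  also have "\<dots> = time_mean T (\<lambda>t. (g t)\<^sup>2) - ?m\<^sup>2" by (simp add: power2_eq_square)
  finally show ?thesis by simp
qed

lemma square_le_of_abs_le: "\<bar>x\<bar> \<le> y \<Longrightarrow> x\<^sup>2 \<le> (y::real)\<^sup>2"
  using power_mono[of "\<bar>x\<bar>" y 2] by simp

text \<open>One panel of plain numbers, with all probability removed. Every estimate below is
  explicit in \<rho>, which bounds the averages of the errors and of errors times factors; \<kappa>
  keeps the sample covariance of the factors away from singularity, and \<mu> stands for the factor
  mean.\<close>

locale panel_data =
  fixes N T :: nat and y u :: "nat \<Rightarrow> int \<Rightarrow> real" and f :: "int \<Rightarrow> real^'k"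
    and \<alpha> :: "nat \<Rightarrow> real" and \<beta> :: "nat \<Rightarrow> real^'k" and lam \<mu> :: "real^'k"
    and \<rho> \<kappa> Bf Bb Bl :: real
  assumes N: "N \<ge> 1" and T: "T \<ge> 1"
    and y: "\<And>i t. i \<in> {1..N} \<Longrightarrow> t \<in> {1..int T} \<Longrightarrow> y i t = \<alpha> i + \<beta> i \<bullet> lam + \<beta> i \<bullet> (f t - \<mu>) + u i t"
    and nonneg: "0 \<le> \<rho>" "0 < \<kappa>" "0 \<le> Bf" "0 \<le> Bb" "0 \<le> Bl"
    and u_mean: "\<And>i. i \<in> {1..N} \<Longrightarrow> \<bar>time_mean T (u i)\<bar> \<le> \<rho>"
    and uf_mean: "\<And>i. i \<in> {1..N} \<Longrightarrow> norm (time_mean T (\<lambda>t. u i t *\<^sub>R f t)) \<le> \<rho>"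
    and Q_lower: "\<And>x. \<kappa> * (norm x)\<^sup>2 \<le> time_mean T (\<lambda>t. ((f t - time_mean T f) \<bullet> x)\<^sup>2)"
    and f_mean: "norm (time_mean T f) \<le> Bf"
    and f_var: "time_mean T (\<lambda>t. (norm (f t - time_mean T f))\<^sup>2) \<le> Bf\<^sup>2"
    and \<beta>_bound: "\<And>i. i \<in> {1..N} \<Longrightarrow> norm (\<beta> i) \<le> Bb"
    and lam_bound: "norm (lam - \<mu>) \<le> Bl"
begin

text \<open>The time average of y i is \<alpha> i + \<beta>h i \<bullet> lamT + e i, so lambda_hat estimates lamT, with error
  ch; r i t is the residual of the time series regression, which differs from u_hat because lambda_hat
  need not be the average factor.\<close>

abbreviation "fb \<equiv> time_mean T f"
abbreviation "ub i \<equiv> time_mean T (u i)"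
abbreviation "\<beta>h \<equiv> beta_hat T y f"
definition "\<delta> i = \<beta>h i - \<beta> i"
definition "lamT = lam - \<mu> + fb"
definition "e i = ub i - \<delta> i \<bullet> lamT"
definition "ch = lambda_hat N T y f - lamT"
text \<open>The constants for which \<open>norm (\<delta> i) \<le> Cd * \<rho>\<close> and
  \<open>\<bar>e i\<bar> \<le> Ce * \<rho>\<close>.\<close>

definition "Cd = (1 + Bf) / \<kappa>"
definition "Ce = 1 + Cd * (Bl + Bf)"
definition "r i t = u i t - ub i - \<delta> i \<bullet> (f t - fb)"

section \<open>Time series regressions and the error of the slopes\<close>

lemma y_mean: "i \<in> {1..N} \<Longrightarrow> time_mean T (y i) = \<alpha> i + \<beta> i \<bullet> lamT + ub i"
proof -
  assume i: "i \<in> {1..N}"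
  have "time_mean T (y i) = time_mean T (\<lambda>t. (\<alpha> i + \<beta> i \<bullet> lam) + \<beta> i \<bullet> (f t - \<mu>) + u i t)"
    using y[OF i] by (intro time_mean_cong) auto
  also have "\<dots> = \<alpha> i + \<beta> i \<bullet> lam + \<beta> i \<bullet> (fb - \<mu>) + ub i"
    using T by (simp add: time_mean_add time_mean_const time_mean_inner time_mean_diff)
  finally show ?thesis by (simp add: lamT_def inner_diff_right inner_add_right)
qed

lemma y_demeaned: "i \<in> {1..N} \<Longrightarrow> t \<in> {1..int T} \<Longrightarrow> y i t - time_mean T (y i) = \<beta> i \<bullet> (f t - fb) + (u i t - ub i)"
  using y y_mean by (simp add: lamT_def inner_diff_right inner_add_right)

definition "Q = (\<Sum>t\<in>{1..int T}. outer (f t - fb) (f t - fb))"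

lemma Q_mult: "Q *v x = (\<Sum>t\<in>{1..int T}. ((f t - fb) \<bullet> x) *\<^sub>R (f t - fb))"
  unfolding Q_def sum_matrix_vector_mult outer_mult_vector ..

lemma Q_quad: "x \<bullet> (Q *v x) = real T * time_mean T (\<lambda>t. ((f t - fb) \<bullet> x)\<^sup>2)"
  using T by (simp add: Q_mult inner_sum_right time_mean_def power2_eq_square inner_commute)

lemma Q_coercive: "x \<bullet> (Q *v x) \<ge> real T * \<kappa> * (norm x)\<^sup>2"
  unfolding Q_quad using Q_lower[of x] T by (simp add: mult.assoc mult_left_mono)

lemma Q_invertible: "invertible Q"
proof (rule coercive_imp_invertible)
  fix x :: "real^'k" assume "x \<noteq> 0"
  then have "0 < real T * \<kappa> * (norm x)\<^sup>2" using T nonneg by simp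
  then show "0 < x \<bullet> (Q *v x)" using Q_coercive[of x] by linarith
qed

lemma f_demeaned_sum: "(\<Sum>t\<in>{1..int T}. f t - fb) = 0"
proof -
  have "time_mean T (\<lambda>t. f t - fb) = 0" using T by (simp add: time_mean_diff time_mean_const)
  then show ?thesis using T by (simp add: time_mean_def)
qed

text \<open>The normal equations minus their version for the true slope. Since the demeaned factors
  sum to zero, the mean error drops out, and the rest is a combination of the two averages
  controlled by \<rho>.\<close>

lemma Q_\<delta>: assumes i: "i \<in> {1..N}"
  shows "Q *v \<delta> i = real T *\<^sub>R (time_mean T (\<lambda>t. u i t *\<^sub>R f t) - ub i *\<^sub>R fb)"
proof -
  have "Q *v \<beta>h i = (\<Sum>t\<in>{1..int T}. (y i t - time_mean T (y i)) *\<^sub>R (f t - fb))"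
    unfolding beta_hat_def Q_def[symmetric] by (rule matrix_inv_solve(1)[OF Q_invertible])
  also have "\<dots> = (\<Sum>t\<in>{1..int T}. ((f t - fb) \<bullet> \<beta> i) *\<^sub>R (f t - fb) + u i t *\<^sub>R (f t - fb) - ub i *\<^sub>R (f t - fb))"
    by (intro sum.cong refl, subst y_demeaned[OF i]) (simp_all add: scaleR_add_left scaleR_diff_left inner_commute)
  also have "\<dots> = Q *v \<beta> i + (\<Sum>t\<in>{1..int T}. u i t *\<^sub>R (f t - fb)) - ub i *\<^sub>R (\<Sum>t\<in>{1..int T}. f t - fb)"
    by (simp only: Q_mult scaleR_sum_right sum_subtractf[symmetric] sum.distrib[symmetric])
  also have "(\<Sum>t\<in>{1..int T}. f t - fb) = 0" by (rule f_demeaned_sum)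
  finally have "Q *v \<delta> i = (\<Sum>t\<in>{1..int T}. u i t *\<^sub>R (f t - fb))"
    by (simp add: \<delta>_def matrix_vector_mult_diff_distrib)
  also have "\<dots> = (\<Sum>t\<in>{1..int T}. u i t *\<^sub>R f t) - (\<Sum>t\<in>{1..int T}. u i t) *\<^sub>R fb"
    by (simp add: scaleR_diff_right sum_subtractf scaleR_sum_left)
  also have "\<dots> = real T *\<^sub>R (time_mean T (\<lambda>t. u i t *\<^sub>R f t) - ub i *\<^sub>R fb)"
    using T by (simp add: time_mean_def[of T "u i"] time_mean_def[of T "\<lambda>t. u i t *\<^sub>R f t"] scaleR_diff_right)
  finally show ?thesis .
qed

text \<open>Coercivity of \<open>Q\<close> against the normal equations; one factor
  \<open>norm (\<delta> i)\<close> is cancelled, hence the separate case of 0, and so is T.\<close>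

lemma \<delta>_bound: assumes i: "i \<in> {1..N}" shows "norm (\<delta> i) \<le> Cd * \<rho>"
proof (cases "\<delta> i = 0")
  case True
  then show ?thesis using nonneg by (simp add: Cd_def)
next
  case False
  have "real T * \<kappa> * (norm (\<delta> i))\<^sup>2 \<le> \<delta> i \<bullet> (Q *v \<delta> i)" by (rule Q_coercive)
  also have "\<dots> \<le> norm (\<delta> i) * norm (Q *v \<delta> i)" by (rule norm_cauchy_schwarz)
  also have "norm (Q *v \<delta> i) = real T * norm (time_mean T (\<lambda>t. u i t *\<^sub>R f t) - ub i *\<^sub>R fb)"
    unfolding Q_\<delta>[OF i] by simp
  also have "norm (time_mean T (\<lambda>t. u i t *\<^sub>R f t) - ub i *\<^sub>R fb) \<le> \<rho> + \<rho> * Bf"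
    using norm_triangle_ineq4[of "time_mean T (\<lambda>t. u i t *\<^sub>R f t)" "ub i *\<^sub>R fb"] uf_mean[OF i]
      mult_mono[OF u_mean[OF i] f_mean] nonneg by simp
  finally have "real T * \<kappa> * (norm (\<delta> i))\<^sup>2 \<le> norm (\<delta> i) * (real T * (\<rho> + \<rho> * Bf))"
    by (simp add: mult_left_mono)
  then have "(norm (\<delta> i) * real T) * (\<kappa> * norm (\<delta> i)) \<le> (norm (\<delta> i) * real T) * (\<rho> + \<rho> * Bf)"
    by (simp add: power2_eq_square mult_ac)
  then have "\<kappa> * norm (\<delta> i) \<le> \<rho> + \<rho> * Bf" using False T by (subst (asm) mult_le_cancel_left_pos) auto
  then show ?thesis using nonneg by (simp add: Cd_def field_simps)
qed

lemma e_bound: assumes i: "i \<in> {1..N}" shows "\<bar>e i\<bar> \<le> Ce * \<rho>"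
proof -
  have C: "Cd \<ge> 0" using nonneg by (simp add: Cd_def)
  have "\<bar>e i\<bar> \<le> \<bar>ub i\<bar> + \<bar>\<delta> i \<bullet> lamT\<bar>" by (simp add: e_def)
  also have "\<bar>\<delta> i \<bullet> lamT\<bar> \<le> norm (\<delta> i) * norm lamT" by (rule Cauchy_Schwarz_ineq2)
  also have "\<dots> \<le> (Cd * \<rho>) * (Bl + Bf)"
    using \<delta>_bound[OF i] lam_bound f_mean nonneg norm_triangle_ineq[of "lam - \<mu>" fb] C
    by (intro mult_mono) (auto simp: lamT_def)
  finally show ?thesis using u_mean[OF i] by (simp add: Ce_def algebra_simps)
qed

lemma y_mean': "i \<in> {1..N} \<Longrightarrow> time_mean T (y i) = \<alpha> i + \<beta>h i \<bullet> lamT + e i"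
  using y_mean by (simp add: e_def \<delta>_def inner_diff_left)

text \<open>Measured against \<open>lamT\<close>, the sampling error of the factor mean produces no
  term of its own; only \<open>e\<close> and \<open>ch\<close> disturb the estimate.\<close>

lemma alpha_hat_eq: "i \<in> {1..N} \<Longrightarrow> alpha_hat N T y f i = \<alpha> i + e i - \<beta>h i \<bullet> ch"
  using y_mean' by (simp add: alpha_hat_def ch_def inner_diff_right)

lemma u_hat_eq:
  assumes "i \<in> {1..N}" "t \<in> {1..int T}"
  shows "u_hat N T y f i t = r i t + \<beta>h i \<bullet> (ch + (lam - \<mu>))"
proof -
  have "u_hat N T y f i t = (y i t - time_mean T (y i)) + \<beta>h i \<bullet> lambda_hat N T y f - \<beta>h i \<bullet> f t"
    by (simp add: u_hat_def alpha_hat_def)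
  also have "\<dots> = (\<beta> i \<bullet> (f t - fb) + (u i t - ub i)) + \<beta>h i \<bullet> (ch + lamT) - \<beta>h i \<bullet> f t"
    unfolding y_demeaned[OF assms] by (simp add: ch_def)
  also have "\<dots> = r i t + \<beta>h i \<bullet> (ch + (lam - \<mu>))"
    by (simp add: r_def \<delta>_def lamT_def inner_diff_right inner_diff_left inner_add_right)
  finally show ?thesis .
qed

section \<open>Bounds for the residual scale\<close>

lemma s_hat_sq: "(s_hat N T y f)\<^sup>2 = (\<Sum>i\<in>{1..N}. time_mean T (\<lambda>t. (u_hat N T y f i t)\<^sup>2)) / real N"
proof -
  have "(s_hat N T y f)\<^sup>2 = 1 / (real N * real T) * (\<Sum>i\<in>{1..N}. \<Sum>t\<in>{1..int T}. (u_hat N T y f i t)\<^sup>2)"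
    unfolding s_hat_def by (intro real_sqrt_pow2 mult_nonneg_nonneg sum_nonneg) auto
  also have "\<dots> = (\<Sum>i\<in>{1..N}. time_mean T (\<lambda>t. (u_hat N T y f i t)\<^sup>2)) / real N"
    by (simp add: time_mean_def sum_divide_distrib sum_distrib_left mult.commute[of "real T"])
  finally show ?thesis .
qed

lemma s_hat_nonneg: "0 \<le> s_hat N T y f"
  unfolding s_hat_def by (intro real_sqrt_ge_zero mult_nonneg_nonneg sum_nonneg) auto

lemma f_abs_dev: "time_mean T (\<lambda>t. norm (f t - fb)) \<le> Bf"
proof -
  have "(time_mean T (\<lambda>t. norm (f t - fb)))\<^sup>2 \<le> Bf\<^sup>2"
    by (rule order_trans[OF time_mean_square_le[OF T] f_var])
  then show ?thesis by (rule power2_le_imp_le[OF _ nonneg(3)])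
qed

text \<open>The mean square over time is at least the variance over time, which removes the unknown
  offset \<open>\<beta>h i \<bullet> (ch + (lam - \<mu>))\<close> whatever \<open>ch\<close> is. The
  variance is at least the squared mean absolute value of the centred residuals \<open>r\<close>,
  and these differ from \<open>u\<close> by terms of order \<rho>.\<close>

lemma s_hat_lower:
  assumes m: "\<And>i. i \<in> {1..N} \<Longrightarrow> m0 \<le> time_mean T (\<lambda>t. \<bar>u i t\<bar>)" and m0: "m0 > 0"
    and small: "\<rho> * (1 + Cd * Bf) \<le> m0 / 2"
  shows "m0 / 2 \<le> s_hat N T y f"
proof -
  have C: "Cd \<ge> 0" using nonneg by (simp add: Cd_def)
  have "(m0 / 2)\<^sup>2 \<le> time_mean T (\<lambda>t. (u_hat N T y f i t)\<^sup>2)" if i: "i \<in> {1..N}" for i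
  proof -
    let ?k = "\<beta>h i \<bullet> (ch + (lam - \<mu>))"
    have rm: "time_mean T (r i) = 0"
    proof -
      have "time_mean T (r i) = ub i - ub i - \<delta> i \<bullet> (fb - fb)"
        unfolding r_def[abs_def] using T by (simp add: time_mean_diff time_mean_const time_mean_inner)
      then show ?thesis by simp
    qed
    have um: "time_mean T (u_hat N T y f i) = ?k"
    proof -
      have "time_mean T (u_hat N T y f i) = time_mean T (\<lambda>t. r i t + ?k)"
        by (intro time_mean_cong u_hat_eq i)
      then show ?thesis using rm T by (simp add: time_mean_add time_mean_const)
    qed
    have "m0 - \<rho> - Cd * \<rho> * Bf \<le> time_mean T (\<lambda>t. \<bar>u i t\<bar>) - \<bar>ub i\<bar> - norm (\<delta> i) * time_mean T (\<lambda>t. norm (f t - fb))"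
      using m[OF i] u_mean[OF i] mult_mono[OF \<delta>_bound[OF i] f_abs_dev] C nonneg
      by (simp add: time_mean_def sum_nonneg)
    also have "\<dots> = time_mean T (\<lambda>t. \<bar>u i t\<bar> - \<bar>ub i\<bar> - norm (\<delta> i) * norm (f t - fb))"
      using T by (simp add: time_mean_diff time_mean_const time_mean_cmult)
    also have "\<dots> \<le> time_mean T (\<lambda>t. \<bar>r i t\<bar>)"
    proof (rule time_mean_mono)
      fix t
      have "\<bar>\<delta> i \<bullet> (f t - fb)\<bar> \<le> norm (\<delta> i) * norm (f t - fb)" by (rule Cauchy_Schwarz_ineq2)
      then show "\<bar>u i t\<bar> - \<bar>ub i\<bar> - norm (\<delta> i) * norm (f t - fb) \<le> \<bar>r i t\<bar>"
        unfolding r_def by linarith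
    qed
    finally have "m0 / 2 \<le> time_mean T (\<lambda>t. \<bar>r i t\<bar>)" using small by (simp add: algebra_simps)
    then have "(m0 / 2)\<^sup>2 \<le> (time_mean T (\<lambda>t. \<bar>r i t\<bar>))\<^sup>2" using m0 by (intro power_mono) auto
    also have "\<dots> \<le> time_mean T (\<lambda>t. \<bar>r i t\<bar>\<^sup>2)" by (rule time_mean_square_le[OF T])
    also have "\<dots> = time_mean T (\<lambda>t. (u_hat N T y f i t - time_mean T (u_hat N T y f i))\<^sup>2)"
      unfolding um using u_hat_eq[OF i] by (intro time_mean_cong) simp
    also have "\<dots> \<le> time_mean T (\<lambda>t. (u_hat N T y f i t)\<^sup>2)" by (rule time_mean_variance_le[OF T])
    finally show ?thesis .
  qed
  then have "(\<Sum>i\<in>{1..N}. (m0 / 2)\<^sup>2) / real N \<le> (s_hat N T y f)\<^sup>2"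
    unfolding s_hat_sq by (intro divide_right_mono sum_mono) auto
  then have "(m0 / 2)\<^sup>2 \<le> (s_hat N T y f)\<^sup>2" using N by simp
  then show ?thesis using s_hat_nonneg power2_le_imp_le by blast
qed

text \<open>\<open>ch\<close> stays in the bound because the alternative does not control it; its
  size later cancels against the same size in \<open>alpha_hat\<close>. The factor 6 is 2 for
  splitting off the offset times 3 for the three parts of \<open>r\<close>.\<close>

lemma s_hat_upper:
  assumes small: "Cd * \<rho> \<le> 1" "\<rho> \<le> 1"
    and U: "(\<Sum>i\<in>{1..N}. \<Sum>t\<in>{1..int T}. (u i t)\<^sup>2) \<le> U * (real N * real T)"
  shows "(s_hat N T y f)\<^sup>2 \<le> 6 * U + 6 + 6 * Bf\<^sup>2 + 2 * (Bb + 1)\<^sup>2 * (norm ch + Bl)\<^sup>2"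
proof -
  let ?c = "ch + (lam - \<mu>)"
  have "time_mean T (\<lambda>t. (u_hat N T y f i t)\<^sup>2) \<le> 6 * time_mean T (\<lambda>t. (u i t)\<^sup>2) + (6 + 6 * Bf\<^sup>2 + 2 * (Bb + 1)\<^sup>2 * (norm ch + Bl)\<^sup>2)"
    if i: "i \<in> {1..N}" for i
  proof -
    have d1: "norm (\<delta> i) \<le> 1" using \<delta>_bound[OF i] small by linarith
    have bh: "norm (\<beta>h i) \<le> Bb + 1" using norm_triangle_ineq[of "\<beta> i" "\<delta> i"] \<beta>_bound[OF i] d1 by (simp add: \<delta>_def)
    have "\<bar>\<beta>h i \<bullet> ?c\<bar> \<le> norm (\<beta>h i) * norm ?c" by (rule Cauchy_Schwarz_ineq2)
    also have "\<dots> \<le> (Bb + 1) * (norm ch + Bl)"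
      using bh norm_triangle_ineq[of ch "lam - \<mu>"] lam_bound nonneg by (intro mult_mono) auto
    finally have k: "(\<beta>h i \<bullet> ?c)\<^sup>2 \<le> (Bb + 1)\<^sup>2 * (norm ch + Bl)\<^sup>2"
      using square_le_of_abs_le by (simp flip: power_mult_distrib)
    have ub1: "(ub i)\<^sup>2 \<le> 1" using u_mean[OF i] small by (simp add: abs_square_le_1)
    have pt: "(u_hat N T y f i t)\<^sup>2 \<le> 6 * (u i t)\<^sup>2 + 6 * (norm (f t - fb))\<^sup>2 + (6 + 2 * (Bb + 1)\<^sup>2 * (norm ch + Bl)\<^sup>2)"
      if t: "t \<in> {1..int T}" for t
    proof -
      have "\<bar>\<delta> i \<bullet> (f t - fb)\<bar> \<le> norm (\<delta> i) * norm (f t - fb)" by (rule Cauchy_Schwarz_ineq2)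
      also have "\<dots> \<le> 1 * norm (f t - fb)" using d1 by (intro mult_right_mono) auto
      finally have d: "(\<delta> i \<bullet> (f t - fb))\<^sup>2 \<le> (norm (f t - fb))\<^sup>2" using square_le_of_abs_le by simp
      have sq2: "(a + b)\<^sup>2 \<le> 2 * a\<^sup>2 + 2 * b\<^sup>2" for a b :: real
        using zero_le_power2[of "a - b"] by (simp add: power2_sum power2_diff)
      have sq3: "(a - b - c)\<^sup>2 \<le> 3 * a\<^sup>2 + 3 * b\<^sup>2 + 3 * c\<^sup>2" for a b c :: real
        using zero_le_power2[of "a + b"] zero_le_power2[of "a + c"] zero_le_power2[of "b - c"]
        by (simp add: power2_eq_square algebra_simps)
      have "(u_hat N T y f i t)\<^sup>2 \<le> 2 * (r i t)\<^sup>2 + 2 * (\<beta>h i \<bullet> ?c)\<^sup>2"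
        unfolding u_hat_eq[OF i t] by (rule sq2)
      moreover have "(r i t)\<^sup>2 \<le> 3 * (u i t)\<^sup>2 + 3 * (ub i)\<^sup>2 + 3 * (\<delta> i \<bullet> (f t - fb))\<^sup>2"
        unfolding r_def by (rule sq3)
      ultimately show ?thesis using d ub1 k by linarith
    qed
    have "time_mean T (\<lambda>t. (u_hat N T y f i t)\<^sup>2) \<le> time_mean T (\<lambda>t. 6 * (u i t)\<^sup>2 + 6 * (norm (f t - fb))\<^sup>2 + (6 + 2 * (Bb + 1)\<^sup>2 * (norm ch + Bl)\<^sup>2))"
      by (intro time_mean_mono pt)
    also have "\<dots> = 6 * time_mean T (\<lambda>t. (u i t)\<^sup>2) + 6 * time_mean T (\<lambda>t. (norm (f t - fb))\<^sup>2) + (6 + 2 * (Bb + 1)\<^sup>2 * (norm ch + Bl)\<^sup>2)"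
      using T by (simp only: time_mean_add time_mean_cmult time_mean_const)
    finally show ?thesis using f_var by linarith
  qed
  then have "(s_hat N T y f)\<^sup>2 \<le> (\<Sum>i\<in>{1..N}. 6 * time_mean T (\<lambda>t. (u i t)\<^sup>2) + (6 + 6 * Bf\<^sup>2 + 2 * (Bb + 1)\<^sup>2 * (norm ch + Bl)\<^sup>2)) / real N"
    unfolding s_hat_sq by (intro divide_right_mono sum_mono) auto
  also have "\<dots> = 6 * ((\<Sum>i\<in>{1..N}. \<Sum>t\<in>{1..int T}. (u i t)\<^sup>2) / (real N * real T)) + (6 + 6 * Bf\<^sup>2 + 2 * (Bb + 1)\<^sup>2 * (norm ch + Bl)\<^sup>2)"
    using N by (simp add: sum.distrib time_mean_def add_divide_distrib flip: sum_distrib_left sum_divide_distrib)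
  also have "(\<Sum>i\<in>{1..N}. \<Sum>t\<in>{1..int T}. (u i t)\<^sup>2) / (real N * real T) \<le> U"
    using U N T by (subst pos_divide_le_eq) auto
  finally show ?thesis by simp
qed

section \<open>The cross-sectional regression\<close>

lemma centering_sum:
  fixes X :: "nat \<Rightarrow> 'b::real_vector"
  assumes "j \<in> {1..N}"
  shows "(\<Sum>i\<in>{1..N}. centering N i j *\<^sub>R X i) = X j - (1 / real N) *\<^sub>R (\<Sum>i\<in>{1..N}. X i)"
proof -
  have "(\<Sum>i\<in>{1..N}. centering N i j *\<^sub>R X i) = (\<Sum>i\<in>{1..N}. (if i = j then X i else 0) - (1 / real N) *\<^sub>R X i)"
    by (intro sum.cong refl) (auto simp: centering_def scaleR_diff_left)
  then show ?thesis using assms by (simp add: sum_subtractf scaleR_sum_right)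
qed

definition "A = (\<Sum>i\<in>{1..N}. \<Sum>j\<in>{1..N}. centering N i j *\<^sub>R outer (\<beta>h i) (\<beta>h j))"
definition "Dh i = \<beta>h i - (1 / real N) *\<^sub>R (\<Sum>j\<in>{1..N}. \<beta>h j)"

lemma A_mult: "A *v x = (\<Sum>j\<in>{1..N}. (\<beta>h j \<bullet> x) *\<^sub>R Dh j)"
proof -
  have "A *v x = (\<Sum>i\<in>{1..N}. \<Sum>j\<in>{1..N}. centering N i j *\<^sub>R ((\<beta>h j \<bullet> x) *\<^sub>R \<beta>h i))"
    unfolding A_def sum_matrix_vector_mult
    by (simp add: scaleR_matrix_vector_assoc[symmetric] outer_mult_vector)
  also have "\<dots> = (\<Sum>j\<in>{1..N}. (\<beta>h j \<bullet> x) *\<^sub>R (\<Sum>i\<in>{1..N}. centering N i j *\<^sub>R \<beta>h i))"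
    by (subst sum.swap) (simp add: scaleR_sum_right mult.commute)
  also have "\<dots> = (\<Sum>j\<in>{1..N}. (\<beta>h j \<bullet> x) *\<^sub>R Dh j)"
    by (intro sum.cong refl) (simp only: centering_sum Dh_def)
  finally show ?thesis .
qed

lemma Dh_sum: "(\<Sum>j\<in>{1..N}. Dh j) = 0"
proof -
  have "(\<Sum>j\<in>{1..N}. Dh j) = (\<Sum>j\<in>{1..N}. \<beta>h j) - real (card {1..N}) *\<^sub>R ((1 / real N) *\<^sub>R (\<Sum>j\<in>{1..N}. \<beta>h j))"
    by (simp only: Dh_def sum_subtractf sum_constant_scaleR)
  then show ?thesis using N by simp
qed

text \<open>One factor \<open>\<beta>h j\<close> in \<open>A_mult\<close> can be centred at no cost
  because the vectors \<open>Dh j\<close> sum to zero; thus \<open>A\<close> is the Gram matrix of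
  the centred estimated slopes.\<close>

lemma A_quad: "x \<bullet> (A *v x) = (\<Sum>j\<in>{1..N}. (Dh j \<bullet> x)\<^sup>2)"
proof -
  let ?b = "(1 / real N) *\<^sub>R (\<Sum>j\<in>{1..N}. \<beta>h j)"
  have "x \<bullet> (A *v x) = (\<Sum>j\<in>{1..N}. (Dh j \<bullet> x)\<^sup>2 + (?b \<bullet> x) * (Dh j \<bullet> x))"
    unfolding A_mult inner_sum_right
    by (intro sum.cong refl) (simp add: Dh_def power2_eq_square inner_diff_left algebra_simps inner_commute)
  also have "\<dots> = (\<Sum>j\<in>{1..N}. (Dh j \<bullet> x)\<^sup>2) + (?b \<bullet> x) * ((\<Sum>j\<in>{1..N}. Dh j) \<bullet> x)"
    by (simp add: sum.distrib sum_distrib_left inner_sum_left)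
  finally show ?thesis unfolding Dh_sum by simp
qed

text \<open>Up to estimation error the form of \<open>A\<close> is that of the true slopes: (a +
  b)^2 >= a^2/2 - b^2 with b^2 at most (k/4) |x|^2 leaves the coercivity N k/4. Under the null the
  normal equations for \<open>ch\<close> have only the errors \<open>e j\<close> on the right, so
  \<open>ch\<close> is of order \<rho>, and with it every \<open>alpha_hat\<close>.\<close>

lemma alpha_hat_null:
  assumes null: "\<And>i. i \<in> {1..N} \<Longrightarrow> \<alpha> i = 0"
    and S: "\<And>x. k * (norm x)\<^sup>2 * real N \<le> (\<Sum>i\<in>{1..N}. ((\<beta> i - (1 / real N) *\<^sub>R (\<Sum>j\<in>{1..N}. \<beta> j)) \<bullet> x)\<^sup>2)"
    and k: "k > 0" and small: "Cd * \<rho> \<le> 1" "(4 * Cd * \<rho>)\<^sup>2 \<le> k" and i: "i \<in> {1..N}"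
  shows "\<bar>alpha_hat N T y f i\<bar> \<le> (Ce + (Bb + 1) * (8 * (Bb + 1) * Ce / k)) * \<rho>"
proof -
  have C: "Cd \<ge> 0" "Ce \<ge> 0" using nonneg by (simp_all add: Cd_def Ce_def)
  have avg: "norm ((1 / real N) *\<^sub>R (\<Sum>j\<in>{1..N}. X j)) \<le> c" if "\<And>j. j \<in> {1..N} \<Longrightarrow> norm (X j) \<le> c" for X :: "nat \<Rightarrow> real^'k" and c
  proof -
    have "norm (\<Sum>j\<in>{1..N}. X j) \<le> real N * c" using sum_norm_bound[of "{1..N}" X c] that by simp
    then show ?thesis using N by (simp add: field_simps)
  qed
  have bh: "norm (\<beta>h i) \<le> Bb + 1" if "i \<in> {1..N}" for i
    using norm_triangle_ineq[of "\<beta> i" "\<delta> i"] \<beta>_bound[OF that] \<delta>_bound[OF that] small(1) by (simp add: \<delta>_def)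
  have avg_bh: "norm ((1 / real N) *\<^sub>R (\<Sum>j\<in>{1..N}. \<beta>h j)) \<le> Bb + 1" by (rule avg) (rule bh)
  have avg_\<delta>: "norm ((1 / real N) *\<^sub>R (\<Sum>j\<in>{1..N}. \<delta> j)) \<le> Cd * \<rho>" by (rule avg) (rule \<delta>_bound)
  have Dhb: "norm (Dh i) \<le> 2 * (Bb + 1)" if "i \<in> {1..N}" for i
    unfolding Dh_def mult_2 by (rule order_trans[OF norm_triangle_ineq4 add_mono[OF bh[OF that] avg_bh]])
  have Ax: "real N * (k / 4) * (norm x)\<^sup>2 \<le> x \<bullet> (A *v x)" for x
  proof -
    let ?D = "\<lambda>i. \<beta> i - (1 / real N) *\<^sub>R (\<Sum>j\<in>{1..N}. \<beta> j)"
    let ?d = "\<lambda>i. \<delta> i - (1 / real N) *\<^sub>R (\<Sum>j\<in>{1..N}. \<delta> j)"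
    have Dh: "Dh i = ?D i + ?d i" for i
    proof -
      have "\<beta>h j = \<beta> j + \<delta> j" for j by (simp add: \<delta>_def)
      then show ?thesis unfolding Dh_def by (simp add: sum.distrib scaleR_add_right)
    qed
    have "(\<Sum>i\<in>{1..N}. (?D i \<bullet> x)\<^sup>2 / 2 - (k / 4) * (norm x)\<^sup>2) \<le> (\<Sum>i\<in>{1..N}. (Dh i \<bullet> x)\<^sup>2)"
    proof (intro sum_mono)
      fix i assume i: "i \<in> {1..N}"
      have "norm (?d i) \<le> 2 * (Cd * \<rho>)"
        using norm_triangle_ineq4[of "\<delta> i" "(1 / real N) *\<^sub>R (\<Sum>j\<in>{1..N}. \<delta> j)"] \<delta>_bound[OF i] avg_\<delta> by linarith
      then have "\<bar>?d i \<bullet> x\<bar> \<le> (2 * (Cd * \<rho>)) * norm x"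
        using Cauchy_Schwarz_ineq2[of "?d i" x] mult_right_mono[of "norm (?d i)" "2 * (Cd * \<rho>)" "norm x"] by simp
      then have "(?d i \<bullet> x)\<^sup>2 \<le> ((2 * (Cd * \<rho>)) * norm x)\<^sup>2"
        by (rule square_le_of_abs_le)
      also have "\<dots> = (4 * Cd * \<rho>)\<^sup>2 / 4 * (norm x)\<^sup>2" by (simp add: power_mult_distrib)
      also have "\<dots> \<le> k / 4 * (norm x)\<^sup>2" using small(2) by (intro mult_right_mono) auto
      finally have d: "(?d i \<bullet> x)\<^sup>2 \<le> k / 4 * (norm x)\<^sup>2" .
      have sq: "a\<^sup>2 / 2 - b\<^sup>2 \<le> (a + b)\<^sup>2" for a b :: real
        using zero_le_power2[of "a + 2 * b"] by (simp add: power2_eq_square algebra_simps)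
      show "(?D i \<bullet> x)\<^sup>2 / 2 - (k / 4) * (norm x)\<^sup>2 \<le> (Dh i \<bullet> x)\<^sup>2"
        using sq[of "?D i \<bullet> x" "?d i \<bullet> x"] d unfolding Dh inner_add_left by linarith
    qed
    moreover have "(\<Sum>i\<in>{1..N}. (?D i \<bullet> x)\<^sup>2 / 2 - (k / 4) * (norm x)\<^sup>2) = (\<Sum>i\<in>{1..N}. (?D i \<bullet> x)\<^sup>2) / 2 - real N * ((k / 4) * (norm x)\<^sup>2)"
      by (simp add: sum_subtractf sum_divide_distrib)
    ultimately show ?thesis using S[of x] unfolding A_quad by (simp add: algebra_simps)
  qed
  have "invertible A"
  proof (rule coercive_imp_invertible)
    fix x :: "real^'k" assume "x \<noteq> 0"
    then have "0 < real N * (k / 4) * (norm x)\<^sup>2" using N k by simp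
    then show "0 < x \<bullet> (A *v x)" using Ax[of x] by linarith
  qed
  have "A *v lambda_hat N T y f = (\<Sum>i\<in>{1..N}. \<Sum>j\<in>{1..N}. (centering N i j * time_mean T (y j)) *\<^sub>R \<beta>h i)"
    unfolding lambda_hat_def A_def[symmetric] by (rule matrix_inv_solve(1)[OF \<open>invertible A\<close>])
  also have "\<dots> = (\<Sum>j\<in>{1..N}. time_mean T (y j) *\<^sub>R (\<Sum>i\<in>{1..N}. centering N i j *\<^sub>R \<beta>h i))"
    by (subst sum.swap) (simp add: scaleR_sum_right mult.commute)
  also have "\<dots> = (\<Sum>j\<in>{1..N}. (\<beta>h j \<bullet> lamT + e j) *\<^sub>R Dh j)"
    by (intro sum.cong refl) (simp only: centering_sum Dh_def y_mean' null add_0)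
  also have "\<dots> = A *v lamT + (\<Sum>j\<in>{1..N}. e j *\<^sub>R Dh j)"
    by (simp add: A_mult scaleR_add_left sum.distrib)
  finally have Ac: "A *v ch = (\<Sum>j\<in>{1..N}. e j *\<^sub>R Dh j)"
    by (simp add: ch_def matrix_vector_mult_diff_distrib)
  have ch: "norm ch \<le> 8 * (Bb + 1) * Ce / k * \<rho>"
  proof (cases "ch = 0")
    case True
    then show ?thesis using nonneg k C by simp
  next
    case False
    have "real N * (k / 4) * (norm ch)\<^sup>2 \<le> ch \<bullet> (A *v ch)" by (rule Ax)
    also have "\<dots> \<le> norm ch * norm (A *v ch)" by (rule norm_cauchy_schwarz)
    also have "\<dots> \<le> norm ch * (real N * (Ce * \<rho> * (2 * (Bb + 1))))"
    proof (rule mult_left_mono)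
      have "norm (e j *\<^sub>R Dh j) \<le> Ce * \<rho> * (2 * (Bb + 1))" if "j \<in> {1..N}" for j
        using mult_mono[OF e_bound[OF that] Dhb[OF that]] C nonneg by simp
      then show "norm (A *v ch) \<le> real N * (Ce * \<rho> * (2 * (Bb + 1)))"
        unfolding Ac using sum_norm_bound[of "{1..N}" "\<lambda>j. e j *\<^sub>R Dh j"] by simp
    qed simp
    finally have "(real N * norm ch) * (k / 4 * norm ch) \<le> (real N * norm ch) * (Ce * \<rho> * (2 * (Bb + 1)))"
      by (simp add: power2_eq_square mult_ac)
    then have "k / 4 * norm ch \<le> Ce * \<rho> * (2 * (Bb + 1))" using False N by (subst (asm) mult_le_cancel_left_pos) auto
    then show ?thesis using k by (simp add: field_simps)
  qed
  have "\<bar>alpha_hat N T y f i\<bar> \<le> \<bar>e i\<bar> + \<bar>\<beta>h i \<bullet> ch\<bar>" unfolding alpha_hat_eq[OF i] null[OF i] by simp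
  also have "\<bar>\<beta>h i \<bullet> ch\<bar> \<le> norm (\<beta>h i) * norm ch" by (rule Cauchy_Schwarz_ineq2)
  also have "\<dots> \<le> (Bb + 1) * (8 * (Bb + 1) * Ce / k * \<rho>)"
    using bh[OF i] ch nonneg by (intro mult_mono) auto
  finally show ?thesis using e_bound[OF i] by (simp add: algebra_simps)
qed

text \<open>The separation \<open>far\<close> holds for every c with a margin growing like 1 + |c|,
  so it applies to c = ch without any knowledge of \<open>lambda_hat\<close>. The errors use up at
  most a quarter of the margin.\<close>

lemma alpha_hat_alt:
  assumes \<eta>: "\<eta> > 0" and M: "M \<subseteq> {1..N}" and far: "\<And>c. \<exists>i\<in>M. \<eta> * (1 + norm c) \<le> \<bar>\<alpha> i - \<beta> i \<bullet> c\<bar>"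
    and small: "Ce * \<rho> \<le> \<eta> / 4" "Cd * \<rho> \<le> \<eta> / 4"
  shows "\<exists>i\<in>M. \<eta> / 2 * (1 + norm ch) \<le> \<bar>alpha_hat N T y f i\<bar>"
proof -
  obtain i where i: "i \<in> M" "\<eta> * (1 + norm ch) \<le> \<bar>\<alpha> i - \<beta> i \<bullet> ch\<bar>" using far by blast
  then have iN: "i \<in> {1..N}" using M by auto
  have "\<bar>\<delta> i \<bullet> ch\<bar> \<le> norm (\<delta> i) * norm ch" by (rule Cauchy_Schwarz_ineq2)
  also have "\<dots> \<le> \<eta> / 4 * norm ch" using \<delta>_bound[OF iN] small by (intro mult_right_mono) auto
  finally have 1: "\<bar>\<delta> i \<bullet> ch\<bar> \<le> \<eta> / 4 * norm ch" .
  have 2: "\<bar>e i\<bar> \<le> \<eta> / 4" using e_bound[OF iN] small by linarith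
  have "alpha_hat N T y f i = (\<alpha> i - \<beta> i \<bullet> ch) + e i - \<delta> i \<bullet> ch"
    unfolding alpha_hat_eq[OF iN] by (simp add: \<delta>_def inner_diff_left)
  moreover have "0 \<le> \<eta> * norm ch" using \<eta> by simp
  ultimately have "\<eta> / 2 * (1 + norm ch) \<le> \<bar>alpha_hat N T y f i\<bar>"
    using 1 2 i(2) \<eta> by (simp add: algebra_simps)
  then show ?thesis using i(1) by blast
qed

end

section \<open>Compactness: coercivity and separation from the null\<close>

lemma pos_def_lower_bound:
  fixes A :: "real^'k^'k"
  assumes "pos_def A"
  obtains c where "c > 0" "\<And>x. c * (norm x)\<^sup>2 \<le> x \<bullet> (A *v x)"
proof -
  let ?S = "sphere (0 :: real^'k) 1"
  have cont: "continuous_on ?S (\<lambda>x. x \<bullet> (A *v x))"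
    by (intro continuous_intros linear_continuous_on_compose[OF continuous_on_id] matrix_vector_mul_linear)
  have ne: "?S \<noteq> {}"
    using norm_axis_1[of "undefined :: 'k"] by (auto intro: exI[of _ "axis undefined 1"] simp: sphere_def)
  obtain x0 where x0: "x0 \<in> ?S" "\<And>x. x \<in> ?S \<Longrightarrow> x0 \<bullet> (A *v x0) \<le> x \<bullet> (A *v x)"
    using continuous_attains_inf[OF compact_sphere ne cont] by blast
  let ?c = "x0 \<bullet> (A *v x0)"
  have "x0 \<noteq> 0" using x0(1) by auto
  then have c: "?c > 0" using assms by (auto simp: pos_def_def)
  have "?c * (norm x)\<^sup>2 \<le> x \<bullet> (A *v x)" for x
  proof (cases "x = 0")
    case False
    let ?x = "(1 / norm x) *\<^sub>R x"
    have "?c \<le> ?x \<bullet> (A *v ?x)" using False by (intro x0) auto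
    also have "\<dots> = x \<bullet> (A *v x) / (norm x)\<^sup>2"
      by (simp add: matrix_vector_mult_scaleR power2_eq_square)
    finally show ?thesis using False by (simp add: field_simps)
  qed simp
  then show thesis using that c by blast
qed

lemma S_beta_quad:
  "x \<bullet> (S_beta \<beta> N *v x) = (\<Sum>i\<in>{1..N}. ((\<beta> i - (1 / real N) *\<^sub>R (\<Sum>j\<in>{1..N}. \<beta> j)) \<bullet> x)\<^sup>2) / real N"
  unfolding S_beta_def Let_def scaleR_matrix_vector_assoc[symmetric] sum_matrix_vector_mult outer_mult_vector
  by (simp add: inner_sum_right power2_eq_square inner_commute)

text \<open>If some c0 fits the first n assets, spanning slopes make it unique there, and one asset
  that c0 does not fit completes a finite set that no c fits. Compactness then gives a margin;
  spanning enters once more to keep it proportional to |c| for large c.\<close>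

lemma alternative_margin:
  fixes \<alpha> :: "nat \<Rightarrow> real" and \<beta> :: "nat \<Rightarrow> real^'k"
  assumes alt: "\<And>c. \<exists>i\<ge>1. \<alpha> i \<noteq> \<beta> i \<bullet> c"
    and span: "\<And>x. (\<And>i. i \<in> {1..n} \<Longrightarrow> \<beta> i \<bullet> x = 0) \<Longrightarrow> x = 0"
  obtains \<eta> m where "\<eta> > 0" "\<And>c. \<exists>i\<in>{1..m}. \<eta> * (1 + norm c) \<le> \<bar>\<alpha> i - \<beta> i \<bullet> c\<bar>"
proof -
  have "\<exists>m\<ge>n. \<forall>c. \<exists>i\<in>{1..m}. \<alpha> i \<noteq> \<beta> i \<bullet> c"
  proof (cases "\<exists>c0. \<forall>i\<in>{1..n}. \<alpha> i = \<beta> i \<bullet> c0")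
    case False
    then show ?thesis by auto
  next
    case True
    then obtain c0 where c0: "\<And>i. i \<in> {1..n} \<Longrightarrow> \<alpha> i = \<beta> i \<bullet> c0" by auto
    obtain i0 where i0: "i0 \<ge> 1" "\<alpha> i0 \<noteq> \<beta> i0 \<bullet> c0" using alt by blast
    have "\<exists>i\<in>{1..max n i0}. \<alpha> i \<noteq> \<beta> i \<bullet> c" for c
    proof (rule ccontr)
      assume "\<not> ?thesis"
      then have eq: "\<And>i. i \<in> {1..max n i0} \<Longrightarrow> \<alpha> i = \<beta> i \<bullet> c" by blast
      have "\<beta> i \<bullet> (c0 - c) = 0" if "i \<in> {1..n}" for i
        using c0[OF that] eq[of i] that by (auto simp: inner_diff_right)
      then have "c0 - c = 0" by (rule span)
      then show False using eq[of i0] i0 by auto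
    qed
    then show ?thesis by (intro exI[of _ "max n i0"]) auto
  qed
  then obtain m where m: "m \<ge> n" and sep: "\<And>c. \<exists>i\<in>{1..m}. \<alpha> i \<noteq> \<beta> i \<bullet> c" by blast
  txt \<open>Homogenized in the pair p = (s, c), so that one minimum over the unit sphere serves all c.\<close>
  let ?g = "\<lambda>p :: real \<times> (real^'k). \<Sum>i\<in>{1..m}. \<bar>\<alpha> i * fst p - \<beta> i \<bullet> snd p\<bar>"
  let ?S = "sphere (0 :: real \<times> (real^'k)) 1"
  have cont: "continuous_on ?S ?g" by (intro continuous_intros)
  have "(1, 0) \<in> ?S" by (simp add: norm_Pair)
  then have ne: "?S \<noteq> {}" by blast
  obtain p0 where p0: "p0 \<in> ?S" "\<And>p. p \<in> ?S \<Longrightarrow> ?g p0 \<le> ?g p"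
    using continuous_attains_inf[OF compact_sphere ne cont] by blast
  have pos: "?g p0 > 0"
  proof (rule ccontr)
    assume "\<not> ?thesis"
    then have "?g p0 = 0" using sum_nonneg[of "{1..m}" "\<lambda>i. \<bar>\<alpha> i * fst p0 - \<beta> i \<bullet> snd p0\<bar>"] by linarith
    then have z: "\<And>i. i \<in> {1..m} \<Longrightarrow> \<alpha> i * fst p0 = \<beta> i \<bullet> snd p0"
      by (subst (asm) sum_nonneg_eq_0_iff) auto
    show False
    \<comment> \<open>A vanishing first coordinate represents c at infinity, where \<alpha> drops
      out and spanning decides.\<close>
    proof (cases "fst p0 = 0")
      case True
      then have "snd p0 = 0" using z m by (intro span) auto
      then show False using p0(1) True by (cases p0) auto
    next
      case False
      then have "\<alpha> i = \<beta> i \<bullet> ((1 / fst p0) *\<^sub>R snd p0)" if "i \<in> {1..m}" for i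
        using z[OF that] by (simp add: field_simps)
      then show False using sep by blast
    qed
  qed
  have m1: "m \<ge> 1" using sep[of 0] by auto
  \<comment> \<open>The m comes from bounding the sum by m times its largest term, the 2 from the
    norm of (1, c) being at least (1 + |c|)/2.\<close>
  define \<eta> where "\<eta> = ?g p0 / (2 * real m)"
  have "\<exists>i\<in>{1..m}. \<eta> * (1 + norm c) \<le> \<bar>\<alpha> i - \<beta> i \<bullet> c\<bar>" for c
  proof (rule ccontr)
    assume "\<not> ?thesis"
    then have less: "\<And>i. i \<in> {1..m} \<Longrightarrow> \<bar>\<alpha> i - \<beta> i \<bullet> c\<bar> < \<eta> * (1 + norm c)" by force
    let ?n = "norm (1::real, c)"
    have n0: "?n > 0" by (simp add: norm_Pair add_pos_nonneg)
    have "?g p0 \<le> ?g ((1 / ?n) *\<^sub>R (1, c))" using n0 by (intro p0) (auto simp del: scaleR_Pair)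
    also have "\<dots> = (\<Sum>i\<in>{1..m}. \<bar>\<alpha> i - \<beta> i \<bullet> c\<bar>) / ?n"
      using n0 by (simp add: sum_divide_distrib abs_divide flip: diff_divide_distrib)
    finally have "?g p0 * ?n \<le> (\<Sum>i\<in>{1..m}. \<bar>\<alpha> i - \<beta> i \<bullet> c\<bar>)" using n0 by (simp add: field_simps)
    also have "\<dots> < (\<Sum>i\<in>{1..m}. \<eta> * (1 + norm c))" using less m1 by (intro sum_strict_mono) auto
    also have "\<dots> = ?g p0 * ((1 + norm c) / 2)" using m1 by (simp add: \<eta>_def)
    finally have "?n < (1 + norm c) / 2" using pos by (subst (asm) mult_less_cancel_left_pos) auto
    moreover have "1 \<le> ?n" "norm c \<le> ?n" using norm_fst_le[of "1::real" c] norm_snd_le[of c "1::real"] by auto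
    moreover have "\<not> b < (1 + a) / 2" if "1 \<le> b" "a \<le> b" for a b :: real
      using that by (simp add: not_less)
    ultimately show False by blast
  qed
  moreover have "\<eta> > 0" using pos m1 by (simp add: \<eta>_def)
  ultimately show thesis using that by blast
qed

section \<open>Limits along the panel\<close>

lemma panel_limit_facts:
  shows "filterlim (\<lambda>(N, T). N) at_top (panel_limit C r)" "filterlim (\<lambda>(N, T). T) at_top (panel_limit C r)"
    "\<forall>\<^sub>F (N, T) in panel_limit C r. real N \<le> C * real T powr r"
proof -
  have m: "filterlim (\<lambda>(N, T). min N T) at_top (panel_limit C r)"
    unfolding panel_limit_def by (rule filterlim_mono[OF filterlim_filtercomap order_refl inf_le1])
  show "filterlim (\<lambda>(N, T). N) at_top (panel_limit C r)"
    by (rule filterlim_at_top_mono[OF m]) (auto intro!: always_eventually)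
  show "filterlim (\<lambda>(N, T). T) at_top (panel_limit C r)"
    by (rule filterlim_at_top_mono[OF m]) (auto intro!: always_eventually)
  have "\<forall>\<^sub>F (N, T) in principal {(N, T). real N \<le> C * real T powr r}. real N \<le> C * real T powr r"
    by (simp add: eventually_principal)
  then show "\<forall>\<^sub>F (N, T) in panel_limit C r. real N \<le> C * real T powr r"
    unfolding panel_limit_def by (rule filter_leD[OF inf_le2])
qed

lemma eventually_panel_limit_T:
  assumes "eventually P sequentially" shows "\<forall>\<^sub>F (N, T) in panel_limit C r. P T"
  using filterlim_iff[THEN iffD1, OF panel_limit_facts(2)] assms by (auto simp: case_prod_beta')

lemma eventually_panel_limit_N:
  assumes "eventually P sequentially" shows "\<forall>\<^sub>F (N, T) in panel_limit C r. P N"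
  using filterlim_iff[THEN iffD1, OF panel_limit_facts(1)] assms by (auto simp: case_prod_beta')

text \<open>For r <= 0 the growth bound keeps N from tending to infinity; every limit along the
  trivial filter holds vacuously, which settles the theorem for large \<epsilon>.\<close>

lemma panel_limit_bot:
  assumes "r \<le> 0" shows "panel_limit C r = bot"
proof -
  have "\<forall>\<^sub>F (N, T) in panel_limit C r. False"
    using panel_limit_facts(3)[of C r] eventually_panel_limit_T[OF eventually_ge_at_top[of 1], of C r]
      eventually_panel_limit_N[OF eventually_gt_at_top[of "nat \<lceil>\<bar>C\<bar>\<rceil>"], of C r]
  proof eventually_elim
    case (elim p)
    obtain N T where p: "p = (N, T)" by (cases p)
    have "real T powr r \<le> real T powr 0" using elim assms unfolding p by (intro powr_mono) auto
    then have "\<bar>C\<bar> * real T powr r \<le> \<bar>C\<bar> * 1" using elim unfolding p by (intro mult_left_mono) auto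
    moreover have "C * real T powr r \<le> \<bar>C\<bar> * real T powr r" by (intro mult_right_mono) auto
    ultimately have "real N \<le> \<bar>C\<bar>" using elim unfolding p by auto
    moreover have "\<bar>C\<bar> < real N" using elim unfolding p by (auto simp: nat_less_iff ceiling_less_iff)
    ultimately show ?case by simp
  qed
  then show ?thesis by (simp add: trivial_limit_def case_prod_beta')
qed

text \<open>\<open>\<bar>C\<bar> + 1\<close> instead of \<open>C\<close> keeps the argument of the
  logarithm positive for every real \<open>C\<close>.\<close>

lemma panel_limit_ln_le:
  "\<forall>\<^sub>F (N, T) in panel_limit C r. ln (real N) \<le> ln (\<bar>C\<bar> + 1) + r * ln (real T)"
  using panel_limit_facts(3)[of C r] eventually_panel_limit_T[OF eventually_ge_at_top[of 1], of C r]
    eventually_panel_limit_N[OF eventually_ge_at_top[of 1], of C r]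
proof eventually_elim
  case (elim p)
  obtain N T where p: "p = (N, T)" by (cases p)
  have "C * real T powr r \<le> (\<bar>C\<bar> + 1) * real T powr r" by (rule mult_right_mono) auto
  with elim have "real N \<le> (\<bar>C\<bar> + 1) * real T powr r" unfolding p by (auto intro: order_trans)
  then have "ln (real N) \<le> ln ((\<bar>C\<bar> + 1) * real T powr r)" using elim unfolding p by (subst ln_le_cancel_iff) auto
  also have "\<dots> = ln (\<bar>C\<bar> + 1) + r * ln (real T)" using elim unfolding p by (subst ln_mult) (auto simp: ln_powr)
  finally show ?case unfolding p by simp
qed

text \<open>Crude but sufficient: \<open>a_norm\<close> is of order 1/sqrt (ln N) and
  \<open>b_norm\<close> of order sqrt (ln N), and any power of ln N is negligible against a power of
  T.\<close>

lemma norming_bounds: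
  "\<forall>\<^sub>F N in sequentially. a_norm N > 0" "\<forall>\<^sub>F N in sequentially. 1 / ln (real N) \<le> a_norm N"
  "\<forall>\<^sub>F N in sequentially. b_norm N + a_norm N * x \<le> ln (real N)" "\<forall>\<^sub>F N in sequentially. ln (real N) > 0"
proof -
  show l0: "\<forall>\<^sub>F N in sequentially. ln (real N) > 0" by real_asymp
  have b: "\<forall>\<^sub>F N in sequentially. b_norm N > 0"
    using filterlim_at_top_dense[THEN iffD1, OF b_norm_at_top] by auto
  then show "\<forall>\<^sub>F N in sequentially. a_norm N > 0"
    by eventually_elim (auto simp: a_norm_def intro!: divide_pos_pos add_pos_nonneg)
  have b1: "\<forall>\<^sub>F N in sequentially. b_norm N \<ge> 1"
    using filterlim_at_top[THEN iffD1, OF b_norm_at_top] by auto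
  have bl: "\<forall>\<^sub>F N in sequentially. 2 * b_norm N \<le> ln (real N)"
    unfolding b_norm_def by real_asymp
  show "\<forall>\<^sub>F N in sequentially. 1 / ln (real N) \<le> a_norm N"
    using l0 b1 bl
  proof eventually_elim
    case (elim N)
    let ?b = "b_norm N"
    have "1 / ln (real N) \<le> 1 / (2 * ?b)" using elim by (intro divide_left_mono) auto
    also have "\<dots> \<le> ?b / (1 + ?b\<^sup>2)"
    proof -
      have "1 \<le> ?b\<^sup>2" using elim by simp
      then show ?thesis using elim by (simp add: divide_simps power2_eq_square add_pos_nonneg)
    qed
    finally show ?case by (simp add: a_norm_def)
  qed
  have z: "((\<lambda>b::real. b / (1 + b\<^sup>2) * x) \<longlongrightarrow> 0) at_top" by real_asymp
  have "(\<lambda>N. a_norm N * x) \<longlonglongrightarrow> 0"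
    using filterlim_compose[OF z b_norm_at_top] by (simp add: a_norm_def)
  then have a1: "\<forall>\<^sub>F N in sequentially. a_norm N * x < 1" by (rule order_tendstoD) simp
  have "\<forall>\<^sub>F N in sequentially. b_norm N + 1 \<le> ln (real N)"
    unfolding b_norm_def by real_asymp
  with a1 show "\<forall>\<^sub>F N in sequentially. b_norm N + a_norm N * x \<le> ln (real N)"
    by eventually_elim auto
qed

text \<open>Dropping the nonnegative \<psi> gives the upper estimate. For the lower one, \<psi> is
  eventually at most \<eta> a_N because T^(-s) ln N tends to 0, and this amounts to replacing x by x
  - \<eta>; continuity in x allows \<eta> to be arbitrarily small.\<close>

lemma normal_product_tendsto_gumbel:
  fixes \<psi> :: "nat \<Rightarrow> nat \<Rightarrow> nat \<Rightarrow> real"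
  assumes \<psi>: "\<forall>\<^sub>F (N, T) in panel_limit C r. \<forall>i\<in>{1..N}. 0 \<le> \<psi> N T i \<and> \<psi> N T i \<le> K * real T powr - s"
    and s: "s > 0"
  shows "((\<lambda>(N, T). \<Prod>i\<in>{1..N}. std_normal_cdf (b_norm N + a_norm N * x - \<psi> N T i))
      \<longlongrightarrow> exp (- exp (- x))) (panel_limit C r)"
proof (rule order_tendstoI)
  fix l assume "exp (- exp (- x)) < l"
  then have "\<forall>\<^sub>F (N, T) in panel_limit C r. std_normal_cdf (b_norm N + a_norm N * x) ^ N < l"
    by (intro eventually_panel_limit_N order_tendstoD(2)[OF gumbel_limit])
  then show "\<forall>\<^sub>F p in panel_limit C r. (\<lambda>(N, T). \<Prod>i\<in>{1..N}. std_normal_cdf (b_norm N + a_norm N * x - \<psi> N T i)) p < l"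
    using \<psi>
  proof eventually_elim
    case (elim p)
    obtain N T where p: "p = (N, T)" by (cases p)
    have "(\<Prod>i\<in>{1..N}. std_normal_cdf (b_norm N + a_norm N * x - \<psi> N T i)) \<le> (\<Prod>i\<in>{1..N}. std_normal_cdf (b_norm N + a_norm N * x))"
      using elim unfolding p by (intro prod_mono) (auto intro!: std_normal_cdf_bounds std_normal_cdf_mono)
    then show ?case using elim unfolding p by simp
  qed
next
  fix l assume l: "l < exp (- exp (- x))"
  have "((\<lambda>\<eta>. exp (- exp (- (x - \<eta>)))) \<longlongrightarrow> exp (- exp (- (x - 0)))) (at_right 0)"
    by (intro tendsto_intros)
  then have "\<forall>\<^sub>F \<eta> in at_right 0. l < exp (- exp (- (x - \<eta>)))" using l by (intro order_tendstoD(1)) auto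
  then have "\<forall>\<^sub>F \<eta> in at_right 0. l < exp (- exp (- (x - \<eta>))) \<and> \<eta> > 0"
    using eventually_at_right_less by (rule eventually_conj)
  then obtain \<eta> where \<eta>: "\<eta> > 0" "l < exp (- exp (- (x - \<eta>)))"
    using eventually_happens'[OF trivial_limit_at_right_real] by blast
  have "(\<lambda>T. K * real T powr - s * (ln (\<bar>C\<bar> + 1) + r * ln (real T))) \<longlonglongrightarrow> 0"
    using s by real_asymp
  then have "\<forall>\<^sub>F T in sequentially. K * real T powr - s * (ln (\<bar>C\<bar> + 1) + r * ln (real T)) < \<eta>"
    using \<eta>(1) by (rule order_tendstoD)
  note evT = eventually_panel_limit_T[OF this, of C r]
  have ev: "\<forall>\<^sub>F (N, T) in panel_limit C r. l < std_normal_cdf (b_norm N + a_norm N * (x - \<eta>)) ^ N"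
    using \<eta>(2) by (intro eventually_panel_limit_N order_tendstoD(1)[OF gumbel_limit])
  show "\<forall>\<^sub>F p in panel_limit C r. l < (\<lambda>(N, T). \<Prod>i\<in>{1..N}. std_normal_cdf (b_norm N + a_norm N * x - \<psi> N T i)) p"
    using ev \<psi> evT panel_limit_ln_le[of C r] eventually_panel_limit_N[OF norming_bounds(2), of C r] eventually_panel_limit_N[OF norming_bounds(4), of C r]
  proof eventually_elim
    case (elim p)
    obtain N T where p: "p = (N, T)" by (cases p)
    have le: "b_norm N + a_norm N * (x - \<eta>) \<le> b_norm N + a_norm N * x - \<psi> N T i" if i: "i \<in> {1..N}" for i
    proof -
      have K: "0 \<le> K * real T powr - s" using elim(2) i unfolding p by fastforce
      have "\<psi> N T i * ln (real N) \<le> K * real T powr - s * ln (real N)"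
        using elim i unfolding p by (intro mult_right_mono) auto
      also have "\<dots> \<le> K * real T powr - s * (ln (\<bar>C\<bar> + 1) + r * ln (real T))"
        using elim K unfolding p by (intro mult_left_mono) auto
      also have "\<dots> < \<eta>" using elim unfolding p by simp
      finally have "\<psi> N T i \<le> \<eta> * (1 / ln (real N))" using elim unfolding p by (simp add: pos_le_divide_eq)
      also have "\<dots> \<le> \<eta> * a_norm N" using elim \<eta>(1) unfolding p by (intro mult_left_mono) auto
      finally show ?thesis by (simp add: algebra_simps)
    qed
    have "(\<Prod>i\<in>{1..N}. std_normal_cdf (b_norm N + a_norm N * (x - \<eta>))) \<le> (\<Prod>i\<in>{1..N}. std_normal_cdf (b_norm N + a_norm N * x - \<psi> N T i))"
      using le by (intro prod_mono) (auto intro!: std_normal_cdf_bounds std_normal_cdf_mono)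
    then show ?case using elim unfolding p by simp
  qed
qed

text \<open>Without \<psi> the thresholds are at most ln N, hence logarithmic in T, and a power of T
  drives one of them to minus infinity; the other factors are at most 1.\<close>

lemma normal_product_tendsto_0:
  fixes \<psi> :: "nat \<Rightarrow> nat \<Rightarrow> nat \<Rightarrow> real"
  assumes \<psi>: "\<forall>\<^sub>F (N, T) in panel_limit C r. \<exists>i\<in>{1..N}. c * real T powr s \<le> \<psi> N T i"
    and c: "c > 0" and s: "s > 0"
  shows "((\<lambda>(N, T). \<Prod>i\<in>{1..N}. std_normal_cdf (b_norm N + a_norm N * x - \<psi> N T i)) \<longlongrightarrow> 0) (panel_limit C r)"
proof -
  have "filterlim (\<lambda>T. ln (\<bar>C\<bar> + 1) + r * ln (real T) - c * real T powr s) at_bot sequentially"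
    using c s by real_asymp
  from filterlim_compose[OF std_normal_cdf_at_bot filterlim_compose[OF this panel_limit_facts(2)[of C r]]]
  have lim: "((\<lambda>(N, T). std_normal_cdf (ln (\<bar>C\<bar> + 1) + r * ln (real T) - c * real T powr s)) \<longlongrightarrow> 0) (panel_limit C r)"
    by (simp add: case_prod_beta')
  show ?thesis
  proof (rule tendsto_sandwich[OF _ _ tendsto_const lim])
    show "\<forall>\<^sub>F p in panel_limit C r. 0 \<le> (\<lambda>(N, T). \<Prod>i\<in>{1..N}. std_normal_cdf (b_norm N + a_norm N * x - \<psi> N T i)) p"
      by (auto intro!: always_eventually prod_nonneg std_normal_cdf_bounds)
    show "\<forall>\<^sub>F p in panel_limit C r. (\<lambda>(N, T). \<Prod>i\<in>{1..N}. std_normal_cdf (b_norm N + a_norm N * x - \<psi> N T i)) p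
        \<le> (\<lambda>(N, T). std_normal_cdf (ln (\<bar>C\<bar> + 1) + r * ln (real T) - c * real T powr s)) p"
      using \<psi> panel_limit_ln_le[of C r] eventually_panel_limit_N[OF norming_bounds(3)[of x], of C r]
    proof eventually_elim
      case (elim p)
      obtain N T where p: "p = (N, T)" by (cases p)
      obtain j where j: "j \<in> {1..N}" "c * real T powr s \<le> \<psi> N T j" using elim unfolding p by auto
      let ?g = "\<lambda>i. std_normal_cdf (b_norm N + a_norm N * x - \<psi> N T i)"
      have "(\<Prod>i\<in>{1..N}. ?g i) = ?g j * (\<Prod>i\<in>{1..N} - {j}. ?g i)" using j by (intro prod.remove) auto
      also have "\<dots> \<le> ?g j * 1"
        by (intro mult_left_mono prod_le_1 std_normal_cdf_bounds conjI)
      also have "\<dots> \<le> std_normal_cdf (ln (\<bar>C\<bar> + 1) + r * ln (real T) - c * real T powr s)"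
        using j elim unfolding p by (auto intro!: std_normal_cdf_mono)
      finally show ?case unfolding p by simp
    qed
  qed
qed

text \<open>The properties of a single path from which the limits follow. The rate T^(-1/\<nu> -
  \<theta>) is dictated by the factor T^(1/\<nu>) in \<open>psi\<close>. In \<open>u4\<close> the
  mean square may grow like T^(1/\<nu>): then \<open>s_hat\<close> picks up only T^(1/(2\<nu>)),
  which the alternative can afford.\<close>

locale regular_path =
  fixes y u :: "nat \<Rightarrow> int \<Rightarrow> real" and f :: "int \<Rightarrow> real^'k"
    and \<alpha> :: "nat \<Rightarrow> real" and \<beta> :: "nat \<Rightarrow> real^'k" and lam \<mu> :: "real^'k"
    and m :: "'k \<Rightarrow> 'k \<Rightarrow> real" and C r \<nu> \<theta> W W' m1 k Bb :: real
  assumes nu: "\<nu> \<ge> 4" and \<theta>: "\<theta> > 0" and W: "W \<ge> 0" "W' \<ge> 0" and m1: "m1 > 0" and k: "k > 0"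
    and y: "\<And>i t. i \<ge> 1 \<Longrightarrow> t \<ge> 1 \<Longrightarrow> y i t = \<alpha> i + \<beta> i \<bullet> lam + \<beta> i \<bullet> (f t - \<mu>) + u i t"
    and u1: "\<And>i T. i \<ge> 1 \<Longrightarrow> T \<ge> 1 \<Longrightarrow> real i \<le> C * real T powr r \<Longrightarrow>
       \<bar>time_mean T (u i)\<bar> \<le> W * real T powr (- (1 / \<nu> + \<theta>))"
    and u2: "\<And>i T. i \<ge> 1 \<Longrightarrow> T \<ge> 1 \<Longrightarrow> real i \<le> C * real T powr r \<Longrightarrow>
       norm (time_mean T (\<lambda>t. u i t *\<^sub>R f t)) \<le> W * real T powr (- (1 / \<nu> + \<theta>))"
    and u3: "\<And>i T. i \<ge> 1 \<Longrightarrow> T \<ge> 1 \<Longrightarrow> real i \<le> C * real T powr r \<Longrightarrow>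
       m1 - W * real T powr (- (1 / \<nu> + \<theta>)) \<le> time_mean T (\<lambda>t. \<bar>u i t\<bar>)"
    and u4: "\<forall>\<^sub>F (N, T) in panel_limit C r.
       (\<Sum>i\<in>{1..N}. \<Sum>t\<in>{1..int T}. (u i t)\<^sup>2) \<le> W' * real T powr (1 / \<nu>) * (real N * real T)"
    and f1: "(\<lambda>T. time_mean T f) \<longlonglongrightarrow> \<mu>"
    and f2: "\<And>a b. (\<lambda>T. time_mean T (\<lambda>t. f t $ a * f t $ b)) \<longlonglongrightarrow> m a b"
    and cov: "pos_def (\<chi> a b. m a b - \<mu> $ a * \<mu> $ b)"
    and \<beta>_bound: "\<And>i. i \<ge> 1 \<Longrightarrow> norm (\<beta> i) \<le> Bb"
    and S: "\<forall>\<^sub>F N in sequentially. \<forall>x. k * (norm x)\<^sup>2 * real N \<le> (\<Sum>i\<in>{1..N}. ((\<beta> i - (1 / real N) *\<^sub>R (\<Sum>j\<in>{1..N}. \<beta> j)) \<bullet> x)\<^sup>2)"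
begin

abbreviation "\<rho> T \<equiv> W * real T powr (- (1 / \<nu> + \<theta>))"

lemma \<rho>_small: assumes "c > 0" shows "\<forall>\<^sub>F (N, T) in panel_limit C r. \<rho> T < c"
proof -
  have "1 / \<nu> + \<theta> > 0" using nu \<theta> by (intro add_pos_pos) auto
  then have "(\<lambda>T. W * real T powr (- (1 / \<nu> + \<theta>))) \<longlonglongrightarrow> W * 0"
    by (intro tendsto_mult tendsto_const tendsto_neg_powr filterlim_real_sequentially) auto
  then show ?thesis using assms by (intro eventually_panel_limit_T order_tendstoD(2)) auto
qed

lemma \<rho>_small': assumes "c > 0" "d \<ge> 0" shows "\<forall>\<^sub>F (N, T) in panel_limit C r. d * \<rho> T \<le> c"
proof -
  have "c / (d + 1) > 0" using assms by auto
  from \<rho>_small[OF this] show ?thesis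
  proof eventually_elim
    case (elim p)
    obtain N T where p: "p = (N, T)" by (cases p)
    have "(d + 1) * \<rho> T \<le> c" using elim assms unfolding p by (simp add: field_simps)
    moreover have "0 \<le> \<rho> T" using W by simp
    ultimately show ?case unfolding p by (simp add: algebra_simps)
  qed
qed

lemma quad_form_diff_le:
  fixes A B :: "real^'k^'k"
  shows "\<bar>x \<bullet> (A *v x) - x \<bullet> (B *v x)\<bar> \<le> (\<Sum>a\<in>UNIV. \<Sum>b\<in>UNIV. \<bar>A $ a $ b - B $ a $ b\<bar>) * (norm x)\<^sup>2"
proof -
  have "x \<bullet> (A *v x) - x \<bullet> (B *v x) = (\<Sum>a\<in>UNIV. \<Sum>b\<in>UNIV. (A $ a $ b - B $ a $ b) * (x $ a * x $ b))"
    by (simp add: inner_vec_def matrix_vector_mult_def sum_distrib_left sum_subtractf[symmetric] algebra_simps)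
  also have "\<bar>\<dots>\<bar> \<le> (\<Sum>a\<in>UNIV. \<Sum>b\<in>UNIV. \<bar>(A $ a $ b - B $ a $ b) * (x $ a * x $ b)\<bar>)"
    by (intro order_trans[OF sum_abs] sum_mono sum_abs)
  also have "\<dots> \<le> (\<Sum>a\<in>UNIV. \<Sum>b\<in>UNIV. \<bar>A $ a $ b - B $ a $ b\<bar> * (norm x)\<^sup>2)"
  proof (intro sum_mono)
    fix a b
    have "\<bar>x $ a * x $ b\<bar> \<le> (norm x)\<^sup>2"
      unfolding abs_mult power2_eq_square by (intro mult_mono component_le_norm_cart) auto
    then show "\<bar>(A $ a $ b - B $ a $ b) * (x $ a * x $ b)\<bar> \<le> \<bar>A $ a $ b - B $ a $ b\<bar> * (norm x)\<^sup>2"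
      unfolding abs_mult[of "A $ a $ b - B $ a $ b"] by (intro mult_left_mono) auto
  qed
  finally show ?thesis by (simp add: sum_distrib_right)
qed

definition "G T = (\<chi> a b. time_mean T (\<lambda>t. f t $ a * f t $ b) - time_mean T f $ a * time_mean T f $ b)"

lemma G_quad: assumes "T \<ge> 1"
  shows "time_mean T (\<lambda>t. ((f t - time_mean T f) \<bullet> x)\<^sup>2) = x \<bullet> (G T *v x)"
proof -
  let ?fb = "time_mean T f"
  have nth: "time_mean T (\<lambda>t. f t $ a) = ?fb $ a" for a
    by (simp add: time_mean_def)
  have "time_mean T (\<lambda>t. ((f t - ?fb) \<bullet> x)\<^sup>2) = time_mean T (\<lambda>t. \<Sum>a\<in>UNIV. \<Sum>b\<in>UNIV. (x $ a * x $ b) * ((f t $ a - ?fb $ a) * (f t $ b - ?fb $ b)))"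
    by (intro time_mean_cong) (simp add: inner_vec_def power2_eq_square sum_product mult_ac)
  also have "\<dots> = (\<Sum>a\<in>UNIV. \<Sum>b\<in>UNIV. (x $ a * x $ b) * time_mean T (\<lambda>t. (f t $ a - ?fb $ a) * (f t $ b - ?fb $ b)))"
    by (simp add: time_mean_sum time_mean_cmult)
  also have "\<dots> = (\<Sum>a\<in>UNIV. \<Sum>b\<in>UNIV. (x $ a * x $ b) * G T $ a $ b)"
  proof (intro sum.cong refl arg_cong2[where f = "(*)"])
    fix a b
    have "time_mean T (\<lambda>t. (f t $ a - ?fb $ a) * (f t $ b - ?fb $ b)) = time_mean T (\<lambda>t. f t $ a * f t $ b - ?fb $ a * f t $ b - ?fb $ b * f t $ a + ?fb $ a * ?fb $ b)"
      by (intro time_mean_cong) (simp add: algebra_simps)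
    also have "\<dots> = G T $ a $ b" using assms
      by (simp add: G_def time_mean_add time_mean_diff time_mean_cmult time_mean_const nth)
    finally show "time_mean T (\<lambda>t. (f t $ a - ?fb $ a) * (f t $ b - ?fb $ b)) = G T $ a $ b" .
  qed
  also have "\<dots> = x \<bullet> (G T *v x)"
    by (simp add: inner_vec_def matrix_vector_mult_def sum_distrib_left mult_ac)
  finally show ?thesis .
qed

lemma G_lim: "(\<lambda>T. G T $ a $ b) \<longlonglongrightarrow> m a b - \<mu> $ a * \<mu> $ b"
  unfolding G_def vec_lambda_beta by (intro tendsto_intros f2 f1)

text \<open>Entrywise convergence of the sample covariance to a positive definite limit preserves
  half of the coercivity constant, uniformly in x. The mean squared deviation is the trace and
  converges too.\<close>

lemma factor_bounds:
  obtains \<kappa> Bf where "\<kappa> > 0" "Bf \<ge> 0"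
    "\<forall>\<^sub>F T in sequentially. (\<forall>x. \<kappa> * (norm x)\<^sup>2 \<le> time_mean T (\<lambda>t. ((f t - time_mean T f) \<bullet> x)\<^sup>2)) \<and>
       norm (time_mean T f) \<le> Bf \<and> time_mean T (\<lambda>t. (norm (f t - time_mean T f))\<^sup>2) \<le> Bf\<^sup>2"
proof -
  let ?S = "(\<chi> a b. m a b - \<mu> $ a * \<mu> $ b) :: real^'k^'k"
  obtain c where c: "c > 0" "\<And>x. c * (norm x)\<^sup>2 \<le> x \<bullet> (?S *v x)" using pos_def_lower_bound[OF cov] by blast
  have "(\<lambda>T. \<Sum>a\<in>UNIV. \<Sum>b\<in>UNIV. \<bar>G T $ a $ b - ?S $ a $ b\<bar>) \<longlonglongrightarrow> (\<Sum>a\<in>(UNIV::'k set). \<Sum>b\<in>(UNIV::'k set). \<bar>(m a b - \<mu> $ a * \<mu> $ b) - ?S $ a $ b\<bar>)"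
    by (intro tendsto_intros G_lim)
  then have d: "\<forall>\<^sub>F T in sequentially. (\<Sum>a\<in>UNIV. \<Sum>b\<in>UNIV. \<bar>G T $ a $ b - ?S $ a $ b\<bar>) < c / 2"
    using c(1) by (intro order_tendstoD(2)[of _ 0]) auto
  define tr where "tr = (\<Sum>a\<in>UNIV. m a a - \<mu> $ a * \<mu> $ a)"
  \<comment> \<open>One constant for the mean and for the root of the trace: it exceeds |tr| + 1
    and, being at least 1, is at most its own square.\<close>
  define Bf where "Bf = norm \<mu> + 1 + \<bar>tr\<bar> + 1"
  have n: "\<forall>\<^sub>F T in sequentially. norm (time_mean T f) < norm \<mu> + 1"
    by (intro order_tendstoD(2)[OF tendsto_norm[OF f1]]) simp
  have "(\<lambda>T. \<Sum>a\<in>UNIV. G T $ a $ a) \<longlonglongrightarrow> tr" unfolding tr_def by (intro tendsto_sum G_lim)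
  then have t: "\<forall>\<^sub>F T in sequentially. (\<Sum>a\<in>UNIV. G T $ a $ a) < \<bar>tr\<bar> + 1"
    by (rule order_tendstoD(2)) simp
  show thesis
  proof (rule that[of "c / 2" Bf])
    show "\<forall>\<^sub>F T in sequentially. (\<forall>x. c / 2 * (norm x)\<^sup>2 \<le> time_mean T (\<lambda>t. ((f t - time_mean T f) \<bullet> x)\<^sup>2)) \<and>
       norm (time_mean T f) \<le> Bf \<and> time_mean T (\<lambda>t. (norm (f t - time_mean T f))\<^sup>2) \<le> Bf\<^sup>2"
      using d n t eventually_ge_at_top[of 1]
    proof eventually_elim
      case (elim T)
      have 1: "c / 2 * (norm x)\<^sup>2 \<le> time_mean T (\<lambda>t. ((f t - time_mean T f) \<bullet> x)\<^sup>2)" for x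
      proof -
        have "\<bar>x \<bullet> (G T *v x) - x \<bullet> (?S *v x)\<bar> \<le> c / 2 * (norm x)\<^sup>2"
          using elim by (intro order_trans[OF quad_form_diff_le] mult_right_mono) auto
        then show ?thesis using c(2)[of x] unfolding G_quad[OF elim(4)] by linarith
      qed
      have "time_mean T (\<lambda>t. (norm (f t - time_mean T f))\<^sup>2) = (\<Sum>a\<in>UNIV. G T $ a $ a)"
      proof -
        have G: "time_mean T (\<lambda>t. ((f t - time_mean T f) $ a)\<^sup>2) = G T $ a $ a" for a
          using G_quad[OF elim(4), of "axis a 1"]
          by (simp add: inner_axis inner_axis' matrix_vector_mul_component column_def matrix_vector_mult_basis)
        have "time_mean T (\<lambda>t. (norm (f t - time_mean T f))\<^sup>2) = time_mean T (\<lambda>t. \<Sum>a\<in>UNIV. ((f t - time_mean T f) $ a)\<^sup>2)"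
          by (intro time_mean_cong) (simp only: power2_norm_eq_inner inner_vec_def, simp add: power2_eq_square)
        then show ?thesis by (simp only: time_mean_sum[OF finite] G)
      qed
      also have "\<dots> \<le> \<bar>tr\<bar> + 1" using elim(3) by (rule less_imp_le)
      also have "\<dots> \<le> Bf * 1" by (simp add: Bf_def add_nonneg_nonneg)
      also have "\<dots> \<le> Bf * Bf" by (intro mult_left_mono) (auto simp: Bf_def)
      finally have 3: "time_mean T (\<lambda>t. (norm (f t - time_mean T f))\<^sup>2) \<le> Bf\<^sup>2" by (simp add: power2_eq_square)
      show ?case using 1 3 elim by (auto simp: Bf_def)
    qed
  qed (use c in \<open>auto simp: Bf_def\<close>)
qed

lemma eventually_panel_data:
  obtains \<kappa> Bf where "\<kappa> > 0" "Bf \<ge> 0"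
    "\<forall>\<^sub>F (N, T) in panel_limit C r. panel_data N T y u f \<alpha> \<beta> lam \<mu> (\<rho> T) \<kappa> Bf Bb (norm (lam - \<mu>)) \<and> m1 / 4 \<le> s_hat N T y f"
proof -
  obtain \<kappa> Bf where *: "\<kappa> > 0" "Bf \<ge> 0"
    "\<forall>\<^sub>F T in sequentially. (\<forall>x. \<kappa> * (norm x)\<^sup>2 \<le> time_mean T (\<lambda>t. ((f t - time_mean T f) \<bullet> x)\<^sup>2)) \<and>
       norm (time_mean T f) \<le> Bf \<and> time_mean T (\<lambda>t. (norm (f t - time_mean T f))\<^sup>2) \<le> Bf\<^sup>2"
    by (rule factor_bounds)
  have Bb: "0 \<le> Bb" using \<beta>_bound[of 1] norm_ge_zero[of "\<beta> 1"] by linarith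
  have pos: "m1 / 2 > 0" "m1 / 4 > 0" "1 + (1 + Bf) / \<kappa> * Bf \<ge> 0" using m1 * by auto
  have "\<forall>\<^sub>F (N, T) in panel_limit C r. panel_data N T y u f \<alpha> \<beta> lam \<mu> (\<rho> T) \<kappa> Bf Bb (norm (lam - \<mu>)) \<and> m1 / 4 \<le> s_hat N T y f"
    using panel_limit_facts(3)[of C r] eventually_panel_limit_T[OF *(3), of C r] \<rho>_small[OF pos(1)] \<rho>_small'[OF pos(2,3)]
      eventually_panel_limit_T[OF eventually_ge_at_top[of 1], of C r] eventually_panel_limit_N[OF eventually_ge_at_top[of 1], of C r]
  proof eventually_elim
    case (elim p)
    obtain N T where p: "p = (N, T)" by (cases p)
    have iN: "i \<ge> 1" "real i \<le> C * real T powr r" if "i \<in> {1..N}" for i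
      using elim that unfolding p by (auto intro: order_trans[of _ "real N"])
    have T: "T \<ge> 1" and N: "N \<ge> 1" using elim unfolding p by auto
    have D: "panel_data N T y u f \<alpha> \<beta> lam \<mu> (\<rho> T) \<kappa> Bf Bb (norm (lam - \<mu>))"
      using elim(2) N T u1[OF iN(1) T iN(2)] u2[OF iN(1) T iN(2)] y[OF iN(1)] \<beta>_bound[OF iN(1)] W *(1,2) Bb unfolding p
      by unfold_locales auto
    then interpret D: panel_data N T y u f \<alpha> \<beta> lam \<mu> "\<rho> T" \<kappa> Bf Bb "norm (lam - \<mu>)" .
    have "(m1 / 2) / 2 \<le> s_hat N T y f"
    proof (rule D.s_hat_lower)
      show "m1 / 2 \<le> time_mean T (\<lambda>t. \<bar>u i t\<bar>)" if "i \<in> {1..N}" for i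
      proof -
        have "\<rho> T < m1 / 2" using elim(3) unfolding p by simp
        then show ?thesis using u3[OF iN(1)[OF that] T iN(2)[OF that]] by linarith
      qed
      show "\<rho> T * (1 + D.Cd * Bf) \<le> m1 / 2 / 2" using elim(4) unfolding p D.Cd_def by (simp add: mult.commute)
    qed (use m1 in auto)
    then show ?case unfolding p using D by simp
  qed
  then show thesis using that * by blast
qed

text \<open>T^(1/\<nu>) times the error rate T^(-1/\<nu> - \<theta>) is T^(-\<theta>), and the
  exponent \<nu>/2 of \<open>psi\<close> is applied to it; \<open>s_hat\<close> only has to stay
  away from 0.\<close>

lemma psi_null:
  assumes null: "\<And>i. i \<ge> 1 \<Longrightarrow> \<alpha> i = 0"
  shows "\<exists>K. \<forall>\<^sub>F (N, T) in panel_limit C r. \<forall>i\<in>{1..N}. 0 \<le> psi \<nu> N T y f i \<and> psi \<nu> N T y f i \<le> K * real T powr - (\<theta> * \<nu> / 2)"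
proof -
  obtain \<kappa> Bf where *: "\<kappa> > 0" "Bf \<ge> 0"
    and ev: "\<forall>\<^sub>F (N, T) in panel_limit C r. panel_data N T y u f \<alpha> \<beta> lam \<mu> (\<rho> T) \<kappa> Bf Bb (norm (lam - \<mu>)) \<and> m1 / 4 \<le> s_hat N T y f"
    by (rule eventually_panel_data)
  define Cd where "Cd = (1 + Bf) / \<kappa>"
  define Ce where "Ce = 1 + Cd * (norm (lam - \<mu>) + Bf)"
  define K1 where "K1 = Ce + (Bb + 1) * (8 * (Bb + 1) * Ce / k)"
  have Bb: "0 \<le> Bb" using \<beta>_bound[of 1] norm_ge_zero[of "\<beta> 1"] by linarith
  have C0: "Cd \<ge> 0" "Ce \<ge> 0" "K1 \<ge> 0" using * Bb k by (auto simp: Cd_def Ce_def K1_def)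
  have pos: "sqrt k > 0" "4 * Cd \<ge> 0" using k C0 by auto
  define K where "K = (4 * (K1 * W) / m1) powr (\<nu> / 2)"
  have "\<forall>\<^sub>F (N, T) in panel_limit C r. \<forall>i\<in>{1..N}. 0 \<le> psi \<nu> N T y f i \<and> psi \<nu> N T y f i \<le> K * real T powr - (\<theta> * \<nu> / 2)"
    using ev \<rho>_small'[OF zero_less_one C0(1)] \<rho>_small'[OF pos]
      eventually_panel_limit_N[OF S, of C r] eventually_panel_limit_T[OF eventually_ge_at_top[of 1], of C r]
  proof eventually_elim
    case (elim p)
    obtain N T where p: "p = (N, T)" by (cases p)
    interpret D: panel_data N T y u f \<alpha> \<beta> lam \<mu> "\<rho> T" \<kappa> Bf Bb "norm (lam - \<mu>)" using elim unfolding p by auto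
    have Cd: "D.Cd = Cd" "D.Ce = Ce" by (simp_all add: D.Cd_def Cd_def D.Ce_def Ce_def)
    have T: "real T > 0" using elim unfolding p by auto
    have s: "m1 / 4 \<le> s_hat N T y f" using elim unfolding p by auto
    have al: "\<bar>alpha_hat N T y f i\<bar> \<le> K1 * \<rho> T" if i: "i \<in> {1..N}" for i
    proof -
      have "(4 * Cd * \<rho> T)\<^sup>2 \<le> (sqrt k)\<^sup>2" using elim k C0 W unfolding p by (intro power_mono) auto
      then have "(4 * D.Cd * \<rho> T)\<^sup>2 \<le> k" using k unfolding Cd by simp
      moreover have "D.Cd * \<rho> T \<le> 1" using elim C0 unfolding p Cd by simp
      ultimately have "\<bar>alpha_hat N T y f i\<bar> \<le> (D.Ce + (Bb + 1) * (8 * (Bb + 1) * D.Ce / k)) * \<rho> T"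
        using elim(4) i null k unfolding p by (intro D.alpha_hat_null) auto
      then show ?thesis unfolding Cd K1_def .
    qed
    have "psi \<nu> N T y f i \<le> K * real T powr - (\<theta> * \<nu> / 2)" if i: "i \<in> {1..N}" for i
    proof -
      have "\<bar>real T powr (1 / \<nu>) * alpha_hat N T y f i / s_hat N T y f\<bar> \<le> real T powr (1 / \<nu>) * (K1 * \<rho> T) / (m1 / 4)"
        unfolding abs_mult abs_divide using s m1 al[OF i]
        by (intro frac_le mult_mono) auto
      also have "\<dots> = 4 * (K1 * W) / m1 * (real T powr (1 / \<nu>) * real T powr (- (1 / \<nu> + \<theta>)))" by simp
      also have "real T powr (1 / \<nu>) * real T powr (- (1 / \<nu> + \<theta>)) = real T powr (- \<theta>)"
        by (simp flip: powr_add)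
      finally have "psi \<nu> N T y f i \<le> (4 * (K1 * W) / m1 * real T powr (- \<theta>)) powr (\<nu> / 2)"
        unfolding psi_def using nu by (intro powr_mono2) auto
      also have "\<dots> = K * real T powr - (\<theta> * \<nu> / 2)"
        unfolding K_def using C0 W m1 by (subst powr_mult) (auto simp: powr_powr intro!: divide_nonneg_nonneg mult_nonneg_nonneg)
      finally show ?thesis .
    qed
    then show ?case unfolding p by (auto simp: psi_def)
  qed
  then show ?thesis by blast
qed

text \<open>Numerator and denominator both carry 1 + |ch|, which cancels whatever
  \<open>lambda_hat\<close> does. There remains T^(1/\<nu>) / T^(1/(2\<nu>)) = T^(1/(2\<nu>)), whose
  power \<nu>/2 is T^(1/4).\<close>

lemma psi_alt:
  assumes alt: "\<And>c. \<exists>i\<ge>1. \<alpha> i \<noteq> \<beta> i \<bullet> c"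
  shows "\<exists>c>0. \<forall>\<^sub>F (N, T) in panel_limit C r. \<exists>i\<in>{1..N}. c * real T powr (1 / 4) \<le> psi \<nu> N T y f i"
proof -
  obtain \<kappa> Bf where *: "\<kappa> > 0" "Bf \<ge> 0"
    and ev: "\<forall>\<^sub>F (N, T) in panel_limit C r. panel_data N T y u f \<alpha> \<beta> lam \<mu> (\<rho> T) \<kappa> Bf Bb (norm (lam - \<mu>)) \<and> m1 / 4 \<le> s_hat N T y f"
    by (rule eventually_panel_data)
  define Bl where "Bl = norm (lam - \<mu>)"
  define Cd where "Cd = (1 + Bf) / \<kappa>"
  define Ce where "Ce = 1 + Cd * (Bl + Bf)"
  have Bb: "0 \<le> Bb" using \<beta>_bound[of 1] norm_ge_zero[of "\<beta> 1"] by linarith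
  have C0: "Cd \<ge> 0" "Ce \<ge> 0" "Bl \<ge> 0" using * by (auto simp: Cd_def Ce_def Bl_def)
  \<comment> \<open>Coercivity at a single cross-section size already shows that finitely many
    slopes span the space.\<close>
  obtain n where n: "n \<ge> 1" "\<And>x. k * (norm x)\<^sup>2 * real n \<le> (\<Sum>i\<in>{1..n}. ((\<beta> i - (1 / real n) *\<^sub>R (\<Sum>j\<in>{1..n}. \<beta> j)) \<bullet> x)\<^sup>2)"
    using eventually_happens'[OF sequentially_bot eventually_conj[OF S eventually_ge_at_top[of 1]]] by auto
  have span: "x = 0" if z: "\<And>i. i \<in> {1..n} \<Longrightarrow> \<beta> i \<bullet> x = 0" for x
  proof -
    have "(\<Sum>i\<in>{1..n}. ((\<beta> i - (1 / real n) *\<^sub>R (\<Sum>j\<in>{1..n}. \<beta> j)) \<bullet> x)\<^sup>2) = (\<Sum>i\<in>{1..n}. 0)"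
      by (intro sum.cong refl) (simp add: inner_diff_left inner_sum_left z)
    then have "k * (norm x)\<^sup>2 * real n \<le> 0" using n(2)[of x] by simp
    moreover have "0 < k * (norm x)\<^sup>2 * real n" if "x \<noteq> 0" using that k n(1) by simp
    ultimately show ?thesis by force
  qed
  obtain \<eta> l where \<eta>: "\<eta> > 0" and far: "\<And>c. \<exists>i\<in>{1..l}. \<eta> * (1 + norm c) \<le> \<bar>\<alpha> i - \<beta> i \<bullet> c\<bar>"
    using alternative_margin[OF alt span] by blast
  define K where "K = 6 * W' + 6 + 6 * Bf\<^sup>2 + 2 * (Bb + 1)\<^sup>2 * (1 + Bl)\<^sup>2"
  have "0 \<le> 6 * W'" "0 \<le> 6 * Bf\<^sup>2" "0 \<le> 2 * (Bb + 1)\<^sup>2 * (1 + Bl)\<^sup>2" using W by auto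
  then have K: "K > 0" unfolding K_def by linarith
  have pos: "\<eta> / 4 > 0" using \<eta> by auto
  define c where "c = (\<eta> / (2 * sqrt K)) powr (\<nu> / 2)"
  have c: "c > 0" using \<eta> K by (simp add: c_def)
  have "\<forall>\<^sub>F (N, T) in panel_limit C r. \<exists>i\<in>{1..N}. c * real T powr (1 / 4) \<le> psi \<nu> N T y f i"
    using ev \<rho>_small'[OF zero_less_one C0(1)] \<rho>_small[OF zero_less_one]
      \<rho>_small'[OF pos C0(2)] \<rho>_small'[OF pos C0(1)] u4
      eventually_panel_limit_N[OF eventually_ge_at_top[of l], of C r] eventually_panel_limit_T[OF eventually_ge_at_top[of 1], of C r]
  proof eventually_elim
    case (elim p)
    obtain N T where p: "p = (N, T)" by (cases p)
    interpret D: panel_data N T y u f \<alpha> \<beta> lam \<mu> "\<rho> T" \<kappa> Bf Bb Bl using elim unfolding p Bl_def by auto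
    have Cd: "D.Cd = Cd" "D.Ce = Ce" by (simp_all add: D.Cd_def Cd_def D.Ce_def Ce_def)
    have T: "real T \<ge> 1" using elim unfolding p by auto
    have T1: "1 \<le> real T powr (1 / \<nu>)" using T nu by (intro ge_one_powr_ge_zero) auto
    let ?c = "norm D.ch"
    have s0: "0 < s_hat N T y f" using elim m1 unfolding p by auto
    have s: "s_hat N T y f \<le> sqrt K * (real T powr (1 / (2 * \<nu>)) * (1 + ?c))"
    proof -
      have "(s_hat N T y f)\<^sup>2 \<le> 6 * (W' * real T powr (1 / \<nu>)) + 6 + 6 * Bf\<^sup>2 + 2 * (Bb + 1)\<^sup>2 * (?c + Bl)\<^sup>2"
        using elim C0 unfolding p Cd[symmetric] by (intro D.s_hat_upper) auto
      also have "\<dots> \<le> K * (real T powr (1 / \<nu>) * (1 + ?c)\<^sup>2)"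
      proof -
        let ?P = "real T powr (1 / \<nu>)" and ?Q = "(1 + ?c)\<^sup>2"
        have Q: "1 \<le> ?Q" by (simp add: power2_sum)
        have PQ: "1 \<le> ?P * ?Q" "?P \<le> ?P * ?Q" "?Q \<le> ?P * ?Q"
          using mult_mono[OF T1 Q] mult_left_mono[OF Q, of ?P] mult_right_mono[OF T1, of ?Q] T1 Q by auto
        have "(?c + Bl)\<^sup>2 \<le> ((1 + Bl) * (1 + ?c))\<^sup>2" using C0 by (intro power_mono) (auto simp: algebra_simps)
        also have "\<dots> = (1 + Bl)\<^sup>2 * ?Q" by (simp add: power_mult_distrib)
        also have "\<dots> \<le> (1 + Bl)\<^sup>2 * (?P * ?Q)" using PQ by (intro mult_left_mono) auto
        finally have 4: "2 * (Bb + 1)\<^sup>2 * (?c + Bl)\<^sup>2 \<le> 2 * (Bb + 1)\<^sup>2 * ((1 + Bl)\<^sup>2 * (?P * ?Q))"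
          by (intro mult_left_mono) auto
        have 1: "6 * (W' * ?P) \<le> 6 * (W' * (?P * ?Q))" using PQ W by (intro mult_left_mono) auto
        have 3: "6 * Bf\<^sup>2 * 1 \<le> 6 * Bf\<^sup>2 * (?P * ?Q)" using PQ by (intro mult_left_mono) auto
        show ?thesis using 1 3 4 PQ(1) unfolding K_def by (simp add: distrib_right mult.assoc)
      qed
      finally have "(s_hat N T y f)\<^sup>2 \<le> K * (real T powr (1 / \<nu>) * (1 + ?c)\<^sup>2)" .
      also have "\<dots> = (sqrt K * (real T powr (1 / (2 * \<nu>)) * (1 + ?c)))\<^sup>2"
      proof -
        have "(real T powr (1 / (2 * \<nu>)))\<^sup>2 = real T powr (1 / \<nu>)"
          by (simp add: power2_eq_square flip: powr_add)
        then show ?thesis using K by (simp add: power_mult_distrib)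
      qed
      finally show ?thesis by (rule power2_le_imp_le) (use K in auto)
    qed
    have lN: "l \<le> N" using elim unfolding p by auto
    have "\<exists>i\<in>{1..l}. \<eta> / 2 * (1 + ?c) \<le> \<bar>alpha_hat N T y f i\<bar>"
    proof (rule D.alpha_hat_alt[OF \<eta>])
      show "{1..l} \<subseteq> {1..N}" using lN by auto
    qed (use far elim C0 \<eta> in \<open>auto simp: p Cd\<close>)
    then obtain i where "i \<in> {1..l}" and i2: "\<eta> / 2 * (1 + ?c) \<le> \<bar>alpha_hat N T y f i\<bar>" by blast
    then have i: "i \<in> {1..N}" "\<eta> / 2 * (1 + ?c) \<le> \<bar>alpha_hat N T y f i\<bar>" using lN by auto
    have "\<eta> / (2 * sqrt K) * real T powr (1 / (2 * \<nu>)) \<le> \<bar>real T powr (1 / \<nu>) * alpha_hat N T y f i / s_hat N T y f\<bar>"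
    proof -
      have cancel: "h / (2 * s) * P = P * P * (h / 2 * c) / (s * (P * c))" if "P > 0" "s > 0" "c > 0" for P s c h :: real
        using that by (simp add: field_simps)
      have c1: "1 + ?c > 0" by (simp add: add_pos_nonneg)
      have "real T powr (1 / \<nu>) = real T powr (1 / (2 * \<nu>)) * real T powr (1 / (2 * \<nu>))"
        by (simp flip: powr_add)
      then have "\<eta> / (2 * sqrt K) * real T powr (1 / (2 * \<nu>)) =
          real T powr (1 / \<nu>) * (\<eta> / 2 * (1 + ?c)) / (sqrt K * (real T powr (1 / (2 * \<nu>)) * (1 + ?c)))"
        using cancel[of "real T powr (1 / (2 * \<nu>))" "sqrt K" "1 + ?c" \<eta>] c1 T K by simp
      also have "\<dots> \<le> real T powr (1 / \<nu>) * \<bar>alpha_hat N T y f i\<bar> / s_hat N T y f"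
        using s s0 i by (intro frac_le mult_left_mono) auto
      finally show ?thesis using s0 by (simp add: abs_mult)
    qed
    then have "(\<eta> / (2 * sqrt K) * real T powr (1 / (2 * \<nu>))) powr (\<nu> / 2) \<le> psi \<nu> N T y f i"
      unfolding psi_def using nu \<eta> K by (intro powr_mono2) auto
    moreover have "(\<eta> / (2 * sqrt K) * real T powr (1 / (2 * \<nu>))) powr (\<nu> / 2) = c * real T powr (1 / 4)"
      unfolding c_def using \<eta> K nu by (subst powr_mult) (auto simp: powr_powr)
    ultimately have "c * real T powr (1 / 4) \<le> psi \<nu> N T y f i" by simp
    then show ?case using i(1) unfolding p by blast
  qed
  then show ?thesis using c by blast
qed

end

section \<open>Almost sure regularity\<close>

context prob_space
begin

lemma AE_lipschitz_sums_bound: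
  fixes v :: "nat \<Rightarrow> int \<Rightarrow> 'a \<Rightarrow> 'b::euclidean_space" and h :: "'b \<Rightarrow> real"
  assumes shift: "\<And>i. i \<ge> 1 \<Longrightarrow> decomposable_shift M \<nu> (a i) c (S i) (g i) (\<eta> i) (\<eta>s i) (v i)"
    and a: "\<And>i. i \<ge> 1 \<Longrightarrow> a i \<ge> 1" and nu: "\<nu> \<ge> 4" and k: "k > 0" "\<And>i t. i \<ge> 1 \<Longrightarrow> Lnorm M \<nu> (v i t) \<le> k"
    and q: "q \<ge> 1" "2 * real q \<le> \<nu>" and \<delta>: "\<delta> > 0" and h: "h \<in> borel_measurable borel"
    and lip: "\<And>x y. \<bar>h x - h y\<bar> \<le> norm (x - y)" "\<And>x. \<bar>h x\<bar> \<le> norm x"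
  shows "AE \<omega> in M. \<exists>W\<ge>0. \<forall>i\<ge>1. \<forall>T\<ge>1. \<bar>\<Sum>t\<in>{1..int T}. h (v i t \<omega>) - expectation (\<lambda>\<omega>. h (v i t \<omega>))\<bar>
     \<le> W * real i powr ((1 + \<delta>) / (2 * q)) * real T powr (1/2 + \<delta>)"
proof (rule AE_partial_sums_bound[OF q(1) \<delta>])
  fix i m n :: nat assume i: "i \<ge> 1" and mn: "m \<le> n"
  have d: "dyadic_approx (2 * q) (2 * k) (2 * c) (\<lambda>t \<omega>. h (v i t \<omega>)) (\<lambda>t j \<omega>. h (coupled (g i) (\<eta> i) (\<eta>s i) t (2 ^ j) \<omega>))"
    by (rule dyadic_approx_lipschitz[OF shift[OF i] nu a[OF i] k(1) k(2)[OF i] _ _ _ h lip]) (use q in auto)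
  show "lp_le M (2 * q) (\<lambda>\<omega>. \<Sum>t\<in>{int m<..int n}. h (v i t \<omega>) - expectation (\<lambda>\<omega>. h (v i t \<omega>)))
      (approx_const q (2 * k) (2 * c) * sqrt (real (n - m)))"
    using lp_le_dyadic_approx_sum[OF q(1) d, of "{int m<..int n}" "\<lambda>_. 1"] mn
    by (simp add: of_nat_diff)
qed

lemma AE_product_sums_bound:
  fixes v :: "int \<Rightarrow> 'a \<Rightarrow> 'b::euclidean_space" and h :: "'b \<Rightarrow> real" and u :: "nat \<Rightarrow> int \<Rightarrow> 'a \<Rightarrow> real"
  assumes shift: "\<And>i. i \<ge> 1 \<Longrightarrow> decomposable_shift M \<nu> (a i) c (S i) (g i) (\<eta> i) (\<eta>s i) (u i)"
    and a: "\<And>i. i \<ge> 1 \<Longrightarrow> a i \<ge> 1" and nu: "\<nu> \<ge> 4" and k: "k > 0" "\<And>i t. i \<ge> 1 \<Longrightarrow> Lnorm M \<nu> (u i t) \<le> k"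
    and u0: "\<And>i t. i \<ge> 1 \<Longrightarrow> expectation (u i t) = 0"
    and shift_v: "decomposable_shift M \<nu> a' c' S' g' \<eta>' \<eta>s' v" and kv: "\<And>t. Lnorm M \<nu> (v t) \<le> k"
    and ind: "\<And>i T :: nat. i \<ge> 1 \<Longrightarrow> indep_rv M (\<Pi>\<^sub>M t\<in>{1..int T}. borel) (\<lambda>\<omega>. \<lambda>t\<in>{1..int T}. u i t \<omega>)
            (\<Pi>\<^sub>M t\<in>{1..int T}. borel) (\<lambda>\<omega>. \<lambda>t\<in>{1..int T}. v t \<omega>)"
    and q: "q \<ge> 1" "2 * real q \<le> \<nu>" and \<delta>: "\<delta> > 0" and h: "h \<in> borel_measurable borel"
    and lip: "\<And>x. \<bar>h x\<bar> \<le> norm x"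
  shows "AE \<omega> in M. \<exists>W\<ge>0. \<forall>i\<ge>1. \<forall>T\<ge>1. \<bar>\<Sum>t\<in>{1..int T}. h (v t \<omega>) * u i t \<omega>\<bar>
     \<le> W * real i powr ((1 + \<delta>) / (2 * q)) * real T powr (1/2 + \<delta>)"
proof (rule AE_partial_sums_bound[OF q(1) \<delta>])
  fix i m n :: nat assume i: "i \<ge> 1" and mn: "m \<le> n"
  define K where "K = approx_const q (2 * k) (2 * c)"
  have c: "c > 0" using shift_facts(1)[OF shift[OF i]] .
  have K: "K \<ge> 0" using c k(1) by (simp add: K_def approx_const_def)
  have d: "dyadic_approx (2 * q) (2 * k) (2 * c) (\<lambda>t \<omega>. u i t \<omega>) (\<lambda>t j \<omega>. coupled (g i) (\<eta> i) (\<eta>s i) t (2 ^ j) \<omega>)"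
    by (rule dyadic_approx_lipschitz[OF shift[OF i] nu a[OF i] k(1) k(2)[OF i], where h = "\<lambda>x. x"]) (use q in auto)
  have "lp_le M (2 * q) (\<lambda>\<omega>. \<Sum>t\<in>{int m<..int n}. h (v t \<omega>) * u i t \<omega>) (K * (2 * k) * sqrt (card {int m<..int n}))"
  proof (rule lp_le_independent_weights[OF ind[OF i, of n] _ q(1) K])
    show "lp_le M (2 * q) (\<lambda>\<omega>. \<Sum>t\<in>{int m<..int n}. b t * u i t \<omega>) (K * sqrt (\<Sum>t\<in>{int m<..int n}. (b t)\<^sup>2))" for b
      using lp_le_dyadic_approx_sum[OF q(1) d, of "{int m<..int n}" b] u0[OF i] by (simp add: K_def)
    show "lp_le M (2 * q) (\<lambda>\<omega>. h (v t \<omega>)) (2 * k)" for t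
    proof (rule lp_le_of_powr_moment[where D = "v t", OF _ _ _ _ _ _ shift_facts(4)[OF shift_v] kv k(1)])
      show "(\<lambda>\<omega>. h (v t \<omega>)) \<in> borel_measurable M"
        by (rule measurable_compose[OF shift_measurable[OF shift_v] h])
    qed (use q shift_measurable[OF shift_v] lip in auto)
  qed (use shift_measurable[OF shift[OF i]] shift_measurable[OF shift_v] h k in auto)
  then show "lp_le M (2 * q) (\<lambda>\<omega>. \<Sum>t\<in>{int m<..int n}. h (v t \<omega>) * u i t \<omega>) (K * (2 * k) * sqrt (real (n - m)))"
    using mn by (simp add: of_nat_diff)
qed

text \<open>A strong law with rate T^(-1/4): the partial sums have order T^(1/2 + 1/4). The bound
  for families is applied to a family that is constant in the asset index.\<close>

lemma AE_shift_product_mean: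
  fixes v :: "int \<Rightarrow> 'a \<Rightarrow> 'b::euclidean_space" and h1 h2 :: "'b \<Rightarrow> real"
  assumes shift: "decomposable_shift M \<nu> a c S g \<eta> \<eta>s v"
    and a: "a \<ge> 1" and nu: "\<nu> \<ge> 4" and k: "k > 0" "\<And>t. Lnorm M \<nu> (v t) \<le> k"
    and h: "h1 \<in> borel_measurable borel" "h2 \<in> borel_measurable borel"
    and lip: "\<And>x y. \<bar>h1 x - h1 y\<bar> \<le> norm (x - y)" "\<And>x. \<bar>h1 x\<bar> \<le> norm x"
      "\<And>x y. \<bar>h2 x - h2 y\<bar> \<le> norm (x - y)" "\<And>x. \<bar>h2 x\<bar> \<le> norm x"
  shows "AE \<omega> in M. (\<lambda>T. time_mean T (\<lambda>t. h1 (v t \<omega>) * h2 (v t \<omega>))) \<longlonglongrightarrow> expectation (\<lambda>\<omega>. h1 (v 0 \<omega>) * h2 (v 0 \<omega>))"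
proof -
  let ?X = "\<lambda>t \<omega>. h1 (v t \<omega>) * h2 (v t \<omega>)"
  have d2: "dyadic_approx (2 * 1) (4 * k\<^sup>2) (8 * k * c) ?X
      (\<lambda>t j \<omega>. h1 (coupled g \<eta> \<eta>s t (2 ^ j) \<omega>) * h2 (coupled g \<eta> \<eta>s t (2 ^ j) \<omega>))"
    unfolding mult_1_right by (rule dyadic_approx_product[OF shift nu a k h lip])
  have e: "expectation (?X t) = expectation (?X 0)" for t
  proof -
    have "expectation (?X t) = (\<integral>x. h1 x * h2 x \<partial>distr M borel (v t))"
      using h shift_measurable[OF shift] by (subst integral_distr) auto
    also have "\<dots> = expectation (?X 0)"
      unfolding distr_shift_eq[OF shift, of t 0] using h shift_measurable[OF shift] by (subst integral_distr) auto
    finally show ?thesis .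
  qed
  have AE: "AE \<omega> in M. \<exists>W\<ge>0. \<forall>i\<ge>1. \<forall>T\<ge>1. \<bar>\<Sum>t\<in>{1..int T}. ?X t \<omega> - expectation (?X t)\<bar>
     \<le> W * real i powr ((1 + 1/4) / (2 * 1)) * real T powr (1/2 + 1/4)"
  proof -
    have "AE \<omega> in M. \<exists>W\<ge>0. \<forall>i\<ge>1. \<forall>T\<ge>1. \<bar>\<Sum>t\<in>{1..int T}. (\<lambda>(_::nat) t \<omega>. ?X t \<omega> - expectation (?X t)) i t \<omega>\<bar>
       \<le> W * real i powr ((1 + 1/4) / (2 * real 1)) * real T powr (1/2 + 1/4)"
    proof (rule AE_partial_sums_bound)
      fix i m n :: nat assume "i \<ge> 1" and mn: "m \<le> n"
      show "lp_le M (2 * 1) (\<lambda>\<omega>. \<Sum>t\<in>{int m<..int n}. ?X t \<omega> - expectation (?X t))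
          (approx_const 1 (4 * k\<^sup>2) (8 * k * c) * sqrt (real (n - m)))"
        using lp_le_dyadic_approx_sum[OF order_refl d2, of "{int m<..int n}" "\<lambda>_. 1"] mn
        by (simp add: of_nat_diff)
    qed auto
    then show ?thesis by simp
  qed
  show ?thesis using AE
  proof eventually_elim
    case (elim \<omega>)
    then obtain W where W: "W \<ge> 0" "\<And>i T. i \<ge> 1 \<Longrightarrow> T \<ge> 1 \<Longrightarrow> \<bar>\<Sum>t\<in>{1..int T}. ?X t \<omega> - expectation (?X t)\<bar>
       \<le> W * real i powr ((1 + 1/4) / (2 * 1)) * real T powr (1/2 + 1/4)" by blast
    have lim: "(\<lambda>T. W * real T powr (- 1/4)) \<longlonglongrightarrow> 0" by real_asymp
    have "(\<lambda>T. time_mean T (\<lambda>t. ?X t \<omega>) - expectation (?X 0)) \<longlonglongrightarrow> 0"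
    proof (rule Lim_null_comparison[OF _ lim])
      show "\<forall>\<^sub>F T in sequentially. norm (time_mean T (\<lambda>t. ?X t \<omega>) - expectation (?X 0)) \<le> W * real T powr (- 1/4)"
        using eventually_ge_at_top[of 1]
      proof eventually_elim
        case (elim T)
        have "time_mean T (\<lambda>t. ?X t \<omega>) - expectation (?X 0) = time_mean T (\<lambda>t. ?X t \<omega> - expectation (?X t))"
        proof -
          have "time_mean T (\<lambda>t. ?X t \<omega> - expectation (?X t)) = time_mean T (\<lambda>t. ?X t \<omega> - expectation (?X 0))"
            by (intro time_mean_cong arg_cong2[where f = "(-)"] refl e)
          then show ?thesis using elim by (simp add: time_mean_diff time_mean_const)
        qed
        also have "norm \<dots> = \<bar>\<Sum>t\<in>{1..int T}. ?X t \<omega> - expectation (?X t)\<bar> / real T"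
          by (simp add: time_mean_def abs_mult)
        also have "\<dots> \<le> W * real T powr (1/2 + 1/4) / real T"
          using W(2)[of 1 T] elim by (intro divide_right_mono) auto
        also have "\<dots> = W * real T powr (1/2 + 1/4 - 1)"
          unfolding powr_diff using elim by simp
        finally have "norm (time_mean T (\<lambda>t. ?X t \<omega>) - expectation (?X 0)) \<le> W * real T powr (1/2 + 1/4 - 1)" .
        moreover have "(1/2 + 1/4 - 1 :: real) = - 1/4" by simp
        ultimately show ?case by (simp only:)
      qed
    qed
    then show ?case by (rule LIM_zero_cancel)
  qed
qed

text \<open>Truncation at L: x^2 <= L |x| below L and x^2 <= x^4 / L^2 above it. L is chosen so that
  the fourth moment consumes at most half of c.\<close>

lemma abs_moment_lower_bound:
  assumes X: "lp_le M 4 X K" "K > 0" and c: "c > 0" "c \<le> expectation (\<lambda>\<omega>. (X \<omega>)\<^sup>2)"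
  shows "c / (2 * sqrt (2 * K ^ 4 / c)) \<le> expectation (\<lambda>\<omega>. \<bar>X \<omega>\<bar>)"
proof -
  define L where "L = sqrt (2 * K ^ 4 / c)"
  have L: "L > 0" "L\<^sup>2 = 2 * K ^ 4 / c" using X(2) c by (auto simp: L_def)
  note lm = lp_le_lower_moment[OF _ _ X, simplified]
  have i1: "integrable M (\<lambda>\<omega>. \<bar>X \<omega>\<bar>)" using lm(2)[of 1] by simp
  have i2: "integrable M (\<lambda>\<omega>. (X \<omega>)\<^sup>2)" using lm(1)[of 2] by simp
  have i4: "integrable M (\<lambda>\<omega>. X \<omega> ^ 4)" using lp_leD(2)[OF X(1)] .
  have le: "x\<^sup>2 \<le> L * \<bar>x\<bar> + x ^ 4 / L\<^sup>2" for x :: real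
  proof (cases "\<bar>x\<bar> \<le> L")
    case True
    have "x\<^sup>2 = \<bar>x\<bar> * \<bar>x\<bar>" by (simp add: power2_eq_square)
    also have "\<dots> \<le> L * \<bar>x\<bar>" using True by (intro mult_right_mono) auto
    finally have "x\<^sup>2 \<le> L * \<bar>x\<bar>" .
    moreover have "0 \<le> x ^ 4 / L\<^sup>2" by simp
    ultimately show ?thesis by linarith
  next
    case False
    then have "L\<^sup>2 \<le> \<bar>x\<bar>\<^sup>2" using L by (intro power_mono) auto
    then have "L\<^sup>2 * x\<^sup>2 \<le> x\<^sup>2 * x\<^sup>2" by (intro mult_right_mono) auto
    then have "x\<^sup>2 * L\<^sup>2 \<le> x ^ 4" by (simp add: mult.commute flip: power_add)
    moreover have "L\<^sup>2 > 0" using L(1) by simp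
    ultimately have "x\<^sup>2 \<le> x ^ 4 / L\<^sup>2" by (simp only: pos_le_divide_eq)
    moreover have "0 \<le> L * \<bar>x\<bar>" using L by simp
    ultimately show ?thesis by linarith
  qed
  have "c \<le> expectation (\<lambda>\<omega>. (X \<omega>)\<^sup>2)" by (rule c(2))
  also have "\<dots> \<le> expectation (\<lambda>\<omega>. L * \<bar>X \<omega>\<bar> + X \<omega> ^ 4 / L\<^sup>2)"
    using i1 i2 i4 le by (intro integral_mono) auto
  also have "\<dots> = L * expectation (\<lambda>\<omega>. \<bar>X \<omega>\<bar>) + expectation (\<lambda>\<omega>. X \<omega> ^ 4) / L\<^sup>2"
    using i1 i4 by simp
  also have "expectation (\<lambda>\<omega>. X \<omega> ^ 4) / L\<^sup>2 \<le> K ^ 4 / L\<^sup>2"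
    using lp_leD(4)[OF X(1)] by (intro divide_right_mono) auto
  also have "K ^ 4 / L\<^sup>2 = c / 2" unfolding L(2) using X(2) c by simp
  finally have "c / 2 \<le> L * expectation (\<lambda>\<omega>. \<bar>X \<omega>\<bar>)" by simp
  then have "c / (2 * L) \<le> expectation (\<lambda>\<omega>. \<bar>X \<omega>\<bar>)" using L by (simp add: field_simps)
  then show ?thesis by (simp add: L_def)
qed

text \<open>Integrability of the matrix-valued integrand is extracted from \<open>pd\<close>:
  otherwise the integral would be 0 by convention, and 0 is not positive definite.\<close>

lemma covariance_matrix_eq:
  fixes X :: "'a \<Rightarrow> real^'k"
  assumes pd: "pos_def (covariance_matrix M X)"
    and i1: "\<And>a. integrable M (\<lambda>\<omega>. X \<omega> $ a)" and i2: "\<And>a b. integrable M (\<lambda>\<omega>. X \<omega> $ a * X \<omega> $ b)"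
    and \<mu>: "\<And>a. expectation X $ a = expectation (\<lambda>\<omega>. X \<omega> $ a)"
  shows "covariance_matrix M X = (\<chi> a b. expectation (\<lambda>\<omega>. X \<omega> $ a * X \<omega> $ b) - expectation X $ a * expectation X $ b)"
proof -
  let ?O = "\<lambda>\<omega>. outer (X \<omega> - expectation X) (X \<omega> - expectation X)"
  have int: "integrable M ?O"
  proof (rule ccontr)
    assume "\<not> ?thesis"
    then have "covariance_matrix M X = 0" by (simp add: covariance_matrix_def not_integrable_integral_eq)
    moreover have "axis undefined 1 \<noteq> (0 :: real^'k)" by (simp add: axis_eq_0_iff)
    ultimately show False using pd by (auto simp: pos_def_def)
  qed
  have bl: "bounded_linear (\<lambda>A :: real^'k^'k. A $ a $ b)" for a b
    by (intro bounded_linear_compose[OF bounded_linear_vec_nth bounded_linear_vec_nth])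
  have "covariance_matrix M X $ a $ b = expectation (\<lambda>\<omega>. X \<omega> $ a * X \<omega> $ b) - expectation X $ a * expectation X $ b" for a b
  proof -
    have "covariance_matrix M X $ a $ b = expectation (\<lambda>\<omega>. ?O \<omega> $ a $ b)"
      unfolding covariance_matrix_def by (rule integral_bounded_linear[OF bl int, symmetric])
    also have "\<dots> = expectation (\<lambda>\<omega>. X \<omega> $ a * X \<omega> $ b - expectation X $ b * X \<omega> $ a - expectation X $ a * X \<omega> $ b + expectation X $ a * expectation X $ b)"
      by (intro Bochner_Integration.integral_cong) (auto simp: outer_def algebra_simps)
    also have "\<dots> = expectation (\<lambda>\<omega>. X \<omega> $ a * X \<omega> $ b) - expectation X $ b * expectation (\<lambda>\<omega>. X \<omega> $ a) - expectation X $ a * expectation (\<lambda>\<omega>. X \<omega> $ b) + expectation X $ a * expectation X $ b"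
      using i1 i2 by (simp add: prob_space)
    finally show ?thesis unfolding \<mu>[symmetric] by simp
  qed
  then show ?thesis by (simp add: vec_eq_iff)
qed

end

context prob_space
begin

lemma AE_regular_path:
  fixes y u :: "nat \<Rightarrow> int \<Rightarrow> 'a \<Rightarrow> real"
    and f :: "int \<Rightarrow> 'a \<Rightarrow> real^'k"
    and au :: "nat \<Rightarrow> real" and Su :: "nat \<Rightarrow> 's measure" and Sf :: "'q measure"
  assumes nu: "\<nu> \<ge> 4"
    and model: "panel_model M y \<beta> f u \<alpha> lam"
    and A1_shift: "\<And>i. i \<ge> 1 \<Longrightarrow> decomposable_shift M \<nu> (au i) cu (Su i) (gu i) (\<eta>u i) (\<eta>su i) (u i)"
    and A1_rate: "\<And>i. i \<ge> 1 \<Longrightarrow> au i \<ge> 1"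
    and A1_moment: "\<exists>c. \<forall>i\<ge>1. \<forall>t. Lnorm M \<nu> (u i t) \<le> c"
    and A1_mean: "\<And>i t. i \<ge> 1 \<Longrightarrow> expectation (u i t) = 0"
    and A1_var: "\<exists>c>0. \<forall>i\<ge>1. \<forall>t. expectation (\<lambda>\<omega>. (u i t \<omega>)\<^sup>2) \<ge> c"
    and A2_shift: "decomposable_shift M \<nu> af cf Sf gf \<eta>f \<eta>sf f"
    and A2_rate: "af \<ge> 1"
    and A2_cov: "pos_def (covariance_matrix M (f 0))"
    and \<epsilon>: "\<epsilon> > 0" and r: "r = 1/2 * (\<nu>/2 - 1) - \<epsilon>" "r > 0"
    and B1_bounded: "bounded (\<beta> ` {1..})"
    and B1_posdef: "\<exists>c>0. \<forall>\<^sub>F N in sequentially. pos_def (S_beta \<beta> N - mat c)"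
    and B2_indep: "\<And>i T :: nat. i \<ge> 1 \<Longrightarrow>
          indep_rv M
            (\<Pi>\<^sub>M t\<in>{1..int T}. borel) (\<lambda>\<omega>. \<lambda>t\<in>{1..int T}. u i t \<omega>)
            (\<Pi>\<^sub>M t\<in>{1..int T}. borel) (\<lambda>\<omega>. \<lambda>t\<in>{1..int T}. f t \<omega>)"
  shows "AE \<omega> in M. \<exists>\<mu> m \<theta> W W' m1 k Bb.
     regular_path (\<lambda>i t. y i t \<omega>) (\<lambda>i t. u i t \<omega>) (\<lambda>t. f t \<omega>) \<alpha> \<beta> lam \<mu> m C r \<nu> \<theta> W W' m1 k Bb"
proof -
  \<comment> \<open>Rounding up adds less than 2 to \<nu>/2, and the result stays below \<nu>
    because \<nu> >= 4.\<close>
  define q where "q = nat \<lceil>\<nu> / 4\<rceil>"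
  have q: "q \<ge> 1" "2 * real q \<le> \<nu>" "\<nu> / 4 \<le> real q"
  proof -
    have "real q = of_int \<lceil>\<nu> / 4\<rceil>" unfolding q_def using nu by simp
    then have b: "\<nu> / 4 \<le> real q" "real q < \<nu> / 4 + 1" by linarith+
    then show "\<nu> / 4 \<le> real q" by simp
    show "2 * real q \<le> \<nu>" using b(2) nu by simp
    have "0 < real q" using b(1) nu by linarith
    then show "q \<ge> 1" by simp
  qed
  \<comment> \<open>The values come from the count in \<open>expo\<close>: the growth condition
    gains 2\<delta>, of which \<delta>/2 pays for the factor 1 + \<delta>, \<delta> for the partial
    sums, and \<delta>/2 = \<theta> remains. The choice of \<delta>' makes (N T)^\<delta>' at most a
    constant times T^(1/\<nu>).\<close>
  define \<delta> where "\<delta> = \<epsilon> / \<nu>"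
  define \<theta> where "\<theta> = \<epsilon> / (2 * \<nu>)"
  define \<delta>' where "\<delta>' = 1 / ((r + 1) * \<nu>)"
  define e1 where "e1 = (1 + \<delta>) / (2 * real q)"
  have pos: "\<delta> > 0" "\<theta> > 0" "\<delta>' > 0" "e1 \<ge> 0" using \<epsilon> nu r(2) q(1) by (auto simp: \<delta>_def \<theta>_def \<delta>'_def e1_def)
  have expo: "r * e1 + \<delta> - 1/2 \<le> - (1 / \<nu> + \<theta>)"
  proof -
    have "r * e1 \<le> r * ((1 + \<delta>) / (\<nu> / 2))"
      unfolding e1_def using q r pos nu by (intro mult_left_mono divide_left_mono) auto
    also have "\<dots> = (1/2 - 1 / \<nu> - 2 * \<delta>) * (1 + \<delta>)"
      unfolding r(1) \<delta>_def using nu by (simp add: field_simps)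
    also have "\<dots> \<le> 1/2 - 1 / \<nu> - 2 * \<delta> + \<delta> / 2"
    proof -
      have "0 \<le> 1 / \<nu>" using nu by simp
      then have "1/2 - 1 / \<nu> - 2 * \<delta> \<le> 1/2" using pos(1) by linarith
      then have "(1/2 - 1 / \<nu> - 2 * \<delta>) * \<delta> \<le> 1/2 * \<delta>" using pos(1) by (intro mult_right_mono) auto
      then show ?thesis unfolding distrib_left mult_1_right by linarith
    qed
    finally have "r * e1 \<le> 1/2 - 1 / \<nu> - 2 * \<delta> + \<delta> / 2" .
    moreover have "2 * \<theta> = \<delta>" by (simp add: \<theta>_def \<delta>_def)
    ultimately show ?thesis by linarith
  qed
  obtain k where k: "k > 0" "\<And>i t. i \<ge> 1 \<Longrightarrow> Lnorm M \<nu> (u i t) \<le> k" "\<And>t. Lnorm M \<nu> (f t) \<le> k"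
  proof -
    obtain c where c: "\<And>i t. i \<ge> 1 \<Longrightarrow> Lnorm M \<nu> (u i t) \<le> c" using A1_moment by blast
    have fe: "Lnorm M \<nu> (f t) = Lnorm M \<nu> (f 0)" for t
      by (rule trans[OF coupled_Lnorm[OF A2_shift, of 0 0 t, symmetric] coupled_Lnorm[OF A2_shift, of 0 0 0]])
    show thesis
    proof (rule that[of "\<bar>c\<bar> + \<bar>Lnorm M \<nu> (f 0)\<bar> + 1"])
      show "Lnorm M \<nu> (u i t) \<le> \<bar>c\<bar> + \<bar>Lnorm M \<nu> (f 0)\<bar> + 1" if "i \<ge> 1" for i t
        using c[OF that, of t] by linarith
      show "Lnorm M \<nu> (f t) \<le> \<bar>c\<bar> + \<bar>Lnorm M \<nu> (f 0)\<bar> + 1" for t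
        unfolding fe[of t] by linarith
    qed linarith
  qed
  have nth_m: "(\<lambda>x :: real^'k. x $ a) \<in> borel_measurable borel" for a
    by (intro borel_measurable_continuous_onI continuous_intros)
  have nth_lip: "\<bar>x $ a - z $ a\<bar> \<le> norm (x - z)" "\<bar>x $ a\<bar> \<le> norm x" for x z :: "real^'k" and a
    using component_le_norm_cart[of "x - z" a] component_le_norm_cart[of x a] by simp_all
  have um: "u i t \<in> borel_measurable M" if "i \<ge> 1" for i t using shift_measurable[OF A1_shift[OF that]] .
  have fm: "f t \<in> borel_measurable M" for t using shift_measurable[OF A2_shift] .
  obtain c where c: "c > 0" "\<And>i t. i \<ge> 1 \<Longrightarrow> c \<le> expectation (\<lambda>\<omega>. (u i t \<omega>)\<^sup>2)" using A1_var by blast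
  have lp4: "lp_le M 4 (u i t) (2 * k)" if "i \<ge> 1" for i t
    by (rule lp_le_of_powr_moment[where D = "u i t", OF _ _ _ um[OF that] um[OF that] _ shift_facts(4)[OF A1_shift[OF that]] k(2)[OF that] k(1)])
      (use nu in auto)
  \<comment> \<open>The value of \<open>abs_moment_lower_bound\<close> for the variance bound c and
    the fourth moment (2 k)^4, common to all assets and times.\<close>
  define m1 where "m1 = c / (2 * sqrt (2 * (2 * k) ^ 4 / c))"
  have m1: "m1 > 0" "\<And>i t. i \<ge> 1 \<Longrightarrow> m1 \<le> expectation (\<lambda>\<omega>. \<bar>u i t \<omega>\<bar>)"
    unfolding m1_def using c k(1) abs_moment_lower_bound[OF lp4 _ c(1) c(2)] by auto
  define \<mu> where "\<mu> = expectation (f 0)"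
  define m where "m a b = expectation (\<lambda>\<omega>. f 0 \<omega> $ a * f 0 \<omega> $ b)" for a b
  have f_eq: "expectation (\<lambda>\<omega>. h (f t \<omega>)) = expectation (\<lambda>\<omega>. h (f 0 \<omega>))" if "h \<in> borel_measurable borel" for t and h :: "real^'k \<Rightarrow> 'b::{banach, second_countable_topology}"
  proof -
    have "expectation (\<lambda>\<omega>. h (f t \<omega>)) = (\<integral>x. h x \<partial>distr M borel (f t))" using that fm by (subst integral_distr) auto
    also have "\<dots> = expectation (\<lambda>\<omega>. h (f 0 \<omega>))"
      unfolding distr_shift_eq[OF A2_shift, of t 0] using that fm by (subst integral_distr) auto
    finally show ?thesis .
  qed
  have f\<mu>: "expectation (f t) = \<mu>" for t using f_eq[of "\<lambda>x. x" t] by (simp add: \<mu>_def)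
  have lp_f: "lp_le M 4 (\<lambda>\<omega>. f t \<omega> $ a) (2 * k)" for t a
    by (rule lp_le_of_powr_moment[where D = "f t", OF _ _ _ measurable_compose[OF fm nth_m] fm _ shift_facts(4)[OF A2_shift] k(3) k(1)])
      (use nu nth_lip in auto)
  have int_f: "integrable M (\<lambda>\<omega>. f t \<omega> $ a)" for t a using lp_le_center(1)[OF _ _ lp_f] k by simp
  have int_ff: "integrable M (\<lambda>\<omega>. f t \<omega> $ a * f t \<omega> $ b)" for t a b
  proof -
    have "lp_le M 2 (\<lambda>\<omega>. f t \<omega> $ a * f t \<omega> $ b) ((2 * k) * (2 * k))"
      using k measurable_compose[OF fm nth_m] by (intro lp_le_mult[OF lp_f _ lp_f]) auto
    from lp_le_center(1)[OF _ _ this] show ?thesis using k by simp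
  qed
  have int_f0: "integrable M (f 0)"
  proof (rule Bochner_Integration.integrable_bound)
    show "integrable M (\<lambda>\<omega>. \<Sum>a\<in>UNIV. \<bar>f 0 \<omega> $ a\<bar>)" using int_f by auto
    show "AE \<omega> in M. norm (f 0 \<omega>) \<le> norm (\<Sum>a\<in>UNIV. \<bar>f 0 \<omega> $ a\<bar>)"
      by (intro AE_I2 order_trans[OF norm_le_l1_cart]) simp
  qed (rule fm)
  have \<mu>_nth: "\<mu> $ a = expectation (\<lambda>\<omega>. f 0 \<omega> $ a)" for a
    unfolding \<mu>_def using integral_bounded_linear[OF bounded_linear_vec_nth int_f0] by simp
  have cov: "pos_def (\<chi> a b. m a b - \<mu> $ a * \<mu> $ b)"
    using covariance_matrix_eq[OF A2_cov int_f int_ff] A2_cov \<mu>_nth by (simp add: m_def \<mu>_def)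
  obtain Bb where Bb: "\<And>i. i \<ge> 1 \<Longrightarrow> norm (\<beta> i) \<le> Bb"
    using B1_bounded by (auto simp: bounded_iff)
  obtain ks where ks: "ks > 0" "\<forall>\<^sub>F N in sequentially. pos_def (S_beta \<beta> N - mat ks)" using B1_posdef by blast
  have S: "\<forall>\<^sub>F N in sequentially. \<forall>x. ks * (norm x)\<^sup>2 * real N \<le> (\<Sum>i\<in>{1..N}. ((\<beta> i - (1 / real N) *\<^sub>R (\<Sum>j\<in>{1..N}. \<beta> j)) \<bullet> x)\<^sup>2)"
    using ks(2) eventually_gt_at_top[of 0]
  proof eventually_elim
    case (elim N)
    show ?case
    proof
      fix x :: "real^'k"
      have mc: "mat ks *v x = ks *\<^sub>R x"
        by (simp add: vec_eq_iff matrix_vector_mult_def mat_def if_distrib[of "\<lambda>z. z * _"] cong: if_cong)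
      have "0 \<le> x \<bullet> ((S_beta \<beta> N - mat ks) *v x)" using elim(1) by (cases "x = 0") (auto simp: pos_def_def less_imp_le)
      then have "ks * (norm x)\<^sup>2 \<le> x \<bullet> (S_beta \<beta> N *v x)"
        by (simp add: matrix_vector_mult_diff_rdistrib inner_diff_right mc power2_norm_eq_inner)
      then show "ks * (norm x)\<^sup>2 * real N \<le> (\<Sum>i\<in>{1..N}. ((\<beta> i - (1 / real N) *\<^sub>R (\<Sum>j\<in>{1..N}. \<beta> j)) \<bullet> x)\<^sup>2)"
        unfolding S_beta_quad using elim(2) by (simp add: pos_le_divide_eq)
    qed
  qed
  have AE1: "AE \<omega> in M. \<exists>W\<ge>0. \<forall>i\<ge>1. \<forall>T\<ge>1. \<bar>\<Sum>t\<in>{1..int T}. u i t \<omega>\<bar> \<le> W * real i powr e1 * real T powr (1/2 + \<delta>)"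
  proof -
    have "AE \<omega> in M. \<exists>W\<ge>0. \<forall>i\<ge>1. \<forall>T\<ge>1. \<bar>\<Sum>t\<in>{1..int T}. u i t \<omega> - expectation (u i t)\<bar> \<le> W * real i powr e1 * real T powr (1/2 + \<delta>)"
      unfolding e1_def by (rule AE_lipschitz_sums_bound[where h = "\<lambda>x. x", OF A1_shift A1_rate nu k(1,2) q(1,2) pos(1)]) auto
    then show ?thesis using A1_mean by simp
  qed
  have AE2: "AE \<omega> in M. \<exists>W\<ge>0. \<forall>i\<ge>1. \<forall>T\<ge>1. \<bar>\<Sum>t\<in>{1..int T}. \<bar>u i t \<omega>\<bar> - expectation (\<lambda>\<omega>. \<bar>u i t \<omega>\<bar>)\<bar> \<le> W * real i powr e1 * real T powr (1/2 + \<delta>)"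
    unfolding e1_def by (rule AE_lipschitz_sums_bound[where h = abs, OF A1_shift A1_rate nu k(1,2) q(1,2) pos(1)]) auto
  have AE3: "AE \<omega> in M. \<exists>W\<ge>0. \<forall>i\<ge>1. \<forall>T\<ge>1. \<bar>\<Sum>t\<in>{1..int T}. f t \<omega> $ a * u i t \<omega>\<bar> \<le> W * real i powr e1 * real T powr (1/2 + \<delta>)" for a
    unfolding e1_def
    by (rule AE_product_sums_bound[where h = "\<lambda>x. x $ a", OF A1_shift A1_rate nu k(1,2) A1_mean A2_shift k(3) B2_indep q(1,2) pos(1) nth_m nth_lip(2)]) auto
  have AE4: "AE \<omega> in M. \<exists>W\<ge>0. \<forall>N T. (\<Sum>i\<in>{1..N}. \<Sum>t\<in>{1..int T}. (u i t \<omega>)\<^sup>2) \<le> W * (real N * real T) powr (1 + \<delta>')"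
  proof (rule AE_double_sum_bound[where K = "2 * (2 * k)\<^sup>2", OF pos(3)])
    fix i t assume i: "1 \<le> (i :: nat)"
    have "2 * k > 0" using k(1) by simp
    note lm = lp_le_lower_moment[OF _ _ lp4[OF i] this, of 2, simplified]
    show "integrable M (\<lambda>\<omega>. (u i t \<omega>)\<^sup>2)" "expectation (\<lambda>\<omega>. (u i t \<omega>)\<^sup>2) \<le> 2 * (2 * k)\<^sup>2"
      using lm by auto
  qed auto
  have AE5: "AE \<omega> in M. (\<lambda>T. time_mean T (\<lambda>t. f t \<omega> $ a * f t \<omega> $ b)) \<longlonglongrightarrow> m a b" for a b
    unfolding m_def by (rule AE_shift_product_mean[OF A2_shift A2_rate nu k(1,3) nth_m nth_m nth_lip nth_lip])
  have AE6: "AE \<omega> in M. \<exists>W\<ge>0. \<forall>i\<ge>1::nat. \<forall>T\<ge>1. \<bar>\<Sum>t\<in>{1..int T}. f t \<omega> $ a - \<mu> $ a\<bar> \<le> W * real i powr ((1 + 1/4) / (2 * real 1)) * real T powr (1/2 + 1/4)" for a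
  proof -
    have "AE \<omega> in M. \<exists>W\<ge>0. \<forall>i\<ge>1::nat. \<forall>T\<ge>1. \<bar>\<Sum>t\<in>{1..int T}. f t \<omega> $ a - expectation (\<lambda>\<omega>. f t \<omega> $ a)\<bar> \<le> W * real i powr ((1 + 1/4) / (2 * real 1)) * real T powr (1/2 + 1/4)"
      by (rule AE_lipschitz_sums_bound[where h = "\<lambda>x. x $ a" and v = "\<lambda>_. f", OF A2_shift A2_rate nu k(1,3) _ _ _ nth_m nth_lip]) (use nu in auto)
    moreover have "expectation (\<lambda>\<omega>. f t \<omega> $ a) = \<mu> $ a" for t using f_eq[OF nth_m, of t a] \<mu>_nth by simp
    ultimately show ?thesis by simp
  qed
  have AE_all: "AE \<omega> in M. \<forall>a. R a \<omega>" if "\<And>a. AE \<omega> in M. R a \<omega>" for R :: "'k \<Rightarrow> 'a \<Rightarrow> bool"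
    using AE_finite_allI[of UNIV R M] that by simp
  have AE7: "AE \<omega> in M. (\<forall>a. \<exists>W\<ge>0. \<forall>i\<ge>1. \<forall>T\<ge>1. \<bar>\<Sum>t\<in>{1..int T}. f t \<omega> $ a * u i t \<omega>\<bar> \<le> W * real i powr e1 * real T powr (1/2 + \<delta>)) \<and>
      (\<forall>a b. (\<lambda>T. time_mean T (\<lambda>t. f t \<omega> $ a * f t \<omega> $ b)) \<longlonglongrightarrow> m a b) \<and>
      (\<forall>a. \<exists>W\<ge>0. \<forall>i\<ge>1::nat. \<forall>T\<ge>1. \<bar>\<Sum>t\<in>{1..int T}. f t \<omega> $ a - \<mu> $ a\<bar> \<le> W * real i powr ((1 + 1/4) / (2 * real 1)) * real T powr (1/2 + 1/4))"
    by (intro AE_conjI AE_all AE3 AE5 AE6)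
  show ?thesis using AE1 AE2 AE4 AE7 AE_space
  proof eventually_elim
    case (elim \<omega>)
    obtain W1 where W1: "W1 \<ge> 0" "\<And>i T. i \<ge> 1 \<Longrightarrow> T \<ge> 1 \<Longrightarrow> \<bar>\<Sum>t\<in>{1..int T}. u i t \<omega>\<bar> \<le> W1 * real i powr e1 * real T powr (1/2 + \<delta>)"
      using elim(1) by blast
    obtain W2 where W2: "W2 \<ge> 0" "\<And>i T. i \<ge> 1 \<Longrightarrow> T \<ge> 1 \<Longrightarrow> \<bar>\<Sum>t\<in>{1..int T}. \<bar>u i t \<omega>\<bar> - expectation (\<lambda>\<omega>. \<bar>u i t \<omega>\<bar>)\<bar> \<le> W2 * real i powr e1 * real T powr (1/2 + \<delta>)"
      using elim(2) by blast
    obtain W4 where W4: "W4 \<ge> 0" "\<And>N T. (\<Sum>i\<in>{1..N}. \<Sum>t\<in>{1..int T}. (u i t \<omega>)\<^sup>2) \<le> W4 * (real N * real T) powr (1 + \<delta>')"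
      using elim(3) by blast
    have "\<forall>a. \<exists>W. W \<ge> 0 \<and> (\<forall>i\<ge>1. \<forall>T\<ge>1. \<bar>\<Sum>t\<in>{1..int T}. f t \<omega> $ a * u i t \<omega>\<bar> \<le> W * real i powr e1 * real T powr (1/2 + \<delta>))"
      using elim(4) by auto
    from choice[OF this] obtain W3 where W3: "\<And>a. W3 a \<ge> 0" "\<And>a i T. i \<ge> 1 \<Longrightarrow> T \<ge> 1 \<Longrightarrow> \<bar>\<Sum>t\<in>{1..int T}. f t \<omega> $ a * u i t \<omega>\<bar> \<le> W3 a * real i powr e1 * real T powr (1/2 + \<delta>)"
      by blast
    \<comment> \<open>\<open>C\<close> is an arbitrary real number; \<open>C0\<close> majorizes it
      and is at least 1, so its powers behave well.\<close>
    define C0 where "C0 = \<bar>C\<bar> + 1"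
    have C0: "C0 \<ge> 1" "C \<le> C0" by (auto simp: C0_def)
    define W where "W = C0 powr e1 * (W1 + W2 + (\<Sum>a\<in>UNIV. W3 a))"
    have W3s: "0 \<le> (\<Sum>a\<in>UNIV. W3 a)" using W3(1) by (intro sum_nonneg) auto
    have W0: "W \<ge> 0" using W1(1) W2(1) W3s by (simp add: W_def)
    have W'0: "0 \<le> W4 * C0 powr \<delta>'" using W4(1) by simp
    have rate: "w * real i powr e1 * real T powr (1/2 + \<delta>) / real T \<le> W * real T powr (- (1 / \<nu> + \<theta>))"
      if "w \<le> W1 + W2 + (\<Sum>a\<in>UNIV. W3 a)" "0 \<le> w" "i \<ge> 1" "T \<ge> 1" "real i \<le> C * real T powr r" for w i T
    proof -
      have "C * real T powr r \<le> C0 * real T powr r" using C0(2) by (rule mult_right_mono) auto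
      then have "real i \<le> C0 * real T powr r" using that(5) by linarith
      then have "real i powr e1 \<le> (C0 * real T powr r) powr e1" using pos by (intro powr_mono2) auto
      also have "\<dots> = C0 powr e1 * real T powr (r * e1)" using C0 by (simp add: powr_mult powr_powr)
      finally have i: "real i powr e1 \<le> C0 powr e1 * real T powr (r * e1)" .
      have T: "real T powr (1/2 + \<delta>) / real T = real T powr (\<delta> - 1/2)"
      proof -
        have "real T powr (1/2 + \<delta> - 1) = real T powr (1/2 + \<delta>) / real T" unfolding powr_diff using that by simp
        moreover have "1/2 + \<delta> - 1 = \<delta> - 1/2" by simp
        ultimately show ?thesis by simp
      qed
      have "w * real i powr e1 * real T powr (1/2 + \<delta>) / real T = w * real i powr e1 * real T powr (\<delta> - 1/2)"
        unfolding T[symmetric] by simp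
      also have "\<dots> \<le> (W1 + W2 + (\<Sum>a\<in>UNIV. W3 a)) * (C0 powr e1 * real T powr (r * e1)) * real T powr (\<delta> - 1/2)"
        using that i by (intro mult_right_mono mult_mono) auto
      also have "\<dots> = W * real T powr (r * e1 + \<delta> - 1/2)"
        by (simp add: W_def powr_add[symmetric] algebra_simps)
      also have "\<dots> \<le> W * real T powr (- (1 / \<nu> + \<theta>))"
        using expo that W0 by (intro mult_left_mono powr_mono) auto
      finally show ?thesis .
    qed
    have "regular_path (\<lambda>i t. y i t \<omega>) (\<lambda>i t. u i t \<omega>) (\<lambda>t. f t \<omega>) \<alpha> \<beta> lam \<mu> m C r \<nu> \<theta> W (W4 * C0 powr \<delta>') m1 ks Bb"
    proof
      show "y i t \<omega> = \<alpha> i + \<beta> i \<bullet> lam + \<beta> i \<bullet> (f t \<omega> - \<mu>) + u i t \<omega>" if "i \<ge> 1" "t \<ge> 1" for i t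
        using model that elim(5) f\<mu>[of t] by (simp add: panel_model_def)
      show "\<bar>time_mean T (\<lambda>t. u i t \<omega>)\<bar> \<le> W * real T powr (- (1 / \<nu> + \<theta>))"
        if "i \<ge> 1" "T \<ge> 1" "real i \<le> C * real T powr r" for i T
      proof -
        have "\<bar>time_mean T (\<lambda>t. u i t \<omega>)\<bar> = \<bar>\<Sum>t\<in>{1..int T}. u i t \<omega>\<bar> / real T"
          by (simp add: time_mean_def abs_mult)
        also have "\<dots> \<le> W1 * real i powr e1 * real T powr (1/2 + \<delta>) / real T"
          using W1(2)[OF that(1,2)] by (intro divide_right_mono) auto
        also have "\<dots> \<le> W * real T powr (- (1 / \<nu> + \<theta>))" using W1 W2 W3s by (intro rate that) auto
        finally show ?thesis .
      qed
      show "norm (time_mean T (\<lambda>t. u i t \<omega> *\<^sub>R f t \<omega>)) \<le> W * real T powr (- (1 / \<nu> + \<theta>))"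
        if "i \<ge> 1" "T \<ge> 1" "real i \<le> C * real T powr r" for i T
      proof -
        have "norm (time_mean T (\<lambda>t. u i t \<omega> *\<^sub>R f t \<omega>)) \<le> (\<Sum>a\<in>UNIV. \<bar>time_mean T (\<lambda>t. u i t \<omega> *\<^sub>R f t \<omega>) $ a\<bar>)"
          by (rule norm_le_l1_cart)
        also have "\<dots> = (\<Sum>a\<in>UNIV. \<bar>\<Sum>t\<in>{1..int T}. f t \<omega> $ a * u i t \<omega>\<bar> / real T)"
          by (simp add: time_mean_def abs_mult mult.commute)
        also have "\<dots> \<le> (\<Sum>a\<in>UNIV. W3 a * real i powr e1 * real T powr (1/2 + \<delta>) / real T)"
          using W3(2)[OF that(1,2)] by (intro sum_mono divide_right_mono) auto
        also have "\<dots> = (\<Sum>a\<in>UNIV. W3 a) * real i powr e1 * real T powr (1/2 + \<delta>) / real T"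
          by (simp add: sum_distrib_right sum_divide_distrib)
        also have "\<dots> \<le> W * real T powr (- (1 / \<nu> + \<theta>))" using W1 W2 W3s by (intro rate that) auto
        finally show ?thesis .
      qed
      show "m1 - W * real T powr (- (1 / \<nu> + \<theta>)) \<le> time_mean T (\<lambda>t. \<bar>u i t \<omega>\<bar>)"
        if "i \<ge> 1" "T \<ge> 1" "real i \<le> C * real T powr r" for i T
      proof -
        let ?E = "\<lambda>t. expectation (\<lambda>\<omega>. \<bar>u i t \<omega>\<bar>)"
        have "\<bar>time_mean T (\<lambda>t. \<bar>u i t \<omega>\<bar> - ?E t)\<bar> = \<bar>\<Sum>t\<in>{1..int T}. \<bar>u i t \<omega>\<bar> - ?E t\<bar> / real T"
          by (simp add: time_mean_def abs_mult)
        also have "\<dots> \<le> W2 * real i powr e1 * real T powr (1/2 + \<delta>) / real T"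
          using W2(2)[OF that(1,2)] by (intro divide_right_mono) auto
        also have "\<dots> \<le> W * real T powr (- (1 / \<nu> + \<theta>))" using W1 W2 W3s by (intro rate that) auto
        finally have "\<bar>time_mean T (\<lambda>t. \<bar>u i t \<omega>\<bar>) - time_mean T ?E\<bar> \<le> W * real T powr (- (1 / \<nu> + \<theta>))"
          by (simp add: time_mean_diff)
        moreover have "m1 \<le> time_mean T ?E"
          using time_mean_mono[of T "\<lambda>_. m1" ?E] m1(2)[OF that(1)] that(2) by (simp add: time_mean_const)
        ultimately show ?thesis by linarith
      qed
      show "\<forall>\<^sub>F (N, T) in panel_limit C r. (\<Sum>i\<in>{1..N}. \<Sum>t\<in>{1..int T}. (u i t \<omega>)\<^sup>2) \<le> W4 * C0 powr \<delta>' * real T powr (1 / \<nu>) * (real N * real T)"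
        using panel_limit_facts(3)[of C r] eventually_panel_limit_T[OF eventually_ge_at_top[of 1], of C r]
      proof eventually_elim
        case (elim p)
        obtain N T where p: "p = (N, T)" by (cases p)
        have T: "T \<ge> 1" and N: "real N \<le> C * real T powr r" using elim unfolding p by auto
        have "C * real T powr r \<le> C0 * real T powr r" using C0(2) by (rule mult_right_mono) auto
        then have "real N * real T \<le> C0 * real T powr r * real T" using N by (intro mult_right_mono) auto
        also have "\<dots> = C0 * real T powr (r + 1)" using T by (simp add: powr_add)
        finally have "(real N * real T) powr \<delta>' \<le> (C0 * real T powr (r + 1)) powr \<delta>'"
          using pos by (intro powr_mono2) auto
        also have "\<dots> = C0 powr \<delta>' * real T powr (1 / \<nu>)"
          using C0 r(2) by (simp add: powr_mult powr_powr \<delta>'_def)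
        finally have le: "(real N * real T) powr \<delta>' \<le> C0 powr \<delta>' * real T powr (1 / \<nu>)" .
        have "(\<Sum>i\<in>{1..N}. \<Sum>t\<in>{1..int T}. (u i t \<omega>)\<^sup>2) \<le> W4 * (real N * real T) powr (1 + \<delta>')" by (rule W4(2))
        also have "\<dots> = W4 * ((real N * real T) powr \<delta>' * (real N * real T))" by (simp add: powr_add)
        also have "\<dots> \<le> W4 * ((C0 powr \<delta>' * real T powr (1 / \<nu>)) * (real N * real T))"
          using le W4(1) by (intro mult_left_mono mult_right_mono) auto
        finally show ?case unfolding p by (simp add: mult.assoc)
      qed
      show "(\<lambda>T. time_mean T (\<lambda>t. f t \<omega>)) \<longlonglongrightarrow> \<mu>"
      proof (rule vec_tendstoI)
        fix a
        obtain V where V: "V \<ge> 0" "\<And>i T. (i::nat) \<ge> 1 \<Longrightarrow> T \<ge> 1 \<Longrightarrow> \<bar>\<Sum>t\<in>{1..int T}. f t \<omega> $ a - \<mu> $ a\<bar> \<le> V * real i powr ((1 + 1/4) / (2 * real 1)) * real T powr (1/2 + 1/4)"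
          using elim(4)[THEN conjunct2, THEN conjunct2, THEN spec, of a] by blast
        have lim: "(\<lambda>T. V * (real T powr (1/2 + 1/4) / real T)) \<longlonglongrightarrow> 0" by real_asymp
        have "(\<lambda>T. time_mean T (\<lambda>t. f t \<omega>) $ a - \<mu> $ a) \<longlonglongrightarrow> 0"
        proof (rule Lim_null_comparison[OF _ lim])
          show "\<forall>\<^sub>F T in sequentially. norm (time_mean T (\<lambda>t. f t \<omega>) $ a - \<mu> $ a) \<le> V * (real T powr (1/2 + 1/4) / real T)"
            using eventually_ge_at_top[of 1]
          proof eventually_elim
            case (elim T)
            have nth: "time_mean T (\<lambda>t. f t \<omega>) $ a = time_mean T (\<lambda>t. f t \<omega> $ a)"
              by (simp add: time_mean_def)
            have "time_mean T (\<lambda>t. f t \<omega> $ a - \<mu> $ a) = time_mean T (\<lambda>t. f t \<omega> $ a) - \<mu> $ a"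
              unfolding time_mean_diff using elim by (simp only: time_mean_const)
            then have "norm (time_mean T (\<lambda>t. f t \<omega>) $ a - \<mu> $ a) = \<bar>time_mean T (\<lambda>t. f t \<omega> $ a - \<mu> $ a)\<bar>"
              unfolding nth by (simp only: real_norm_def)
            also have "\<dots> = \<bar>\<Sum>t\<in>{1..int T}. f t \<omega> $ a - \<mu> $ a\<bar> / real T"
              unfolding time_mean_def by (simp add: abs_mult del: sum_subtractf sum_constant)
            also have "\<dots> \<le> V * real T powr (1/2 + 1/4) / real T"
              using V(2)[of 1 T] elim by (intro divide_right_mono) (simp_all only: of_nat_1 powr_one_eq_one mult_1_right order_refl of_nat_0_le_iff)
            finally show ?case by (simp only: times_divide_eq_right)
          qed
        qed
        then show "(\<lambda>T. time_mean T (\<lambda>t. f t \<omega>) $ a) \<longlonglongrightarrow> \<mu> $ a" by (rule LIM_zero_cancel)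
      qed
      show "(\<lambda>T. time_mean T (\<lambda>t. f t \<omega> $ a * f t \<omega> $ b)) \<longlonglongrightarrow> m a b" for a b
        using elim(4)[THEN conjunct2, THEN conjunct1] by blast
    qed (fact nu pos W0 W'0 m1 ks cov Bb S)+
    then show ?case by blast
  qed
qed

end

theorem theoremB1:
  fixes M :: "'w measure"
    and y u :: "nat \<Rightarrow> int \<Rightarrow> 'w \<Rightarrow> real"
    and f :: "int \<Rightarrow> 'w \<Rightarrow> real^'k"
    and w :: "nat \<Rightarrow> 'w \<Rightarrow> real"
    and \<alpha> :: "nat \<Rightarrow> real"
    and \<beta> :: "nat \<Rightarrow> real^'k"
    and lam :: "real^'k"
    and \<nu> \<epsilon> C cu cf af :: real
    and au :: "nat \<Rightarrow> real"
    and Su :: "nat \<Rightarrow> 's measure"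
    and gu :: "nat \<Rightarrow> (nat \<Rightarrow> 's) \<Rightarrow> real"
    and \<eta>u :: "nat \<Rightarrow> int \<Rightarrow> 'w \<Rightarrow> 's"
    and \<eta>su :: "nat \<Rightarrow> int \<Rightarrow> int \<Rightarrow> nat \<Rightarrow> 'w \<Rightarrow> 's"
    and Sf :: "'q measure"
    and gf :: "(nat \<Rightarrow> 'q) \<Rightarrow> real^'k"
    and \<eta>f :: "int \<Rightarrow> 'w \<Rightarrow> 'q"
    and \<eta>sf :: "int \<Rightarrow> int \<Rightarrow> nat \<Rightarrow> 'w \<Rightarrow> 'q"
  assumes "prob_space M"
    and "\<nu> \<ge> 4"
    and model: "panel_model M y \<beta> f u \<alpha> lam"
    and A1_shift: "\<And>i. i \<ge> 1 \<Longrightarrow>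
          decomposable_shift M \<nu> (au i) cu (Su i) (gu i) (\<eta>u i) (\<eta>su i) (u i)"
    and A1_rate: "\<And>i. i \<ge> 1 \<Longrightarrow> au i > (\<nu> - 1) / (\<nu> - 2)"
    and A1_moment: "\<exists>c. \<forall>i\<ge>1. \<forall>t. Lnorm M \<nu> (u i t) \<le> c"
    and A1_mean: "\<And>i t. i \<ge> 1 \<Longrightarrow> (\<integral>\<omega>. u i t \<omega> \<partial>M) = 0"
    and A1_var: "\<exists>c>0. \<forall>i\<ge>1. \<forall>t. (\<integral>\<omega>. (u i t \<omega>)\<^sup>2 \<partial>M) \<ge> c"
    and A2_shift: "decomposable_shift M \<nu> af cf Sf gf \<eta>f \<eta>sf f"
    and A2_rate: "af > (\<nu> - 1) / (\<nu> - 2)"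
    and A2_cov: "\<And>t. pos_def (covariance_matrix M (f t))"
    and A3: "\<And>i t. i \<ge> 1 \<Longrightarrow> (\<integral>\<omega>. u i t \<omega> *\<^sub>R f t \<omega> \<partial>M) = 0"
    and A4: "\<epsilon> > 0"
    and B1_bounded: "bounded (\<beta> ` {1..})"
    and B1_posdef: "\<exists>c>0. \<forall>\<^sub>F N in sequentially. pos_def (S_beta \<beta> N - mat c)"
    and B2_indep: "\<And>i T :: nat. i \<ge> 1 \<Longrightarrow>
          indep_rv M
            (\<Pi>\<^sub>M t\<in>{1..int T}. borel) (\<lambda>\<omega>. \<lambda>t\<in>{1..int T}. u i t \<omega>)
            (\<Pi>\<^sub>M t\<in>{1..int T}. borel) (\<lambda>\<omega>. \<lambda>t\<in>{1..int T}. f t \<omega>)"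
    and B2_sum: "\<exists>c>0. \<forall>N T :: nat.
          (\<Sum>i\<in>{1..N}. \<Sum>j\<in>{1..N}. \<Sum>s\<in>{1..int T}. \<Sum>t\<in>{1..int T}.
             \<bar>\<integral>\<omega>. u i t \<omega> * u j s \<omega> \<partial>M\<bar>) \<le> c * real N * real T"
    and w_normal: "\<And>i. i \<ge> 1 \<Longrightarrow> distributed M lborel (w i) std_normal_density"
    and w_indep: "prob_space.indep_vars M (\<lambda>_. borel) w {1..}"
    and w_sample: "\<And>N T.
          indep_rv M
            (\<Pi>\<^sub>M i\<in>{1..}. borel) (\<lambda>\<omega>. \<lambda>i\<in>{1..}. w i \<omega>)
            (sample_space N T) (sample u f N T)"
  shows "(H_null \<alpha> \<longrightarrow> (\<forall>x. AE \<omega> in M.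
            ((\<lambda>(N, T). cond_prob_sample M u f N T (Z_event M \<nu> y f w N T x) \<omega>)
               \<longlongrightarrow> exp (- exp (- x))) (panel_limit C (1/2 * (\<nu>/2 - 1) - \<epsilon>)))) \<and>
         (H_alt M y \<beta> f u \<longrightarrow> (\<forall>x. AE \<omega> in M.
            ((\<lambda>(N, T). cond_prob_sample M u f N T (Z_event M \<nu> y f w N T x) \<omega>)
               \<longlongrightarrow> 0) (panel_limit C (1/2 * (\<nu>/2 - 1) - \<epsilon>))))"
proof -
  interpret prob_space M by fact
  define r where "r = 1/2 * (\<nu>/2 - 1) - \<epsilon>"
  define P where "P = (\<lambda>x N T \<omega>. cond_prob_sample M u f N T (Z_event M \<nu> y f w N T x) \<omega>)"
  define \<psi> where "\<psi> = (\<lambda>\<omega> N T. psi \<nu> N T (\<lambda>i t. y i t \<omega>) (\<lambda>t. f t \<omega>))"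
  show ?thesis
  proof (cases "r > 0")
    case False
    then show ?thesis using panel_limit_bot[of r C] by (simp add: r_def)
  next
    case True
    have rate: "(\<nu> - 1) / (\<nu> - 2) \<ge> 1" using \<open>\<nu> \<ge> 4\<close> by simp
    have reg: "AE \<omega> in M. \<exists>\<mu> m \<theta> W W' m1 k Bb.
       regular_path (\<lambda>i t. y i t \<omega>) (\<lambda>i t. u i t \<omega>) (\<lambda>t. f t \<omega>) \<alpha> \<beta> lam \<mu> m C r \<nu> \<theta> W W' m1 k Bb"
    proof (rule AE_regular_path[OF \<open>\<nu> \<ge> 4\<close> model A1_shift _ A1_moment A1_mean A1_var A2_shift _ A2_cov A4 r_def True B1_bounded B1_posdef B2_indep])
      show "au i \<ge> 1" if "i \<ge> 1" for i using A1_rate[OF that] rate by linarith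
      show "af \<ge> 1" using A2_rate rate by linarith
    qed
    \<comment> \<open>Each conditional probability is determined only up to a null set; as the pairs
      (N, T) are countable, one null set serves all of them for fixed x.\<close>
    have cp: "AE \<omega> in M. \<forall>p. fst p \<ge> 1 \<and> a_norm (fst p) > 0 \<longrightarrow>
        P x (fst p) (snd p) \<omega> = (\<Prod>i\<in>{1..fst p}. std_normal_cdf (b_norm (fst p) + a_norm (fst p) * x - \<psi> \<omega> (fst p) (snd p) i))" for x
      unfolding AE_all_countable P_def \<psi>_def
      using cond_prob_Z_event[OF model w_normal w_indep w_sample] by (intro allI AE_impI) auto
    have ev: "\<forall>\<^sub>F p in panel_limit C r. fst p \<ge> 1 \<and> a_norm (fst p) > 0"
      using eventually_panel_limit_N[OF eventually_conj[OF eventually_ge_at_top[of 1] norming_bounds(1)], of C r]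
      by (simp add: case_prod_beta')
    have transfer: "((\<lambda>(N, T). P x N T \<omega>) \<longlongrightarrow> l) (panel_limit C r)"
      if cpx: "\<forall>p. fst p \<ge> 1 \<and> a_norm (fst p) > 0 \<longrightarrow>
        P x (fst p) (snd p) \<omega> = (\<Prod>i\<in>{1..fst p}. std_normal_cdf (b_norm (fst p) + a_norm (fst p) * x - \<psi> \<omega> (fst p) (snd p) i))"
        and lim: "((\<lambda>(N, T). \<Prod>i\<in>{1..N}. std_normal_cdf (b_norm N + a_norm N * x - \<psi> \<omega> N T i)) \<longlongrightarrow> l) (panel_limit C r)" for x l \<omega>
    proof (rule Lim_transform_eventually[OF lim])
      show "\<forall>\<^sub>F p in panel_limit C r. (\<lambda>(N, T). \<Prod>i\<in>{1..N}. std_normal_cdf (b_norm N + a_norm N * x - \<psi> \<omega> N T i)) p = (\<lambda>(N, T). P x N T \<omega>) p"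
        using ev by eventually_elim (use cpx in \<open>auto simp: case_prod_beta'\<close>)
    qed
    show ?thesis unfolding r_def[symmetric]
    proof (intro conjI impI allI)
      fix x assume null: "H_null \<alpha>"
      have "AE \<omega> in M. ((\<lambda>(N, T). P x N T \<omega>) \<longlongrightarrow> exp (- exp (- x))) (panel_limit C r)"
        using reg cp[of x]
      proof eventually_elim
        case (elim \<omega>)
        from elim(1) obtain \<mu> m \<theta> W W' m1 k Bb where
          "regular_path (\<lambda>i t. y i t \<omega>) (\<lambda>i t. u i t \<omega>) (\<lambda>t. f t \<omega>) \<alpha> \<beta> lam \<mu> m C r \<nu> \<theta> W W' m1 k Bb" by blast
        then interpret R: regular_path "\<lambda>i t. y i t \<omega>" "\<lambda>i t. u i t \<omega>" "\<lambda>t. f t \<omega>" \<alpha> \<beta> lam \<mu> m C r \<nu> \<theta> W W' m1 k Bb .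
        obtain K where "\<forall>\<^sub>F (N, T) in panel_limit C r. \<forall>i\<in>{1..N}. 0 \<le> \<psi> \<omega> N T i \<and> \<psi> \<omega> N T i \<le> K * real T powr - (\<theta> * \<nu> / 2)"
          using R.psi_null null unfolding H_null_def \<psi>_def by blast
        moreover have "\<theta> * \<nu> / 2 > 0" using R.\<theta> \<open>\<nu> \<ge> 4\<close> by simp
        ultimately show ?case by (intro transfer elim(2) normal_product_tendsto_gumbel)
      qed
      then show "AE \<omega> in M. ((\<lambda>(N, T). cond_prob_sample M u f N T (Z_event M \<nu> y f w N T x) \<omega>) \<longlongrightarrow> exp (- exp (- x))) (panel_limit C r)"
        unfolding P_def .
    next
      fix x assume alt: "H_alt M y \<beta> f u"
      \<comment> \<open>If some c fitted every \<alpha> i, the representation of the panel shifted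
        by c would satisfy the null, contrary to \<open>H_alt\<close>.\<close>
      have far: "\<exists>i\<ge>1. \<alpha> i \<noteq> \<beta> i \<bullet> c" for c
      proof -
        have "panel_model M y \<beta> f u (\<lambda>i. \<alpha> i - \<beta> i \<bullet> c) (lam + c)"
          using model unfolding panel_model_def by (simp add: inner_add_right)
        then show ?thesis using alt unfolding H_alt_def by force
      qed
      have "AE \<omega> in M. ((\<lambda>(N, T). P x N T \<omega>) \<longlongrightarrow> 0) (panel_limit C r)"
        using reg cp[of x]
      proof eventually_elim
        case (elim \<omega>)
        from elim(1) obtain \<mu> m \<theta> W W' m1 k Bb where
          "regular_path (\<lambda>i t. y i t \<omega>) (\<lambda>i t. u i t \<omega>) (\<lambda>t. f t \<omega>) \<alpha> \<beta> lam \<mu> m C r \<nu> \<theta> W W' m1 k Bb" by blast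
        then interpret R: regular_path "\<lambda>i t. y i t \<omega>" "\<lambda>i t. u i t \<omega>" "\<lambda>t. f t \<omega>" \<alpha> \<beta> lam \<mu> m C r \<nu> \<theta> W W' m1 k Bb .
        obtain c where "c > 0" "\<forall>\<^sub>F (N, T) in panel_limit C r. \<exists>i\<in>{1..N}. c * real T powr (1 / 4) \<le> \<psi> \<omega> N T i"
          using R.psi_alt[OF far] unfolding \<psi>_def by blast
        then show ?case by (intro transfer elim(2) normal_product_tendsto_0[where s = "1/4"]) auto
      qed
      then show "AE \<omega> in M. ((\<lambda>(N, T). cond_prob_sample M u f N T (Z_event M \<nu> y f w N T x) \<omega>) \<longlongrightarrow> 0) (panel_limit C r)"
        unfolding P_def .
    qed
  qed
qed

end
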